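(* Consider a $\phi$-irreducible, trans-dimensional MCMC chain on $\mathcal{X}=\bigcup_{m\in\mathcal{M}}(\{m\}\times\mathcal{X}_m)$, with stationary distribution $\pi$, which is coordinate-preserving, i.e. whose between-model maps decompose as $h_{ij}=h_{ij}^{(1)}\times h_{ij}^{(2)}\times\cdots$ with each $h_{ij}^{(\ell)}$ acting solely on the $\ell$th coordinate. Suppose that for each $(m,x)\in\mathcal{X}$, when the chain starts at $X_0=(m,x)$, then, with probability $1$, it eventually accepts at least one move in each of the coordinate directions $1,2,\dots,d_m$. Then the chain is Harris recurrent.
   Context: Setting: $\mathcal{M}\subseteq\mathbf{N}$ with $|\mathcal{M}|>1$. For each $m\in\mathcal{M}$, $\mathcal{X}_m$ is an open subset of $\mathbf{R}^{d_m}$ and $f_m:\mathcal{X}_m\to(0,\infty)$ satisfies $\int_{\mathcal{X}_m}f_m\,d\lambda_m<\infty$, where $\lambda_m$ is Lebesgue measure on $\mathbf{R}^{d_m}$. Let $\pi_m$ be the probability distribution on $\mathcal{X}_m$ with density proportional to $f_m$. Let $p:\mathcal{M}\to(0,1)$ with $\sum_{m\in\mathcal{M}}p(m)=1$, and let $\pi(\{m\}\times A)=p(m)\pi_m(A)$ for measurable $A\subseteq\mathcal{X}_m$, extended by linearity to $\mathcal{X}$. Augmentation: $\tilde{\mathcal{X}}_m=\mathcal{X}_m\times[0,1]\times[0,1]\times\cdots$ with distribution $\tilde\pi_m=\pi_m\times\mathrm{Uniform}[0,1]\times\mathrm{Uniform}[0,1]\times\cdots$. Fix $0<a<1$ and an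 irreducible Markov kernel $R$ on $\mathcal{M}$ with $R(m,m')>0$ if and only if $R(m',m)>0$. For each $i,j$ with $R(i,j)>0$ there is a deterministic function $h_{ij}:\tilde{\mathcal{X}}_i\to\tilde{\mathcal{X}}_j$, with $h_{ji}=(h_{ij})^{-1}$. Coordinate-preserving means each $h_{ij}=h_{ij}^{(1)}\times h_{ij}^{(2)}\times\cdots$, where each $h_{ij}^{(\ell)}$ is a real function of a real variable acting solely on the $\ell$th coordinate, and it and its inverse are differentiable. Algorithm: from a current state $(m,x)$, first replace the coordinates $d_m+1,d_m+2,\dots$ by fresh i.i.d. $\mathrm{Uniform}[0,1]$ draws. Then, with probability $a$, propose a between-model move from $(m,x)$ to $(m',h_{mm'}(x))$ with $m'\sim R(m,\cdot)$, accepted or rejected with the Metropolis–Hastings acceptance probability (including the Jacobian of the transformation) which leaves the distribution with weights $p(m)$ and conditionals $\tilde\pi_m$ stationary. Otherwise, with probability $1-a$, choose one of the coordinates $i\in\{1,\dots,d_m\}$ uniformly at random and execute a Metropolis-within-Gibbs move for that coordinate: propose replacing $x_i$ by a draw $z$ from a density $q_{m,i}(x,\cdot)$ on $\mathbf{R}$ ($x\in\mathcal{X}_m$), giving $y$, and accept with probability $\min\left[1,\frac{f_m(y)q_{m,i}(y,x_i)}{f_m(x)q_{m,i}(x,z)}\right]$ (equal to $1$ if the denominator is $0$; proposals outside $\mathcal{X}_m$ are rejected), otherwise leave $x$ unchanged. The proposals $q_{m,i}$ are jointly measurable, give positive probability to remaining in $\mathcal{X}_m$ from every $x\in\mathcal{X}_m$,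 and are symmetrically positive: for $x,y\in\mathcal{X}_m$ differing only in coordinate $i$, $q_{m,i}(x,y_i)>0$ if and only if $q_{m,i}(y,x_i)>0$. "Accepting a move in coordinate direction $\ell$" means accepting such a Metropolis-within-Gibbs proposal for coordinate $\ell$. Since the extra coordinates are refreshed at each iteration, this is a Markov chain on $\mathcal{X}$ with stationary distribution $\pi$. For measurable $A$, $\tau_A=\inf\{n\ge1:X_n\in A\}$ ($\infty$ if never). A chain is $\phi$-irreducible if there is a nonzero $\sigma$-finite measure $\psi$ on $\mathcal{X}$ with $\mathbf{P}[\tau_A<\infty\mid X_0=z]>0$ for all $z\in\mathcal{X}$ and all measurable $A$ with $\psi(A)>0$. A $\phi$-irreducible chain with stationary distribution $\pi$ is Harris recurrent if $\mathbf{P}(\tau_A<\infty\mid X_0=z)=1$ for all measurable $A$ with $\pi(A)>0$ and all $z\in\mathcal{X}$. *)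

theory Defs
  imports "HOL-Probability.Probability"
begin

section \<open>Markov chains on a general state space\<close>

text \<open>
  The law on trajectories of the Markov chain with kernel \<open>K\<close> started at \<open>z\<close>, by the
  Ionescu-Tulcea construction: coordinate \<open>0\<close> is \<open>z\<close> and, given the past \<open>\<omega>\<close>, coordinate
  \<open>Suc n\<close> has distribution \<open>K (\<omega> n)\<close>.  This is meaningful when
  \<open>K \<in> measurable S (prob_algebra S)\<close> and \<open>z \<in> space S\<close>.
\<close>

definition markov_path :: "'s measure \<Rightarrow> ('s \<Rightarrow> 's measure) \<Rightarrow> 's \<Rightarrow> (nat \<Rightarrow> 's) measure" where
  "markov_path S K z =
     projective_family.lim UNIV
       (Ionescu_Tulcea.CI (\<lambda>n \<omega>. case n of 0 \<Rightarrow> return S z | Suc k \<Rightarrow> K (\<omega> k)) (\<lambda>_. S))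
       (\<lambda>_. S)"

definition return_time :: "'s set \<Rightarrow> (nat \<Rightarrow> 's) \<Rightarrow> enat" where
  "return_time A \<omega> = Inf {enat n | n. 1 \<le> n \<and> \<omega> n \<in> A}"

definition return_prob :: "'s measure \<Rightarrow> ('s \<Rightarrow> 's measure) \<Rightarrow> 's \<Rightarrow> 's set \<Rightarrow> real" where
  "return_prob S K z A =
     measure (markov_path S K z) {\<omega> \<in> space (markov_path S K z). return_time A \<omega> < \<infinity>}"

definition phi_irreducible :: "'s measure \<Rightarrow> ('s \<Rightarrow> 's measure) \<Rightarrow> bool" where
  "phi_irreducible S K \<longleftrightarrow>
     (\<exists>\<psi>. sets \<psi> = sets S \<and> sigma_finite_measure \<psi> \<and> emeasure \<psi> (space S) \<noteq> 0 \<and>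
       (\<forall>z\<in>space S. \<forall>A\<in>sets S. emeasure \<psi> A > 0 \<longrightarrow> return_prob S K z A > 0))"

definition stationary :: "('s \<Rightarrow> 's measure) \<Rightarrow> 's measure \<Rightarrow> bool" where
  "stationary K \<pi> \<longleftrightarrow> prob_space \<pi> \<and> \<pi> \<bind> K = \<pi>"

definition harris_recurrent :: "'s measure \<Rightarrow> ('s \<Rightarrow> 's measure) \<Rightarrow> 's measure \<Rightarrow> bool" where
  "harris_recurrent S K \<pi> \<longleftrightarrow>
     phi_irreducible S K \<and> sets \<pi> = sets S \<and> stationary K \<pi> \<and>
     (\<forall>A\<in>sets S. emeasure \<pi> A > 0 \<longrightarrow> (\<forall>z\<in>space S. return_prob S K z A = 1))"


section \<open>Trans-dimensional MCMC\<close>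

text \<open>
  A point of Euclidean \<open>d\<close>-space is an extensional function on \<open>{..<d}\<close>, so coordinates are numbered
  from \<open>0\<close>.  A point of an augmented space \<open>\<X>\<^sub>m \<times> [0,1] \<times> [0,1] \<times> \<dots>\<close> is a total function
  on \<open>nat\<close>.

  The field \<open>aux\<close> is the value set of an auxiliary \<open>Uniform[0,1]\<close> coordinate.  Besides
  \<open>{0..1}\<close> we allow \<open>{0<..<1}\<close>, which carries the same distribution: no continuous map sends the
  compact interval onto a coordinate projection of a nonempty open set, so with \<open>{0..1}\<close>
  coordinatewise bijections between augmented spaces exist only for models of equal dimension.
\<close>

record transdim =
  models :: "nat set"
  dimn :: "nat \<Rightarrow> nat"
  region :: "nat \<Rightarrow> (nat \<Rightarrow> real) set"
  dens :: "nat \<Rightarrow> (nat \<Rightarrow> real) \<Rightarrow> real"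
  weight :: "nat \<Rightarrow> real"
  jump_prob :: real
  jump :: "nat \<Rightarrow> nat \<Rightarrow> real"
  jump_map :: "nat \<Rightarrow> nat \<Rightarrow> (nat \<Rightarrow> real) \<Rightarrow> (nat \<Rightarrow> real)"
  proposal :: "nat \<Rightarrow> nat \<Rightarrow> (nat \<Rightarrow> real) \<Rightarrow> real \<Rightarrow> real"
  aux :: "real set"

definition region_lebesgue :: "transdim \<Rightarrow> nat \<Rightarrow> (nat \<Rightarrow> real) measure" where
  "region_lebesgue T m = restrict_space (\<Pi>\<^sub>M i\<in>{..<dimn T m}. lborel) (region T m)"

definition mass :: "transdim \<Rightarrow> nat \<Rightarrow> ennreal" where
  "mass T m = (\<integral>\<^sup>+x. ennreal (dens T m x) \<partial>region_lebesgue T m)"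

definition model_dist :: "transdim \<Rightarrow> nat \<Rightarrow> (nat \<Rightarrow> real) measure" where
  "model_dist T m = density (region_lebesgue T m) (\<lambda>x. ennreal (dens T m x) / mass T m)"

definition state_space :: "transdim \<Rightarrow> (nat \<times> (nat \<Rightarrow> real)) measure" where
  "state_space T =
     sigma (SIGMA m:models T. region T m)
       {A. A \<subseteq> (SIGMA m:models T. region T m) \<and>
           (\<forall>m\<in>models T. Pair m -` A \<in> sets (region_lebesgue T m))}"

definition target :: "transdim \<Rightarrow> (nat \<times> (nat \<Rightarrow> real)) measure" where
  "target T = do {
     m \<leftarrow> point_measure (models T) (\<lambda>m. ennreal (weight T m));
     x \<leftarrow> model_dist T m;
     return (state_space T) (m, x)
   }"

definition aug_region :: "transdim \<Rightarrow> nat \<Rightarrow> (nat \<Rightarrow> real) set" where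
  "aug_region T m =
     {x. restrict x {..<dimn T m} \<in> region T m \<and> (\<forall>l\<ge>dimn T m. x l \<in> aux T)}"

definition refresh :: "transdim \<Rightarrow> nat \<Rightarrow> (nat \<Rightarrow> real) \<Rightarrow> (nat \<Rightarrow> real) measure" where
  "refresh T m x =
     distr (\<Pi>\<^sub>M l\<in>UNIV. restrict_space lborel (aux T))
       (restrict_space (\<Pi>\<^sub>M l\<in>UNIV. borel) (aug_region T m))
       (\<lambda>u l. if l < dimn T m then x l else u l)"

definition coordinate_preserving :: "transdim \<Rightarrow> bool" where
  "coordinate_preserving T \<longleftrightarrow>
     (\<forall>i\<in>models T. \<forall>j\<in>models T. jump T i j > 0 \<longrightarrow>
       (\<exists>h :: nat \<Rightarrow> real \<Rightarrow> real.
         (\<forall>x\<in>aug_region T i. \<forall>l. jump_map T i j x l = h l (x l)) \<and>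
         (\<forall>l. h l differentiable_on (\<lambda>x. x l) ` aug_region T i)))"

text \<open>
  The inverse of \<open>jump_map T i j\<close> is \<open>jump_map T j i\<close> (see below), so the clause for \<open>(j, i)\<close> says
  that the inverses of the coordinate maps are differentiable as well.

  The Jacobian matrix of a coordinatewise map is diagonal, so its determinant is the infinite
  product of the partial derivatives of coordinate \<open>l\<close> in direction \<open>l\<close>.  All but finitely many
  factors are derivatives of bijections of the unit interval evaluated at independent uniform
  variables, so the partial products form a nonnegative martingale and converge almost surely
  from every starting point; the limit superior only fixes a value on the exceptional null set.
\<close>

definition jacobian :: "transdim \<Rightarrow> nat \<Rightarrow> nat \<Rightarrow> (nat \<Rightarrow> real) \<Rightarrow> ennreal" where
  "jacobian T i j x =
     limsup (\<lambda>n. \<Prod>l<n. ennreal \<bar>vector_derivative (\<lambda>t. jump_map T i j (x(l := t)) l)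
                              (at (x l) within {t. x(l := t) \<in> aug_region T i})\<bar>)"

text \<open>The auxiliary coordinates have density \<open>1\<close> and do not show up in the densities.\<close>

definition jump_accept :: "transdim \<Rightarrow> nat \<Rightarrow> nat \<Rightarrow> (nat \<Rightarrow> real) \<Rightarrow> real" where
  "jump_accept T i j x =
     (let y = jump_map T i j x;
          tgt = (\<lambda>m w. ennreal (weight T m) *
                  (ennreal (dens T m (restrict w {..<dimn T m})) / mass T m))
      in enn2real (min 1
           (tgt j y * ennreal (jump T j i) * jacobian T i j x /
            (tgt i x * ennreal (jump T i j)))))"

definition coord_accept :: "transdim \<Rightarrow> nat \<Rightarrow> nat \<Rightarrow> (nat \<Rightarrow> real) \<Rightarrow> real \<Rightarrow> real" where
  "coord_accept T m i x z =
     (let y = x(i := z);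
          num = dens T m y * proposal T m i y (x i);
          den = dens T m x * proposal T m i x z
      in if den = 0 then 1 else min 1 (num / den))"

text \<open>
  One iteration yields the new state together with a label: \<open>Some i\<close> if a
  Metropolis-within-Gibbs proposal for coordinate \<open>i\<close> was accepted, \<open>None\<close> otherwise.
\<close>

definition labelled_space :: "transdim \<Rightarrow> ((nat \<times> (nat \<Rightarrow> real)) \<times> nat option) measure" where
  "labelled_space T = state_space T \<Otimes>\<^sub>M count_space UNIV"

definition between_move ::
  "transdim \<Rightarrow> nat \<Rightarrow> (nat \<Rightarrow> real) \<Rightarrow> (nat \<Rightarrow> real)
    \<Rightarrow> ((nat \<times> (nat \<Rightarrow> real)) \<times> nat option) measure" where
  "between_move T m x x' = do {
     m' \<leftarrow> point_measure {m' \<in> models T. jump T m m' > 0} (\<lambda>m'. ennreal (jump T m m'));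
     acc \<leftarrow> measure_pmf (bernoulli_pmf (jump_accept T m m' x'));
     return (labelled_space T)
       (if acc then ((m', restrict (jump_map T m m' x') {..<dimn T m'}), None) else ((m, x), None))
   }"

definition within_move ::
  "transdim \<Rightarrow> nat \<Rightarrow> (nat \<Rightarrow> real) \<Rightarrow> ((nat \<times> (nat \<Rightarrow> real)) \<times> nat option) measure" where
  "within_move T m x = do {
     i \<leftarrow> uniform_count_measure {..<dimn T m};
     z \<leftarrow> density lborel (\<lambda>z. ennreal (proposal T m i x z));
     if x(i := z) \<in> region T m
     then do {
       acc \<leftarrow> measure_pmf (bernoulli_pmf (coord_accept T m i x z));
       return (labelled_space T) (if acc then ((m, x(i := z)), Some i) else ((m, x), None))
     }
     else return (labelled_space T) ((m, x), None)
   }"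

definition labelled_step ::
  "transdim \<Rightarrow> nat \<times> (nat \<Rightarrow> real) \<Rightarrow> ((nat \<times> (nat \<Rightarrow> real)) \<times> nat option) measure" where
  "labelled_step T = (\<lambda>(m, x). do {
     x' \<leftarrow> refresh T m x;
     jumping \<leftarrow> measure_pmf (bernoulli_pmf (jump_prob T));
     if jumping then between_move T m x x' else within_move T m x
   })"

definition mcmc_kernel :: "transdim \<Rightarrow> nat \<times> (nat \<Rightarrow> real) \<Rightarrow> (nat \<times> (nat \<Rightarrow> real)) measure" where
  "mcmc_kernel T s = distr (labelled_step T s) (state_space T) fst"

definition labelled_path ::
  "transdim \<Rightarrow> nat \<times> (nat \<Rightarrow> real) \<Rightarrow> (nat \<Rightarrow> (nat \<times> (nat \<Rightarrow> real)) \<times> nat option) measure" where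
  "labelled_path T z = markov_path (labelled_space T) (\<lambda>(s, _). labelled_step T s) (z, None)"

definition accepts_all_directions :: "transdim \<Rightarrow> nat \<times> (nat \<Rightarrow> real) \<Rightarrow> bool" where
  "accepts_all_directions T = (\<lambda>(m, x).
     AE \<omega> in labelled_path T (m, x). \<forall>i<dimn T m. \<exists>n\<ge>1. snd (\<omega> n) = Some i)"

locale transdim_mcmc =
  fixes T :: transdim
  assumes two_models: "\<exists>i\<in>models T. \<exists>j\<in>models T. i \<noteq> j"
    and dimn_pos: "m \<in> models T \<Longrightarrow> dimn T m > 0"
    and region_open: "m \<in> models T \<Longrightarrow>
      openin (product_topology (\<lambda>_. euclideanreal) {..<dimn T m}) (region T m)"
    and region_nonempty: "m \<in> models T \<Longrightarrow> region T m \<noteq> {}"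
    and dens_measurable: "m \<in> models T \<Longrightarrow> dens T m \<in> borel_measurable (region_lebesgue T m)"
    and dens_pos: "m \<in> models T \<Longrightarrow> x \<in> region T m \<Longrightarrow> dens T m x > 0"
    and mass_finite: "m \<in> models T \<Longrightarrow> mass T m < \<infinity>"
    and weight_bounds: "m \<in> models T \<Longrightarrow> weight T m \<in> {0<..<1}"
    and weight_sum: "(weight T has_sum 1) (models T)"
    and jump_prob_bounds: "jump_prob T \<in> {0<..<1}"
    and jump_nonneg: "i \<in> models T \<Longrightarrow> j \<in> models T \<Longrightarrow> jump T i j \<ge> 0"
    and jump_sum: "i \<in> models T \<Longrightarrow> (jump T i has_sum 1) (models T)"
    and jump_irreducible: "i \<in> models T \<Longrightarrow> j \<in> models T \<Longrightarrow>
      (i, j) \<in> {(k, l). k \<in> models T \<and> l \<in> models T \<and> jump T k l > 0}\<^sup>+"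
    and jump_symmetric: "i \<in> models T \<Longrightarrow> j \<in> models T \<Longrightarrow> jump T i j > 0 \<longleftrightarrow> jump T j i > 0"
    and aux_interval: "aux T = {0..1} \<or> aux T = {0<..<1}"
    and jump_map_mem: "i \<in> models T \<Longrightarrow> j \<in> models T \<Longrightarrow> jump T i j > 0 \<Longrightarrow>
      x \<in> aug_region T i \<Longrightarrow> jump_map T i j x \<in> aug_region T j"
    and jump_map_inverse: "i \<in> models T \<Longrightarrow> j \<in> models T \<Longrightarrow> jump T i j > 0 \<Longrightarrow>
      x \<in> aug_region T i \<Longrightarrow> jump_map T j i (jump_map T i j x) = x"
    and proposal_measurable: "m \<in> models T \<Longrightarrow> i < dimn T m \<Longrightarrow>
      (\<lambda>(x, z). proposal T m i x z) \<in> borel_measurable (region_lebesgue T m \<Otimes>\<^sub>M borel)"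
    and proposal_nonneg: "m \<in> models T \<Longrightarrow> i < dimn T m \<Longrightarrow> x \<in> region T m \<Longrightarrow>
      proposal T m i x z \<ge> 0"
    and proposal_density: "m \<in> models T \<Longrightarrow> i < dimn T m \<Longrightarrow> x \<in> region T m \<Longrightarrow>
      (\<integral>\<^sup>+z. ennreal (proposal T m i x z) \<partial>lborel) = 1"
    and proposal_remains: "m \<in> models T \<Longrightarrow> i < dimn T m \<Longrightarrow> x \<in> region T m \<Longrightarrow>
      emeasure (density lborel (\<lambda>z. ennreal (proposal T m i x z))) {z. x(i := z) \<in> region T m} > 0"
    and proposal_symmetric: "m \<in> models T \<Longrightarrow> i < dimn T m \<Longrightarrow> x \<in> region T m \<Longrightarrow>
      x(i := z) \<in> region T m \<Longrightarrow>
      proposal T m i x z > 0 \<longleftrightarrow> proposal T m i (x(i := z)) (x i) > 0"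

end

theory Submission
  imports Defs
begin

text \<open>
  For a stationary irreducible chain, almost every starting point hits a given set \<open>A\<close> of positive
  measure almost surely: the probability \<open>u\<close> of never hitting \<open>A\<close> satisfies \<open>u = K u\<close> almost
  everywhere, so by stationarity \<open>{u = 0}\<close> and its complement are both closed up to null sets, and
  irreducibility excludes that both have positive measure.  Hence Harris recurrence follows once
  the chain leaves every null set \<open>N\<close> almost surely, from every starting point.

  To see this for the trans-dimensional chain, split the coordinates into a set \<open>F\<close> of randomized
  ones and the remaining ones, frozen at arbitrary values \<open>c\<close>.  By induction on \<open>n\<close>, for all \<open>F\<close> and
  \<open>c\<close> and almost every choice of the coordinates in \<open>F\<close>, the chain is almost surely not in \<open>N\<close>
  after \<open>n\<close> steps with all coordinates randomized.  An accepted move in direction \<open>i\<close> adds \<open>i\<close> to \<open>F\<close> by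
  Fubini.  A jump maps frozen coordinates to frozen ones, and as the inverse coordinate maps are
  differentiable, preimages of null sets under a coordinate map are null sets.  A starting point in
  model \<open>m\<close> corresponds to \<open>F\<close> consisting of the auxiliary coordinates, and accepting a move in each
  direction makes \<open>F\<close> everything.
\<close>

section \<open>Almost-everywhere statements for kernels and product measures\<close>

text \<open>The obstacle is that the law of the chain need not become absolutely continuous:
  rejections leave mass on points with frozen coordinates, and whether a coordinate has been moved
  depends on the positions through the acceptance probabilities. Conditional laws given the
  acceptance history are therefore never computed. Each step carries a label, and the induction on
  \<open>n\<close> removes the first step, of which only the outcomes possible up to null sets
  matter: the same point after a rejection, an updated coordinate whose new value may avoid a
  Lebesgue null set, or the landing point of a jump. Acceptance probabilities enter only through
  measurability. The statement must range over all \<open>c\<close> because a jump moves frozen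
  values to other frozen values, and over all \<open>F\<close> because updates enlarge it. The
  auxiliary coordinates used by a jump are random as well, so landing points may be treated as
  randomized in more coordinates than \<open>F\<close>; the surplus is given up by monotonicity, and
  \<open>F\<close> grows through accepted updates only. As every \<open>n\<close> is treated
  separately, a union of countably many null sets handles the random time by which all directions
  have been accepted.\<close>

lemma AE_iff_nn_integral_indicator:
  assumes [measurable]: "Measurable.pred M P"
  shows "(AE x in M. P x) \<longleftrightarrow> (\<integral>\<^sup>+x. (if P x then 0 else 1) \<partial>M) = 0"
proof -
  have eq: "(if P x then 0 else 1 :: ennreal) = 0 \<longleftrightarrow> P x" for x by simp
  have m: "(\<lambda>x. if P x then 0 else 1 :: ennreal) \<in> borel_measurable M" by measurable
  show ?thesis unfolding nn_integral_0_iff_AE[OF m] eq by (rule refl)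
qed

text \<open>Tonelli for the indicator of the exceptional set, in both orders. The first puts the new
  coordinate innermost, as resampling it requires; the second fixes its value first, as an induction
  on the number of coordinates requires.\<close>

lemma (in product_sigma_finite) AE_PiM_insert:
  assumes I: "finite I" "i \<notin> I" and P[measurable]: "Measurable.pred (PiM (insert i I) M) P"
  shows "(AE x in PiM (insert i I) M. P x) \<longleftrightarrow> (AE x in PiM I M. AE t in M i. P (x(i := t)))" (is ?A)
    and "(AE x in PiM (insert i I) M. P x) \<longleftrightarrow> (AE t in M i. AE x in PiM I M. P (x(i := t)))" (is ?B)
proof -
  let ?f = "\<lambda>x. if P x then 0 else 1 :: ennreal"
  interpret I: finite_product_sigma_finite M I by standard (rule I)
  interpret PI: sigma_finite_measure "PiM I M" by (rule sigma_finite) (rule I)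
  interpret Mi: sigma_finite_measure "M i" by (rule sigma_finite_measures)
  have upd[measurable]: "(\<lambda>(x, t). x(i := t)) \<in> measurable (PiM I M \<Otimes>\<^sub>M M i) (PiM (insert i I) M)"
    by measurable
  have upd'[measurable]: "(\<lambda>(t, x). x(i := t)) \<in> measurable (M i \<Otimes>\<^sub>M PiM I M) (PiM (insert i I) M)"
    by measurable
  have fi[measurable]: "(\<lambda>t. x(i := t)) \<in> measurable (M i) (PiM (insert i I) M)" if "x \<in> space (PiM I M)" for x
    using measurable_component_update[OF that I(2)] .
  have fx[measurable]: "(\<lambda>x. x(i := t)) \<in> measurable (PiM I M) (PiM (insert i I) M)" if "t \<in> space (M i)" for t
    using that by measurable
  have "(AE x in PiM (insert i I) M. P x) \<longleftrightarrow> (\<integral>\<^sup>+x. (\<integral>\<^sup>+t. ?f (x(i := t)) \<partial>M i) \<partial>PiM I M) = 0"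
    by (subst AE_iff_nn_integral_indicator[OF P], subst product_nn_integral_insert[OF I]) simp_all
  also have "\<dots> \<longleftrightarrow> (AE x in PiM I M. (\<integral>\<^sup>+t. ?f (x(i := t)) \<partial>M i) = 0)"
    by (rule nn_integral_0_iff_AE) measurable
  also have "\<dots> \<longleftrightarrow> (AE x in PiM I M. AE t in M i. P (x(i := t)))"
    by (rule AE_cong) (subst AE_iff_nn_integral_indicator, measurable)
  finally show ?A .
  have "(AE x in PiM (insert i I) M. P x) \<longleftrightarrow> (\<integral>\<^sup>+t. (\<integral>\<^sup>+x. ?f (x(i := t)) \<partial>PiM I M) \<partial>M i) = 0"
    by (subst AE_iff_nn_integral_indicator[OF P], subst product_nn_integral_insert_rev[OF I]) simp_all
  also have "\<dots> \<longleftrightarrow> (AE t in M i. (\<integral>\<^sup>+x. ?f (x(i := t)) \<partial>PiM I M) = 0)"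
    by (rule nn_integral_0_iff_AE) measurable
  also have "\<dots> \<longleftrightarrow> (AE t in M i. AE x in PiM I M. P (x(i := t)))"
    by (rule AE_cong) (subst AE_iff_nn_integral_indicator, measurable)
  finally show ?B .
qed

lemma (in product_sigma_finite) AE_PiM_merge:
  assumes IJ: "I \<inter> J = {}" "finite I" "finite J" and P[measurable]: "Measurable.pred (PiM (I \<union> J) M) P"
  shows "(AE x in PiM (I \<union> J) M. P x) \<longleftrightarrow> (AE x in PiM I M. AE y in PiM J M. P (merge I J (x, y)))"
proof -
  let ?f = "\<lambda>x. if P x then 0 else 1 :: ennreal"
  interpret PJ: sigma_finite_measure "PiM J M" by (rule sigma_finite) (rule IJ)
  have "(AE x in PiM (I \<union> J) M. P x) \<longleftrightarrow> (\<integral>\<^sup>+x. (\<integral>\<^sup>+y. ?f (merge I J (x, y)) \<partial>PiM J M) \<partial>PiM I M) = 0"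
    by (subst AE_iff_nn_integral_indicator[OF P], subst product_nn_integral_fold[OF IJ]) simp_all
  also have "\<dots> \<longleftrightarrow> (AE x in PiM I M. (\<integral>\<^sup>+y. ?f (merge I J (x, y)) \<partial>PiM J M) = 0)"
    by (rule nn_integral_0_iff_AE) measurable
  also have "\<dots> \<longleftrightarrow> (AE x in PiM I M. AE y in PiM J M. P (merge I J (x, y)))"
    by (rule AE_cong) (subst AE_iff_nn_integral_indicator, measurable)
  finally show ?thesis .
qed

text \<open>The exceptional set is a cylinder, and a finite marginal of a product of probability
  measures is the product of the remaining factors. Here \<open>I\<close> may be infinite, which
  covers the sequence of auxiliary coordinates.\<close>

lemma (in product_prob_space) AE_PiM_restrict:
  assumes J: "finite J" "J \<subseteq> I" and P[measurable]: "Measurable.pred (PiM J M) P"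
  shows "(AE x in PiM I M. P (restrict x J)) \<longleftrightarrow> (AE x in PiM J M. P x)"
proof -
  have [measurable]: "(\<lambda>x. restrict x J) \<in> measurable (PiM I M) (PiM J M)"
    using J by (intro measurable_restrict_subset)
  have "(AE x in distr (PiM I M) (PiM J M) (\<lambda>x. restrict x J). P x) \<longleftrightarrow> (AE x in PiM I M. P (restrict x J))"
    by (rule AE_distr_iff) measurable
  then show ?thesis unfolding distr_PiM_restrict_finite[OF J] by (rule sym)
qed

lemma AE_vimage_null_sets:
  assumes P: "AE y in N. P y" and f: "\<And>Z. Z \<in> null_sets N \<Longrightarrow> f -` Z \<inter> space M \<in> null_sets M"
    and sp: "f \<in> space M \<rightarrow> space N"
  shows "AE x in M. P (f x)"
proof -
  from P obtain Z where "Z \<in> null_sets N" "{y\<in>space N. \<not> P y} \<subseteq> Z"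
    by (auto simp: eventually_ae_filter)
  with f[of Z] sp have "f -` Z \<inter> space M \<in> null_sets M" "{x\<in>space M. \<not> P (f x)} \<subseteq> f -` Z \<inter> space M"
    by auto
  then show ?thesis unfolding eventually_ae_filter by blast
qed

text \<open>Null sets of a product have no product structure, so the maps are substituted one
  coordinate at a time: by Fubini almost every section is again an almost-everywhere statement, and
  the condition on preimages is only ever used for a single \<open>f i\<close>.\<close>

lemma AE_PiM_map:
  assumes M: "product_sigma_finite M" and N: "product_sigma_finite N" and I: "finite I"
    and f: "\<And>i. i \<in> I \<Longrightarrow> f i \<in> measurable (M i) (N i)"
    and null: "\<And>i Z. i \<in> I \<Longrightarrow> Z \<in> null_sets (N i) \<Longrightarrow> f i -` Z \<inter> space (M i) \<in> null_sets (M i)"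
    and P: "Measurable.pred (PiM I N) P" "AE y in PiM I N. P y"
  shows "AE x in PiM I M. P (\<lambda>i\<in>I. f i (x i))"
  using I f null P
proof (induction I arbitrary: P)
  case empty
  from empty.prems(4) show ?case unfolding PiM_empty AE_count_space by simp
next
  case (insert i I)
  interpret M: product_sigma_finite M by fact
  interpret N: product_sigma_finite N by fact
  note [measurable] = \<open>Measurable.pred (PiM (insert i I) N) P\<close>
  have f[measurable]: "\<And>j. j \<in> insert i I \<Longrightarrow> f j \<in> measurable (M j) (N j)" by fact
  have "AE t in N i. AE y in PiM I N. P (y(i := t))"
    using insert.prems(4) by (subst (asm) N.AE_PiM_insert(2)) (use insert.hyps in auto)
  \<comment> \<open>Membership of \<open>t\<close> in the space makes the update by \<open>t\<close>
    measurable, so that the section is a legitimate predicate for the induction hypothesis.\<close>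
  then have "AE t in N i. t \<in> space (N i) \<and> (AE y in PiM I N. P (y(i := t)))"
    using AE_space by eventually_elim simp
  then have "AE t in N i. AE x in PiM I M. P ((\<lambda>j\<in>I. f j (x j))(i := t))"
  proof eventually_elim
    case (elim t)
    have upd[measurable]: "(\<lambda>y. y(i := t)) \<in> measurable (PiM I N) (PiM (insert i I) N)"
      using elim by (intro measurable_fun_upd[of _ I]) auto
    show ?case
      by (rule insert.IH[of "\<lambda>y. P (y(i := t))"]) (use elim insert.prems in auto)
  qed
  then have "AE t in M i. AE x in PiM I M. P ((\<lambda>j\<in>I. f j (x j))(i := f i t))"
    by (rule AE_vimage_null_sets) (use insert.prems(2) f[of i, THEN measurable_space] in auto)
  moreover have "(\<lambda>j\<in>I. f j (x j))(i := f i t) = (\<lambda>j\<in>insert i I. f j ((x(i := t)) j))" for x t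
    using insert.hyps by (auto simp: fun_eq_iff)
  moreover have "Measurable.pred (PiM (insert i I) M) (\<lambda>x. P (\<lambda>j\<in>insert i I. f j (x j)))"
    by (rule measurable_compose[OF measurable_restrict, of _ _ _ _ P]) measurable
  ultimately show ?case
    using insert.hyps by (subst M.AE_PiM_insert(2)) auto
qed

text \<open>Inside \<open>P\<close> the preimage of \<open>Z\<close> lies in the image of
  \<open>Z\<close> under the inverse \<open>g\<close>, and a differentiable real function maps
  Lebesgue null sets to null sets. Outside \<open>P\<close>, where \<open>h\<close> is the identity,
  the preimage lies in \<open>Z\<close> itself.\<close>

lemma null_sets_vimage_differentiable_inverse:
  fixes h g :: "real \<Rightarrow> real"
  assumes h[measurable]: "h \<in> borel_measurable borel"
    and g: "g differentiable_on P'" and inv: "\<And>t. t \<in> P \<Longrightarrow> h t \<in> P' \<and> g (h t) = t"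
    and id: "\<And>t. t \<notin> P \<Longrightarrow> h t = t"
    and Z: "Z \<in> null_sets lborel"
  shows "h -` Z \<in> null_sets lborel"
proof -
  have [measurable]: "Z \<in> sets borel" using Z by auto
  have "negligible Z"
    using Z by (simp add: negligible_iff_null_sets null_sets_completionI)
  then have "negligible (g ` (Z \<inter> P') \<union> Z)"
    using g by (intro negligible_Un negligible_differentiable_image_negligible)
      (auto intro: negligible_subset differentiable_on_subset)
  moreover have "h -` Z \<subseteq> g ` (Z \<inter> P') \<union> Z"
  proof
    fix t assume t: "t \<in> h -` Z"
    show "t \<in> g ` (Z \<inter> P') \<union> Z"
    proof (cases "t \<in> P")
      case True
      with inv[of t] t show ?thesis by (auto intro!: image_eqI[of _ g "h t"])
    next
      case False
      with id[of t] t show ?thesis by simp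
    qed
  qed
  ultimately have "negligible (h -` Z)" by (rule negligible_subset)
  \<comment> \<open>Negligibility alone places the preimage among the null sets of the completion;
    Borel measurability of \<open>h\<close> brings it back to \<open>lborel\<close>.\<close>
  moreover have "h -` Z \<in> sets lborel"
    using measurable_sets[OF h, of Z] by simp
  ultimately show ?thesis
    by (simp add: negligible_iff_null_sets null_sets_completion_iff)
qed

text \<open>At interior points the derivative is the limit of difference quotients with steps
  1/(n+1), hence a limit of Borel functions. The remaining points of \<open>P\<close> are countably
  many, and changing a Borel function there keeps it Borel. This serves the factors of the
  Jacobian.\<close>

lemma borel_measurable_vector_derivative_within:
  fixes h :: "real \<Rightarrow> real"
  assumes h: "h differentiable_on P" and P[measurable]: "P \<in> sets borel" and fr: "countable (P - interior P)"
  shows "(\<lambda>t. if t \<in> P then vector_derivative h (at t within P) else 0) \<in> borel_measurable borel"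
proof -
  \<comment> \<open>The quotients evaluate the function at points that may lie outside
    \<open>P\<close>. The extension by zero is Borel, since \<open>h\<close> is continuous on
    \<open>P\<close>, and it agrees with \<open>h\<close> near interior points.\<close>
  define h0 where "h0 t = (if t \<in> P then h t else 0)" for t
  have [measurable]: "h0 \<in> borel_measurable borel"
    unfolding h0_def using differentiable_imp_continuous_on[OF h]
    by (intro borel_measurable_continuous_on_if) auto
  define D where "D t = (if t \<in> interior P then lim (\<lambda>n. (h0 (t + 1 / real (Suc n)) - h0 t) / (1 / real (Suc n))) else 0)" for t
  have [measurable]: "interior P \<in> sets borel" by simp
  have D: "D \<in> borel_measurable borel" unfolding D_def by measurable
  show ?thesis
  proof (rule measurable_discrete_difference[OF D fr])
    fix t :: real assume "t \<notin> P - interior P"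
    show "D t = (if t \<in> P then vector_derivative h (at t within P) else 0)"
    proof (cases "t \<in> interior P")
      case True
      then have tP: "t \<in> P" using interior_subset by auto
      have at_eq: "at t within P = at t" using True by (rule at_within_interior)
      have "h differentiable at t" using h tP at_eq by (auto simp: differentiable_on_def)
      then have "(h has_vector_derivative vector_derivative h (at t)) (at t)"
        by (simp add: vector_derivative_works)
      then have "(h has_field_derivative vector_derivative h (at t)) (at t)"
        by (simp add: has_real_derivative_iff_has_vector_derivative)
      then have "(h0 has_field_derivative vector_derivative h (at t)) (at t)"
        by (rule has_field_derivative_transform_within_open[OF _ open_interior True])
          (use interior_subset in \<open>auto simp: h0_def\<close>)
      then have "((\<lambda>u. (h0 (t + u) - h0 t) / u) \<longlongrightarrow> vector_derivative h (at t)) (at 0)"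
        by (simp add: DERIV_def)
      moreover have "filterlim (\<lambda>n. 1 / real (Suc n)) (at 0) sequentially"
        unfolding filterlim_at using LIMSEQ_Suc[OF lim_1_over_n[where 'a=real]] by auto
      ultimately have "(\<lambda>n. (h0 (t + 1 / real (Suc n)) - h0 t) / (1 / real (Suc n))) \<longlonglongrightarrow> vector_derivative h (at t)"
        by (rule filterlim_compose)
      then have "D t = vector_derivative h (at t)" using True by (simp add: D_def limI)
      then show ?thesis using tP at_eq by simp
    next
      case False
      then show ?thesis using \<open>t \<notin> P - interior P\<close> by (auto simp: D_def)
    qed
  qed auto
qed

section \<open>Measurability of almost-sure statements and of randomized choices\<close>

lemma pred_AE_kernel:
  assumes k: "k \<in> measurable M (subprob_algebra L)" and P: "Measurable.pred L P"
  shows "Measurable.pred M (\<lambda>s. AE p in k s. P p)"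
proof -
  have A: "{p\<in>space L. \<not> P p} \<in> sets L"
    using P by (rule predE[OF pred_intros_logic(2)])
  have [measurable]: "(\<lambda>s. emeasure (k s) {p\<in>space L. \<not> P p}) \<in> borel_measurable M"
    by (rule measurable_compose[OF k measurable_emeasure_subprob_algebra[OF A]])
  have "Measurable.pred M (\<lambda>s. emeasure (k s) {p\<in>space L. \<not> P p} = 0)"
    by measurable
  moreover have "(AE p in k s. P p) \<longleftrightarrow> emeasure (k s) {p\<in>space L. \<not> P p} = 0" if "s \<in> space M" for s
    using subprob_measurableD[OF k that] A by (subst AE_iff_null) (auto simp: null_sets_def)
  ultimately show ?thesis by (rule measurable_cong[THEN iffD2, rotated])
qed

lemma (in sigma_finite_measure) pred_AE:
  assumes P: "Measurable.pred (N \<Otimes>\<^sub>M M) (\<lambda>p. P (fst p) (snd p))"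
  shows "Measurable.pred N (\<lambda>x. AE z in M. P x z)"
proof -
  note [measurable] = P
  have "(\<lambda>(x, z). if P x z then 0 else 1 :: ennreal) \<in> borel_measurable (N \<Otimes>\<^sub>M M)"
    unfolding split_beta' by measurable
  then have [measurable]: "(\<lambda>x. \<integral>\<^sup>+z. (if P x z then 0 else 1) \<partial>M) \<in> borel_measurable N"
    by (rule borel_measurable_nn_integral)
  have "Measurable.pred M (P x)" if "x \<in> space N" for x
    using measurable_compose[OF measurable_Pair1'[OF that] P] by simp
  then have "(AE z in M. P x z) \<longleftrightarrow> (\<integral>\<^sup>+z. (if P x z then 0 else 1) \<partial>M) = 0" if "x \<in> space N" for x
    using that by (intro AE_iff_nn_integral_indicator)
  moreover have "Measurable.pred N (\<lambda>x. (\<integral>\<^sup>+z. (if P x z then 0 else 1) \<partial>M) = (0 :: ennreal))"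
    by measurable
  ultimately show ?thesis by (rule measurable_cong[THEN iffD2])
qed

text \<open>On a discrete index space every family of probability measures is a kernel, so a mixture
  can be checked index by index. This covers coins, the choice of a coordinate and the choice of a
  model.\<close>

lemma AE_bind_countable:
  assumes P: "sets P = sets (count_space J)" and g: "\<And>j. j \<in> J \<Longrightarrow> g j \<in> space (prob_algebra R)"
    and Q: "Measurable.pred R Q" "\<And>j. j \<in> J \<Longrightarrow> AE y in g j. Q y"
  shows "AE y in P \<bind> g. Q y"
proof -
  have space_P: "space P = J" using sets_eq_imp_space_eq[OF P] by simp
  have "g \<in> measurable (count_space J) (prob_algebra R)" using g by (auto simp del: space_prob_algebra)
  then have g': "g \<in> measurable P (subprob_algebra R)"
    by (intro measurable_prob_algebraD) (simp add: measurable_cong_sets[OF P refl])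
  show ?thesis
    unfolding AE_bind[OF g' Q(1)]
  proof (rule AE_I2)
    fix j assume "j \<in> space P"
    then show "AE y in g j. Q y" unfolding space_P by (rule Q(2))
  qed
qed

lemma bind_countable_in_prob_algebra:
  assumes P: "prob_space P" "sets P = sets (count_space J)"
    and g: "\<And>j. j \<in> J \<Longrightarrow> g j \<in> space (prob_algebra R)"
  shows "P \<bind> g \<in> space (prob_algebra R)"
proof -
  have A: "P \<in> space (prob_algebra (count_space J))" using P by (simp add: space_prob_algebra)
  have B: "g \<in> measurable (count_space J) (prob_algebra R)" using g by auto
  show ?thesis
    using prob_space_bind'[OF A B] sets_bind'[OF A B] by (simp add: space_prob_algebra)
qed

context
begin

interpretation pmf_as_function .

text \<open>The parameter is clamped to the unit interval, so this formula holds for every real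
  \<open>p\<close> and gives measurability in the parameter directly.\<close>

lemma pmf_bernoulli:
  "pmf (bernoulli_pmf p) b = (if b then min 1 (max 0 p) else 1 - min 1 (max 0 p))"
  by transfer simp

end

lemma measurable_bernoulli_pmf [measurable (raw)]:
  assumes [measurable]: "f \<in> borel_measurable M"
  shows "(\<lambda>x. measure_pmf (bernoulli_pmf (f x))) \<in> measurable M (prob_algebra (count_space UNIV))"
proof (rule measurable_prob_algebraI)
  show "(\<lambda>x. measure_pmf (bernoulli_pmf (f x))) \<in> measurable M (subprob_algebra (count_space UNIV))"
  proof (rule measurable_subprob_algebra)
    fix A :: "bool set"
    have "(\<lambda>x. pmf (bernoulli_pmf (f x)) b) \<in> borel_measurable M" for b
      by (cases b) (simp_all add: pmf_bernoulli)
    then have "(\<lambda>x. \<Sum>b\<in>A. ennreal (pmf (bernoulli_pmf (f x)) b)) \<in> borel_measurable M"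
      by measurable
    then show "(\<lambda>x. emeasure (measure_pmf (bernoulli_pmf (f x))) A) \<in> borel_measurable M"
      by (simp add: emeasure_measure_pmf_finite)
  qed (auto intro: measure_pmf.subprob_space_axioms)
qed (rule measure_pmf.prob_space_axioms)

lemma measurable_density_kernel:
  fixes q :: "'a \<Rightarrow> real \<Rightarrow> ennreal"
  assumes q: "(\<lambda>(x, z). q x z) \<in> borel_measurable (M \<Otimes>\<^sub>M lborel)"
    and total: "\<And>x. x \<in> space M \<Longrightarrow> (\<integral>\<^sup>+z. q x z \<partial>lborel) = 1"
  shows "(\<lambda>x. density lborel (q x)) \<in> measurable M (prob_algebra lborel)"
proof (rule measurable_prob_algebraI)
  have qx: "q x \<in> borel_measurable lborel" if "x \<in> space M" for x
    using measurable_compose[OF measurable_Pair1'[OF that] q] by simp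
  show prob: "prob_space (density lborel (q x))" if "x \<in> space M" for x
    using qx[OF that] total[OF that] by (intro prob_spaceI) (auto simp: emeasure_density)
  show "(\<lambda>x. density lborel (q x)) \<in> measurable M (subprob_algebra lborel)"
  proof (rule measurable_subprob_algebra)
    fix A :: "real set" assume [measurable]: "A \<in> sets lborel"
    have "(\<lambda>(x, z). q x z * indicator A z) \<in> borel_measurable (M \<Otimes>\<^sub>M lborel)"
      using q by (simp add: split_beta')
    then have "(\<lambda>x. \<integral>\<^sup>+z. q x z * indicator A z \<partial>lborel) \<in> borel_measurable M"
      by (rule lborel.borel_measurable_nn_integral)
    then show "(\<lambda>x. emeasure (density lborel (q x)) A) \<in> borel_measurable M"
      by (rule measurable_cong[THEN iffD1, rotated]) (subst emeasure_density[OF qx \<open>A \<in> sets lborel\<close>], auto)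
  qed (auto intro: prob_space_imp_subprob_space prob)
qed

lemma measurable_bind_countable:
  assumes J: "countable J" and P: "prob_space P" "sets P = sets (count_space J)"
    and g: "\<And>j. j \<in> J \<Longrightarrow> (\<lambda>x. g x j) \<in> measurable M (prob_algebra R)"
  shows "(\<lambda>x. P \<bind> g x) \<in> measurable M (prob_algebra R)"
proof (rule measurable_bind_prob_space2)
  show "(\<lambda>x. P) \<in> measurable M (prob_algebra (count_space J))"
    using P by (intro measurable_const) (simp add: space_prob_algebra)
  show "(\<lambda>(x, j). g x j) \<in> measurable (M \<Otimes>\<^sub>M count_space J) (prob_algebra R)"
    unfolding split_beta'
    by (rule measurable_compose_countable'[of J "\<lambda>j p. g (fst p) j" _ _ snd])
      (use g in \<open>auto intro: measurable_compose[OF measurable_fst] J\<close>)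
qed

lemma nn_integral_count_space_has_sum:
  fixes f :: "nat \<Rightarrow> real"
  assumes f: "\<And>i. i \<in> A \<Longrightarrow> f i \<ge> 0" and s: "(f has_sum s) A"
  shows "(\<integral>\<^sup>+i. ennreal (f i) \<partial>count_space A) = ennreal s"
proof -
  let ?g = "\<lambda>i. if i \<in> A then f i else 0"
  have "(?g has_sum s) UNIV"
    using s by (subst has_sum_cong_neutral[of A UNIV f ?g]) auto
  then have "?g sums s" by (rule has_sum_imp_sums)
  then have "(\<Sum>i. ennreal (?g i)) = ennreal s"
    using f by (intro suminf_ennreal_eq) auto
  moreover have "(\<integral>\<^sup>+i. ennreal (f i) \<partial>count_space A) = (\<integral>\<^sup>+i. ennreal (?g i) \<partial>count_space UNIV)"
    by (subst nn_integral_count_space_indicator) (auto intro!: nn_integral_cong simp: indicator_def)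
  ultimately show ?thesis by (simp add: nn_integral_count_space_nat)
qed

section \<open>The path measure of a Markov chain\<close>

locale markov_kernel =
  fixes S :: "'s measure" and K :: "'s \<Rightarrow> 's measure"
  assumes kernel: "K \<in> measurable S (prob_algebra S)"
begin

lemma kernel_subprob [measurable]: "K \<in> measurable S (subprob_algebra S)"
  using kernel by (rule measurable_prob_algebraD)

lemma prob_space_kernel: "z \<in> space S \<Longrightarrow> prob_space (K z)"
  and sets_kernel: "z \<in> space S \<Longrightarrow> sets (K z) = sets S"
  and space_kernel: "z \<in> space S \<Longrightarrow> space (K z) = space S"
  using measurable_space[OF kernel]
  by (auto simp: space_prob_algebra dest: sets_eq_imp_space_eq)

lemma Ionescu_Tulcea_kernel:
  assumes "z \<in> space S"
  shows "Ionescu_Tulcea (\<lambda>n \<omega>. case n of 0 \<Rightarrow> return S z | Suc k \<Rightarrow> K (\<omega> k)) (\<lambda>_. S)"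
proof (rule Ionescu_Tulcea.intro)
  fix n :: nat
  show "(\<lambda>\<omega>. case n of 0 \<Rightarrow> return S z | Suc k \<Rightarrow> K (\<omega> k))
      \<in> measurable (Pi\<^sub>M {0..<n} (\<lambda>_. S)) (subprob_algebra S)"
  proof (cases n)
    case 0
    then show ?thesis using assms
      by (auto intro!: measurable_const simp: space_subprob_algebra prob_space_return prob_space_imp_subprob_space)
  next
    case (Suc k)
    then show ?thesis by simp
  qed
next
  fix n :: nat and \<omega> assume "\<omega> \<in> space (Pi\<^sub>M {0..<n} (\<lambda>_. S))"
  then show "prob_space (case n of 0 \<Rightarrow> return S z | Suc k \<Rightarrow> K (\<omega> k))"
    using assms by (cases n) (auto simp: prob_space_return space_PiM PiE_iff intro!: prob_space_kernel)
qed

text \<open>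
  Finite-dimensional boxes suffice for uniqueness, and this form of the Markov property is easily
  checked for the images of path laws under shifts and projections.
\<close>

definition path_law :: "'s \<Rightarrow> (nat \<Rightarrow> 's) measure \<Rightarrow> bool" where
  "path_law z Q \<longleftrightarrow> prob_space Q \<and> sets Q = sets (\<Pi>\<^sub>M i\<in>UNIV. S) \<and>
     (\<forall>B\<in>sets S. emeasure Q {\<omega>\<in>space Q. \<omega> 0 \<in> B} = indicator B z) \<and>
     (\<forall>A n. (\<forall>i. A i \<in> sets S) \<longrightarrow>
        emeasure Q {\<omega>\<in>space Q. \<forall>i\<le>Suc n. \<omega> i \<in> A i} =
        (\<integral>\<^sup>+\<omega>. indicator {\<omega>. \<forall>i\<le>n. \<omega> i \<in> A i} \<omega> * emeasure (K (\<omega> n)) (A (Suc n)) \<partial>Q))"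

text \<open>On cylinders over an initial segment the limit measure is \<open>IT.C 0 n\<close>. Both
  clauses of \<open>path_law\<close> speak of such cylinders, and unrolling the last step of
  \<open>IT.C\<close> produces the integral against \<open>K\<close>.\<close>

lemma path_law_markov_path:
  assumes z: "z \<in> space S"
  shows "path_law z (markov_path S K z)"
proof -
  interpret IT: Ionescu_Tulcea "\<lambda>n \<omega>. case n of 0 \<Rightarrow> return S z | Suc k \<Rightarrow> K (\<omega> k)" "\<lambda>_. S"
    by (rule Ionescu_Tulcea_kernel[OF z])
  define Q where "Q = markov_path S K z"
  have Q: "Q = IT.PF.lim" by (simp add: Q_def markov_path_def)
  have sets_Q[measurable_cong, simp]: "sets Q = sets (\<Pi>\<^sub>M i\<in>UNIV. S)" by (simp add: Q)
  have space_Q[simp]: "space Q = space (\<Pi>\<^sub>M i\<in>UNIV. S)" by (simp add: Q)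
  have emb: "emeasure Q (prod_emb UNIV (\<lambda>_. S) {0..<n} X) = emeasure (IT.C 0 n (\<lambda>_. undefined)) X"
    if "X \<in> sets (Pi\<^sub>M {0..<n} (\<lambda>_. S))" for n X
    unfolding Q using that sets.sets_into_space[OF that] IT.emeasure_CI[of "{0..<n}" n X]
    by (subst IT.lim) (auto simp: prod_emb_id space_PiM)
  have distr: "distr Q (Pi\<^sub>M {0..<n} (\<lambda>_. S)) (\<lambda>\<omega>. restrict \<omega> {0..<n}) = IT.C 0 n (\<lambda>_. undefined)" for n
  proof (rule measure_eqI)
    have u: "(\<lambda>_. undefined) \<in> space (Pi\<^sub>M {0..<0::nat} (\<lambda>_. S))" by (simp add: space_PiM)
    show *: "sets (distr Q (Pi\<^sub>M {0..<n} (\<lambda>_. S)) (\<lambda>\<omega>. restrict \<omega> {0..<n})) = sets (IT.C 0 n (\<lambda>_. undefined))"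
      using IT.sets_C[OF u, of n] by simp
    fix X assume "X \<in> sets (distr Q (Pi\<^sub>M {0..<n} (\<lambda>_. S)) (\<lambda>\<omega>. restrict \<omega> {0..<n}))"
    then have [measurable]: "X \<in> sets (Pi\<^sub>M {0..<n} (\<lambda>_. S))" by simp
    show "emeasure (distr Q (Pi\<^sub>M {0..<n} (\<lambda>_. S)) (\<lambda>\<omega>. restrict \<omega> {0..<n})) X = emeasure (IT.C 0 n (\<lambda>_. undefined)) X"
      by (subst emb[symmetric], simp, subst emeasure_distr)
        (auto intro!: measurable_restrict_subset arg_cong[where f="emeasure Q"] simp: prod_emb_def space_PiM)
  qed
  \<comment> \<open>The projection to no coordinates at all already carries the total mass.\<close>
  have "prob_space Q"
  proof (rule prob_space_distrD)
    show "(\<lambda>\<omega>. restrict \<omega> {0..<0}) \<in> measurable Q (Pi\<^sub>M {0..<0} (\<lambda>_. S))" by simp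
    show "prob_space (distr Q (Pi\<^sub>M {0..<0} (\<lambda>_. S)) (\<lambda>\<omega>. restrict \<omega> {0..<0}))"
      unfolding distr by (rule IT.prob_space_C) (simp add: space_PiM)
  qed
  moreover have "emeasure Q {\<omega>\<in>space Q. \<omega> 0 \<in> B} = indicator B z" if B[measurable]: "B \<in> sets S" for B
  proof -
    have eq: "{\<omega>\<in>space Q. \<omega> 0 \<in> B} = prod_emb UNIV (\<lambda>_. S) {0..<Suc 0} (Pi\<^sub>E {0..<Suc 0} (\<lambda>_. B))"
      using sets.sets_into_space[OF B] by (auto simp: prod_emb_def space_PiM)
    have "emeasure Q {\<omega>\<in>space Q. \<omega> 0 \<in> B} = emeasure (IT.C 0 (Suc 0) (\<lambda>_. undefined)) (Pi\<^sub>E {0..<Suc 0} (\<lambda>_. B))"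
      unfolding eq by (rule emb) (intro sets_PiM_I_finite; simp)
    also have "\<dots> = emeasure (IT.eP 0 (\<lambda>_. undefined)) (Pi\<^sub>E {0..<Suc 0} (\<lambda>_. B))"
      using bind_return[OF IT.measurable_eP[of 0], of "\<lambda>_. undefined"] by (simp add: space_PiM)
    also have "\<dots> = emeasure (return S z) ((\<lambda>x. fun_upd (\<lambda>_. undefined) 0 x) -` (Pi\<^sub>E {0..<Suc 0} (\<lambda>_. B)) \<inter> space S)"
      by (subst IT.emeasure_eP) (auto simp: space_PiM intro!: sets_PiM_I_finite)
    also have "((\<lambda>x. fun_upd (\<lambda>_. undefined) 0 x) -` (Pi\<^sub>E {0..<Suc 0} (\<lambda>_. B)) \<inter> space S) = B"
    proof -
      have "fun_upd (\<lambda>_. undefined) 0 x \<in> Pi\<^sub>E {0..<Suc 0} (\<lambda>_. B) \<longleftrightarrow> x \<in> B" for x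
        unfolding PiE_iff extensional_def by simp
      with sets.sets_into_space[OF B] show ?thesis by blast
    qed
    finally show ?thesis by simp
  qed
  moreover have "emeasure Q {\<omega>\<in>space Q. \<forall>i\<le>Suc n. \<omega> i \<in> A i} =
        (\<integral>\<^sup>+\<omega>. indicator {\<omega>. \<forall>i\<le>n. \<omega> i \<in> A i} \<omega> * emeasure (K (\<omega> n)) (A (Suc n)) \<partial>Q)"
    if A[measurable]: "\<And>i. A i \<in> sets S" for A n
  proof -
    let ?X = "Pi\<^sub>E {0..<Suc (Suc n)} A"
    have [measurable]: "?X \<in> sets (Pi\<^sub>M {0..<Suc (Suc n)} (\<lambda>_. S))"
      by (simp add: sets_PiM_I_finite del: PiE_insert_eq)
    have "{\<omega>\<in>space Q. \<forall>i\<le>Suc n. \<omega> i \<in> A i} = prod_emb UNIV (\<lambda>_. S) {0..<Suc (Suc n)} ?X"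
      using sets.sets_into_space[OF A] by (auto simp: prod_emb_def space_PiM PiE_iff)
    then have "emeasure Q {\<omega>\<in>space Q. \<forall>i\<le>Suc n. \<omega> i \<in> A i} = emeasure (IT.C 0 (Suc (Suc n)) (\<lambda>_. undefined)) ?X"
      by (simp add: emb del: IT.C.simps)
    also have "\<dots> = emeasure (IT.C 0 (Suc n) (\<lambda>_. undefined) \<bind> IT.eP (Suc n)) ?X" by simp
    also have "\<dots> = (\<integral>\<^sup>+\<omega>. emeasure (IT.eP (Suc n) \<omega>) ?X \<partial>IT.C 0 (Suc n) (\<lambda>_. undefined))"
    proof (rule emeasure_bind)
      show "space (IT.C 0 (Suc n) (\<lambda>_. undefined)) \<noteq> {}"
        by (rule prob_space.not_empty, rule IT.prob_space_C) (simp add: space_PiM)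
      have "sets (IT.C 0 (Suc n) (\<lambda>_. undefined)) = sets (Pi\<^sub>M {0..<Suc n} (\<lambda>_. S))"
        using IT.sets_C[of "\<lambda>_. undefined" 0 "Suc n"] by (simp add: space_PiM)
      then show "IT.eP (Suc n) \<in> measurable (IT.C 0 (Suc n) (\<lambda>_. undefined)) (subprob_algebra (Pi\<^sub>M {0..<Suc (Suc n)} (\<lambda>_. S)))"
        using IT.measurable_eP[of "Suc n"] by (simp cong: measurable_cong_sets)
    qed simp
    also have "\<dots> = (\<integral>\<^sup>+\<omega>. indicator {\<omega>. \<forall>i\<le>n. \<omega> i \<in> A i} \<omega> * emeasure (K (\<omega> n)) (A (Suc n)) \<partial>IT.C 0 (Suc n) (\<lambda>_. undefined))"
    proof (rule nn_integral_cong)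
      fix \<omega> assume "\<omega> \<in> space (IT.C 0 (Suc n) (\<lambda>_. undefined))"
      then have \<omega>: "\<omega> \<in> space (Pi\<^sub>M {0..<Suc n} (\<lambda>_. S))"
        using IT.space_C[of "\<lambda>_. undefined" 0 "Suc n"] by (simp add: space_PiM)
      have "emeasure (IT.eP (Suc n) \<omega>) ?X = emeasure (K (\<omega> n)) ((\<lambda>x. fun_upd \<omega> (Suc n) x) -` ?X \<inter> space S)"
        using IT.emeasure_eP[OF \<omega>, of ?X] by simp
      also have "(\<lambda>x. fun_upd \<omega> (Suc n) x) -` ?X \<inter> space S = (if \<forall>i\<le>n. \<omega> i \<in> A i then A (Suc n) else {})"
      proof -
        have "fun_upd \<omega> (Suc n) x \<in> ?X \<longleftrightarrow> (\<forall>i\<le>n. \<omega> i \<in> A i) \<and> x \<in> A (Suc n)" for x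
          using \<omega> unfolding PiE_iff extensional_def space_PiM
          by (force simp: less_Suc_eq_le le_Suc_eq)
        with sets.sets_into_space[OF A] show ?thesis by (auto simp del: fun_upd_apply)
      qed
      finally show "emeasure (IT.eP (Suc n) \<omega>) ?X = indicator {\<omega>. \<forall>i\<le>n. \<omega> i \<in> A i} \<omega> * emeasure (K (\<omega> n)) (A (Suc n))"
        by auto
    qed
    also have "\<dots> = (\<integral>\<^sup>+\<omega>. indicator {\<omega>. \<forall>i\<le>n. \<omega> i \<in> A i} \<omega> * emeasure (K (\<omega> n)) (A (Suc n)) \<partial>Q)"
    proof -
      have "(\<lambda>\<omega>. indicator {\<omega>. \<forall>i\<le>n. \<omega> i \<in> A i} \<omega> * emeasure (K (\<omega> n)) (A (Suc n))) \<in> borel_measurable (Pi\<^sub>M {0..<Suc n} (\<lambda>_. S))"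
      proof -
        have *: "(\<lambda>\<omega>. indicator {\<omega>. \<forall>i\<le>n. \<omega> i \<in> A i} \<omega> * emeasure (K (\<omega> n)) (A (Suc n)))
          = (\<lambda>\<omega>. (\<Prod>i\<le>n. indicator (A i) (\<omega> i)) * emeasure (K (\<omega> n)) (A (Suc n)))"
          by (auto simp: fun_eq_iff indicator_def prod.If_cases)
        show ?thesis unfolding * by measurable
      qed
      then show ?thesis
        unfolding distr[symmetric]
        by (subst nn_integral_distr) (auto intro!: measurable_restrict_subset nn_integral_cong simp: indicator_def)
    qed
    finally show ?thesis .
  qed
  ultimately show ?thesis
    by (simp add: path_law_def flip: Q_def)
qed

abbreviation paths :: "(nat \<Rightarrow> 's) measure" where
  "paths \<equiv> \<Pi>\<^sub>M i\<in>UNIV. S"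

lemma path_law_prob: "path_law z Q \<Longrightarrow> prob_space Q"
  and path_law_sets: "path_law z Q \<Longrightarrow> sets Q = sets paths"
  and path_law_space: "path_law z Q \<Longrightarrow> space Q = space paths"
  by (auto simp: path_law_def dest: sets_eq_imp_space_eq)

lemma pred_box:
  assumes A: "\<And>i. A i \<in> sets S"
  shows "Measurable.pred paths (\<lambda>\<omega>. \<forall>i\<le>n::nat. \<omega> i \<in> A i)"
proof -
  have "Measurable.pred paths (\<lambda>\<omega>. \<forall>i\<in>{..n}. \<omega> i \<in> A i)"
  proof (intro pred_intros_finite)
    fix i show "Measurable.pred paths (\<lambda>\<omega>. \<omega> i \<in> A i)"
      using A[of i] by measurable
  qed simp
  then show ?thesis unfolding Ball_def atMost_iff .
qed

lemma sets_box:
  assumes "\<And>i. A i \<in> sets S"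
  shows "{\<omega>\<in>space paths. \<forall>i\<le>n::nat. \<omega> i \<in> A i} \<in> sets paths"
  by (rule predE[OF pred_box[of A n, OF assms]])

lemma measurable_indicator_box:
  assumes "\<And>i. A i \<in> sets S"
  shows "(\<lambda>\<omega>. indicator {\<omega>. \<forall>i\<le>n::nat. \<omega> i \<in> A i} \<omega> :: ennreal) \<in> borel_measurable paths"
  by (rule measurable_cong[THEN iffD1, OF _ borel_measurable_indicator[OF sets_box[of A n, OF assms]]])
    (simp add: indicator_def)

lemma path_law_emeasure_start:
  "path_law z Q \<Longrightarrow> B \<in> sets S \<Longrightarrow> emeasure Q {\<omega>\<in>space Q. \<omega> 0 \<in> B} = indicator B z"
  by (simp add: path_law_def)

lemma path_law_emeasure_step:
  assumes "path_law z Q" "\<And>i. A i \<in> sets S"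
  shows "emeasure Q {\<omega>\<in>space Q. \<forall>i\<le>Suc n. \<omega> i \<in> A i} =
        (\<integral>\<^sup>+\<omega>. indicator {\<omega>. \<forall>i\<le>n. \<omega> i \<in> A i} \<omega> * emeasure (K (\<omega> n)) (A (Suc n)) \<partial>Q)"
proof -
  have "\<forall>i. A i \<in> sets S" using assms by simp
  with assms(1) show ?thesis unfolding path_law_def by blast
qed

text \<open>For indicators this is the defining property. Instead of approximating \<open>f\<close>,
  the property is read as the identity of measures \<open>N1 = N2 \<bind> K\<close> between the laws
  of two consecutive coordinates on the box event, and \<open>f\<close> is then integrated on both
  sides.\<close>

lemma path_law_nn_integral:
  assumes Q: "path_law z Q" and f[measurable]: "f \<in> borel_measurable S"
    and A[measurable]: "\<And>i. A i \<in> sets S"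
  shows "(\<integral>\<^sup>+\<omega>. indicator {\<omega>. \<forall>i\<le>n. \<omega> i \<in> A i} \<omega> * f (\<omega> (Suc n)) \<partial>Q) =
    (\<integral>\<^sup>+\<omega>. indicator {\<omega>. \<forall>i\<le>n. \<omega> i \<in> A i} \<omega> * (\<integral>\<^sup>+y. f y \<partial>K (\<omega> n)) \<partial>Q)"
proof -
  note path_law_sets[OF Q, measurable_cong] path_law_space[OF Q, simp]
  let ?I = "\<lambda>\<omega>. indicator {\<omega>. \<forall>i\<le>n. \<omega> i \<in> A i} \<omega> :: ennreal"
  have I[measurable]: "?I \<in> borel_measurable paths"
    by (rule measurable_indicator_box[of A]) (rule A)
  define N1 where "N1 = distr (density Q ?I) S (\<lambda>\<omega>. \<omega> (Suc n))"
  define N2 where "N2 = distr (density Q ?I) S (\<lambda>\<omega>. \<omega> n)"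
  interpret Q: prob_space Q by (rule path_law_prob[OF Q])
  have ne: "space S \<noteq> {}"
    using Q.not_empty by (auto simp: space_PiM)
  have "N1 = N2 \<bind> K"
  proof (rule measure_eqI)
    show "sets N1 = sets (N2 \<bind> K)"
      using ne by (subst sets_bind[of _ _ S]) (auto simp: N1_def N2_def sets_kernel)
    fix B assume "B \<in> sets N1"
    then have B[measurable]: "B \<in> sets S" by (simp add: N1_def)
    have "emeasure N1 B = (\<integral>\<^sup>+\<omega>. ?I \<omega> * indicator B (\<omega> (Suc n)) \<partial>Q)"
      unfolding N1_def by (simp add: emeasure_distr emeasure_density)
        (auto intro!: nn_integral_cong split: split_indicator)
    also have "\<dots> = (\<integral>\<^sup>+\<omega>. indicator {\<omega>\<in>space Q. \<forall>i\<le>Suc n. \<omega> i \<in> (A(Suc n := B)) i} \<omega> \<partial>Q)"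
      by (rule nn_integral_cong) (auto simp: le_Suc_eq split: split_indicator)
    also have "\<dots> = emeasure Q {\<omega>\<in>space Q. \<forall>i\<le>Suc n. \<omega> i \<in> (A(Suc n := B)) i}"
    proof (rule nn_integral_indicator)
      have "(A(Suc n := B)) i \<in> sets S" for i by simp
      from sets_box[of "A(Suc n := B)", OF this]
      show "{\<omega>\<in>space Q. \<forall>i\<le>Suc n. \<omega> i \<in> (A(Suc n := B)) i} \<in> sets Q"
        by (simp only: path_law_sets[OF Q] path_law_space[OF Q])
    qed
    also have "\<dots> = (\<integral>\<^sup>+\<omega>. ?I \<omega> * emeasure (K (\<omega> n)) B \<partial>Q)"
    proof -
      have "(A(Suc n := B)) i \<in> sets S" for i by simp
      with Q have "emeasure Q {\<omega>\<in>space Q. \<forall>i\<le>Suc n. \<omega> i \<in> (A(Suc n := B)) i} =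
        (\<integral>\<^sup>+\<omega>. indicator {\<omega>. \<forall>i\<le>n. \<omega> i \<in> (A(Suc n := B)) i} \<omega> * emeasure (K (\<omega> n)) ((A(Suc n := B)) (Suc n)) \<partial>Q)"
        by (rule path_law_emeasure_step[of z Q "A(Suc n := B)" n])
      also have "{\<omega>::nat\<Rightarrow>'s. \<forall>i\<le>n. \<omega> i \<in> (A(Suc n := B)) i} = {\<omega>. \<forall>i\<le>n. \<omega> i \<in> A i}"
        by auto
      finally show ?thesis by simp
    qed
    also have "\<dots> = (\<integral>\<^sup>+x. emeasure (K x) B \<partial>N2)"
      unfolding N2_def by (subst nn_integral_distr) (auto simp: nn_integral_density)
    also have "\<dots> = emeasure (N2 \<bind> K) B"
      using ne by (subst emeasure_bind[where N=S]) (auto simp: N2_def)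
    finally show "emeasure N1 B = emeasure (N2 \<bind> K) B" .
  qed
  then have "(\<integral>\<^sup>+x. f x \<partial>N1) = (\<integral>\<^sup>+x. (\<integral>\<^sup>+y. f y \<partial>K x) \<partial>N2)"
    by (simp, subst nn_integral_bind[of f S]) (auto simp: N2_def)
  then show ?thesis
    unfolding N1_def N2_def by (simp add: nn_integral_distr nn_integral_density)
qed

text \<open>Integrating out the last coordinate first expresses finite-dimensional laws through
  \<open>K\<close> and \<open>z\<close> alone. The value is thus common to all measures with
  \<open>path_law z\<close>, and it is visibly measurable in \<open>z\<close>: uniqueness and the
  kernel property of the path measure both come from this.\<close>

primrec box_integral :: "'s \<Rightarrow> nat \<Rightarrow> (nat \<Rightarrow> 's set) \<Rightarrow> ('s \<Rightarrow> ennreal) \<Rightarrow> ennreal" where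
  "box_integral z 0 A f = indicator (A 0) z * f z"
| "box_integral z (Suc n) A f = box_integral z n A (\<lambda>x. \<integral>\<^sup>+y. indicator (A (Suc n)) y * f y \<partial>K x)"

lemma measurable_box_integral:
  assumes [measurable]: "\<And>i. A i \<in> sets S"
  shows "f \<in> borel_measurable S \<Longrightarrow> (\<lambda>z. box_integral z n A f) \<in> borel_measurable S"
proof (induction n arbitrary: f)
  case 0
  note [measurable] = this
  show ?case by simp
next
  case (Suc n)
  note [measurable] = Suc.prems
  show ?case unfolding box_integral.simps by (rule Suc.IH) measurable
qed

lemma path_law_start:
  assumes Q: "path_law z Q" and z: "z \<in> space S"
  shows "distr Q S (\<lambda>\<omega>. \<omega> 0) = return S z"
proof (rule measure_eqI)
  note path_law_sets[OF Q, measurable_cong]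
  fix B assume "B \<in> sets (distr Q S (\<lambda>\<omega>. \<omega> 0))"
  then have B[measurable]: "B \<in> sets S" by simp
  have "emeasure (distr Q S (\<lambda>\<omega>. \<omega> 0)) B = emeasure Q {\<omega>\<in>space Q. \<omega> 0 \<in> B}"
    by (subst emeasure_distr) (auto intro!: arg_cong[where f="emeasure Q"])
  also have "\<dots> = indicator B z"
    using Q B unfolding path_law_def by blast
  finally show "emeasure (distr Q S (\<lambda>\<omega>. \<omega> 0)) B = emeasure (return S z) B" by simp
qed simp

lemma path_law_AE_start:
  assumes Q: "path_law z Q" and z: "z \<in> space S" and P[measurable]: "Measurable.pred S P" "P z"
  shows "AE \<omega> in Q. P (\<omega> 0)"
proof -
  note path_law_sets[OF Q, measurable_cong]
  have "AE x in distr Q S (\<lambda>\<omega>. \<omega> 0). P x"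
    unfolding path_law_start[OF Q z] using z P by (simp add: AE_return)
  then show ?thesis by (simp add: AE_distr_iff)
qed

lemma path_law_box_integral:
  assumes Q: "path_law z Q" and z: "z \<in> space S" and A[measurable]: "\<And>i. A i \<in> sets S"
  shows "f \<in> borel_measurable S \<Longrightarrow>
    (\<integral>\<^sup>+\<omega>. indicator {\<omega>. \<forall>i\<le>n. \<omega> i \<in> A i} \<omega> * f (\<omega> n) \<partial>Q) = box_integral z n A f"
proof (induction n arbitrary: f)
  note path_law_sets[OF Q, measurable_cong]
  case 0
  note [measurable] = this
  have "(\<integral>\<^sup>+\<omega>. indicator {\<omega>. \<forall>i\<le>0. \<omega> i \<in> A i} \<omega> * f (\<omega> 0) \<partial>Q)
    = (\<integral>\<^sup>+x. indicator (A 0) x * f x \<partial>distr Q S (\<lambda>\<omega>. \<omega> 0))"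
    by (subst nn_integral_distr) (auto intro!: nn_integral_cong simp: indicator_def)
  then show ?case
    using z by (simp add: path_law_start[OF Q z] nn_integral_return)
next
  case (Suc n)
  note [measurable] = Suc.prems
  have "(\<integral>\<^sup>+\<omega>. indicator {\<omega>. \<forall>i\<le>Suc n. \<omega> i \<in> A i} \<omega> * f (\<omega> (Suc n)) \<partial>Q)
    = (\<integral>\<^sup>+\<omega>. indicator {\<omega>. \<forall>i\<le>n. \<omega> i \<in> A i} \<omega> * (indicator (A (Suc n)) (\<omega> (Suc n)) * f (\<omega> (Suc n))) \<partial>Q)"
    by (auto intro!: nn_integral_cong simp: le_Suc_eq split: split_indicator)
  also have "\<dots> = (\<integral>\<^sup>+\<omega>. indicator {\<omega>. \<forall>i\<le>n. \<omega> i \<in> A i} \<omega> * (\<integral>\<^sup>+y. indicator (A (Suc n)) y * f y \<partial>K (\<omega> n)) \<partial>Q)"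
    by (rule path_law_nn_integral[OF Q, of "\<lambda>y. indicator (A (Suc n)) y * f y"]) auto
  also have "\<dots> = box_integral z (Suc n) A f"
    unfolding box_integral.simps by (rule Suc.IH) measurable
  finally show ?case .
qed

text \<open>Indices outside \<open>J\<close> are left free by the full space; inserting 0 keeps the
  maximum meaningful when \<open>J\<close> is empty.\<close>

lemma emb_eq_box:
  fixes J :: "nat set"
  assumes J: "finite J" and A: "\<And>i. i \<in> J \<Longrightarrow> A i \<in> sets S"
  shows "prod_emb UNIV (\<lambda>_. S) J (Pi\<^sub>E J A) =
    {\<omega>\<in>space paths. \<forall>i\<le>Max (insert 0 J). \<omega> i \<in> (if i \<in> J then A i else space S)}"
proof -
  have *: "i \<le> Max (insert 0 J)" if "i \<in> J" for i
    using J that by (intro Max_ge) auto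
  have "(\<forall>i\<le>Max (insert 0 J). \<omega> i \<in> (if i \<in> J then A i else space S)) \<longleftrightarrow> (\<forall>i\<in>J. \<omega> i \<in> A i)"
    if "\<And>i. \<omega> i \<in> space S" for \<omega>
    using * that by auto
  with * show ?thesis
    by (auto simp: prod_emb_def space_PiM PiE_iff)
qed

lemma path_law_emb:
  fixes J :: "nat set"
  assumes Q: "path_law z Q" and z: "z \<in> space S"
    and J: "finite J" and A: "\<And>i. i \<in> J \<Longrightarrow> A i \<in> sets S"
  shows "emeasure Q (prod_emb UNIV (\<lambda>_. S) J (Pi\<^sub>E J A)) =
    box_integral z (Max (insert 0 J)) (\<lambda>i. if i \<in> J then A i else space S) (\<lambda>_. 1)"
proof -
  note path_law_sets[OF Q, measurable_cong] path_law_space[OF Q, simp]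
  let ?A = "\<lambda>i. if i \<in> J then A i else space S"
  have A': "?A i \<in> sets S" for i using A by auto
  have "emeasure Q {\<omega>\<in>space paths. \<forall>i\<le>Max (insert 0 J). \<omega> i \<in> ?A i}
    = (\<integral>\<^sup>+\<omega>. indicator {\<omega>\<in>space paths. \<forall>i\<le>Max (insert 0 J). \<omega> i \<in> ?A i} \<omega> \<partial>Q)"
    using sets_box[of ?A, OF A'] by (intro nn_integral_indicator[symmetric]) (simp only: path_law_sets[OF Q])
  also have "\<dots> = (\<integral>\<^sup>+\<omega>. indicator {\<omega>. \<forall>i\<le>Max (insert 0 J). \<omega> i \<in> ?A i} \<omega> * (\<lambda>_. 1) (\<omega> (Max (insert 0 J))) \<partial>Q)"
    by (auto intro!: nn_integral_cong simp: indicator_def)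
  also have "\<dots> = box_integral z (Max (insert 0 J)) ?A (\<lambda>_. 1)"
    by (rule path_law_box_integral[OF Q z A']) simp
  finally show ?thesis by (simp only: emb_eq_box[OF J A])
qed

lemma path_law_unique:
  assumes Q: "path_law z Q" "path_law z Q'" and z: "z \<in> space S"
  shows "Q = Q'"
proof (rule measure_eqI_PiM_infinite[of Q UNIV "\<lambda>_. S" Q'])
  interpret Q: prob_space Q by (rule path_law_prob[OF Q(1)])
  show "finite_measure Q" by unfold_locales
qed (simp_all add: path_law_sets[OF Q(1)] path_law_sets[OF Q(2)] path_law_emb[OF Q(1) z] path_law_emb[OF Q(2) z])

text \<open>Finite-dimensional cylinders are an intersection-stable generator, and on them the path
  measure is given by \<open>box_integral\<close>.\<close>

lemma measurable_markov_path [measurable]: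
  "markov_path S K \<in> measurable S (prob_algebra paths)"
proof (rule measurable_prob_algebra_generated[OF sets_PiM Int_stable_prod_algebra prod_algebra_sets_into_space])
  fix z assume z: "z \<in> space S"
  show "prob_space (markov_path S K z)" "sets (markov_path S K z) = sets paths"
    using path_law_markov_path[OF z] by (auto simp: path_law_def)
next
  fix X assume "X \<in> prod_algebra (UNIV :: nat set) (\<lambda>_. S)"
  then obtain J :: "nat set" and A where X: "X = prod_emb UNIV (\<lambda>_. S) J (Pi\<^sub>E J A)" "finite J"
    and A: "\<And>i. i \<in> J \<Longrightarrow> A i \<in> sets S"
    by (rule prod_algebraE) auto
  have "(\<lambda>z. box_integral z (Max (insert 0 J)) (\<lambda>i. if i \<in> J then A i else space S) (\<lambda>_. 1)) \<in> borel_measurable S"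
    using A by (intro measurable_box_integral) auto
  then show "(\<lambda>z. emeasure (markov_path S K z) X) \<in> borel_measurable S"
    by (rule measurable_cong[THEN iffD2, rotated])
       (simp add: X path_law_emb[OF path_law_markov_path _ X(2)] A)
qed

text \<open>The Markov property at time 1. The mixture on the right is shown to have the start law
  and one-step laws that determine the path measure, so uniqueness identifies the two.\<close>

lemma markov_path_shift:
  assumes z: "z \<in> space S"
  shows "markov_path S K z = K z \<bind> (\<lambda>y. distr (markov_path S K y) paths (case_nat z))"
    (is "_ = ?Q")
proof (rule path_law_unique[OF path_law_markov_path[OF z] _ z])
  interpret Kz: prob_space "K z" by (rule prob_space_kernel[OF z])
  note z[measurable] sets_kernel[OF z, measurable_cong] space_kernel[OF z, simp]
  have Kz1[simp]: "emeasure (K z) (space S) = 1"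
    using Kz.emeasure_space_1 by simp
  have cn[measurable]: "case_nat z \<in> measurable paths paths"
    by (rule measurable_case_nat') (use z in auto)
  have D[measurable]: "(\<lambda>y. distr (markov_path S K y) paths (case_nat z)) \<in> measurable S (prob_algebra paths)"
    by measurable
  note D'[measurable] = measurable_prob_algebraD[OF D]
  have Kz: "K z \<in> space (prob_algebra S)"
    by (simp add: space_prob_algebra sets_kernel z Kz.prob_space_axioms)
  have sets_Q: "sets ?Q = sets paths"
    using z by (subst sets_bind[of _ _ paths]) auto
  then have space_Q: "space ?Q = space paths" by (rule sets_eq_imp_space_eq)
  have Q_integral: "(\<integral>\<^sup>+\<omega>. g \<omega> \<partial>?Q) = (\<integral>\<^sup>+y. (\<integral>\<^sup>+\<omega>. g (case_nat z \<omega>) \<partial>markov_path S K y) \<partial>K z)"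
    if g[measurable]: "g \<in> borel_measurable paths" for g
  proof -
    have "(\<integral>\<^sup>+\<omega>. g \<omega> \<partial>?Q) = (\<integral>\<^sup>+y. (\<integral>\<^sup>+\<omega>. g \<omega> \<partial>distr (markov_path S K y) paths (case_nat z)) \<partial>K z)"
      by (rule nn_integral_bind[OF g]) (use D' in \<open>simp add: measurable_cong_sets[OF sets_kernel[OF z] refl]\<close>)
    also have "\<dots> = (\<integral>\<^sup>+y. (\<integral>\<^sup>+\<omega>. g (case_nat z \<omega>) \<partial>markov_path S K y) \<partial>K z)"
    proof (rule nn_integral_cong)
      fix y assume "y \<in> space (K z)"
      then have y: "y \<in> space S" by simp
      note path_law_sets[OF path_law_markov_path[OF y], measurable_cong]
      show "(\<integral>\<^sup>+\<omega>. g \<omega> \<partial>distr (markov_path S K y) paths (case_nat z)) = (\<integral>\<^sup>+\<omega>. g (case_nat z \<omega>) \<partial>markov_path S K y)"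
        by (rule nn_integral_distr) auto
    qed
    finally show ?thesis .
  qed
  have emeasure_Q: "emeasure ?Q X = (\<integral>\<^sup>+y. (\<integral>\<^sup>+\<omega>. indicator X (case_nat z \<omega>) \<partial>markov_path S K y) \<partial>K z)"
    if X[measurable]: "X \<in> sets paths" for X
    using Q_integral[of "indicator X"] sets_Q by (simp add: X)
  have Pn: "path_law y (markov_path S K y)" "sets (markov_path S K y) = sets paths" "space (markov_path S K y) = space paths"
    if "y \<in> space (K z)" for y
    using path_law_markov_path[of y] path_law_sets path_law_space that by auto
  show "path_law z ?Q"
    unfolding path_law_def
  proof (intro conjI allI impI ballI)
    show "prob_space ?Q"
      by (rule prob_space_bind'[OF Kz D])
    show "sets ?Q = sets paths" by fact
  next
    fix B assume B[measurable]: "B \<in> sets S"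
    have [measurable]: "{\<omega>\<in>space paths. \<omega> 0 \<in> B} \<in> sets paths" by measurable
    have "emeasure ?Q {\<omega>\<in>space ?Q. \<omega> 0 \<in> B} = (\<integral>\<^sup>+y. (\<integral>\<^sup>+\<omega>. indicator B z \<partial>markov_path S K y) \<partial>K z)"
      unfolding space_Q
    proof (subst emeasure_Q, measurable, intro nn_integral_cong)
      fix y \<omega> assume "y \<in> space (K z)" "\<omega> \<in> space (markov_path S K y)"
      then have "case_nat z \<omega> \<in> space paths"
        using Pn[of y] measurable_space[OF cn] by auto
      then show "indicator {\<omega> \<in> space paths. \<omega> 0 \<in> B} (case_nat z \<omega>) = (indicator B z :: ennreal)"
        by (auto simp: indicator_def)
    qed
    also have "\<dots> = (\<integral>\<^sup>+y. indicator B z \<partial>K z)"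
      by (intro nn_integral_cong)
        (simp add: prob_space.emeasure_space_1[OF path_law_prob[OF path_law_markov_path]])
    finally show "emeasure ?Q {\<omega>\<in>space ?Q. \<omega> 0 \<in> B} = indicator B z"
      by simp
  next
    fix A :: "nat \<Rightarrow> 's set" and n
    assume "\<forall>i. A i \<in> sets S"
    then have A[measurable]: "A i \<in> sets S" for i by auto
    have [measurable]: "{\<omega>\<in>space paths. \<forall>i\<le>Suc n. \<omega> i \<in> A i} \<in> sets paths"
      by (rule sets_box[of A]) (rule A)
    have [measurable]: "(\<lambda>\<omega>. indicator {\<omega>. \<forall>i\<le>m. \<omega> i \<in> A i} \<omega> :: ennreal) \<in> borel_measurable paths" for m
      by (rule measurable_indicator_box[of A]) (rule A)
    have "emeasure ?Q {\<omega>\<in>space ?Q. \<forall>i\<le>Suc n. \<omega> i \<in> A i} =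
      (\<integral>\<^sup>+y. (\<integral>\<^sup>+\<omega>. indicator (A 0) z * indicator {\<omega>\<in>space paths. \<forall>i\<le>n. \<omega> i \<in> A (Suc i)} \<omega> \<partial>markov_path S K y) \<partial>K z)"
      unfolding space_Q
    proof (subst emeasure_Q, measurable, intro nn_integral_cong)
      fix y \<omega> assume "y \<in> space (K z)" "\<omega> \<in> space (markov_path S K y)"
      then have "\<omega> \<in> space paths" "case_nat z \<omega> \<in> space paths"
        using Pn[of y] measurable_space[OF cn] by auto
      then show "indicator {\<omega> \<in> space paths. \<forall>i\<le>Suc n. \<omega> i \<in> A i} (case_nat z \<omega>) =
        indicator (A 0) z * (indicator {\<omega>\<in>space paths. \<forall>i\<le>n. \<omega> i \<in> A (Suc i)} \<omega> :: ennreal)"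
        by (auto simp: indicator_def less_Suc_eq_le[symmetric] All_less_Suc2 simp del: less_Suc_eq_le)
    qed
    also have "\<dots> = (\<integral>\<^sup>+y. indicator (A 0) z * emeasure (markov_path S K y) {\<omega>\<in>space paths. \<forall>i\<le>n. \<omega> i \<in> A (Suc i)} \<partial>K z)"
      using sets_box[of "\<lambda>i. A (Suc i)" n, OF A]
      by (intro nn_integral_cong nn_integral_cmult_indicator) (simp only: Pn)
    also have "\<dots> = (\<integral>\<^sup>+y. (\<integral>\<^sup>+\<omega>. indicator {\<omega>. \<forall>i\<le>n. \<omega> i \<in> A i} (case_nat z \<omega>) *
       emeasure (K (case_nat z \<omega> n)) (A (Suc n)) \<partial>markov_path S K y) \<partial>K z)"
    \<comment> \<open>A box up to time 1 sees only the start of the shifted chain; longer boxes use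
      its one-step law, with all indices lowered by one.\<close>
    proof (cases n)
      case 0
      have "(\<integral>\<^sup>+y. indicator (A 0) z * emeasure (markov_path S K y) {\<omega>\<in>space paths. \<omega> 0 \<in> A 1} \<partial>K z) =
        (\<integral>\<^sup>+y. indicator (A 0) z * indicator (A 1) y \<partial>K z)"
      proof (rule nn_integral_cong)
        fix y assume y: "y \<in> space (K z)"
        have "emeasure (markov_path S K y) {\<omega>\<in>space paths. \<omega> 0 \<in> A 1} = indicator (A 1) y"
          using path_law_emeasure_start[OF Pn(1)[OF y] A[of 1]] by (simp only: Pn(3)[OF y])
        then show "indicator (A 0) z * emeasure (markov_path S K y) {\<omega>\<in>space paths. \<omega> 0 \<in> A 1}
          = indicator (A 0) z * indicator (A 1) y" by simp
      qed
      also have "\<dots> = indicator (A 0) z * emeasure (K z) (A 1)"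
        by (rule nn_integral_cmult_indicator) (simp add: sets_kernel z)
      also have "\<dots> = (\<integral>\<^sup>+y. (\<integral>\<^sup>+\<omega>. indicator (A 0) z * emeasure (K z) (A 1) \<partial>markov_path S K y) \<partial>K z)"
      proof -
        have "(\<integral>\<^sup>+\<omega>. indicator (A 0) z * emeasure (K z) (A 1) \<partial>markov_path S K y) = indicator (A 0) z * emeasure (K z) (A 1)"
          if "y \<in> space (K z)" for y
          using prob_space.emeasure_space_1[OF path_law_prob[OF Pn(1)[OF that]]] by simp
        then have "(\<integral>\<^sup>+y. (\<integral>\<^sup>+\<omega>. indicator (A 0) z * emeasure (K z) (A 1) \<partial>markov_path S K y) \<partial>K z) =
          (\<integral>\<^sup>+y. indicator (A 0) z * emeasure (K z) (A 1) \<partial>K z)"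
          by (rule nn_integral_cong)
        then show ?thesis by simp
      qed
      finally show ?thesis using 0 by (simp add: indicator_def)
    next
      case (Suc k)
      show ?thesis
      proof (rule nn_integral_cong)
        fix y assume y: "y \<in> space (K z)"
        note [measurable_cong] = Pn(2)[OF y]
        have *: "emeasure (markov_path S K y) {\<omega>\<in>space (markov_path S K y). \<forall>i\<le>Suc k. \<omega> i \<in> A (Suc i)} =
          (\<integral>\<^sup>+\<omega>. indicator {\<omega>. \<forall>i\<le>k. \<omega> i \<in> A (Suc i)} \<omega> * emeasure (K (\<omega> k)) (A (Suc (Suc k))) \<partial>markov_path S K y)"
          using path_law_emeasure_step[OF Pn(1)[OF y], of "\<lambda>i. A (Suc i)" k] by simp
        have "indicator (A 0) z * emeasure (markov_path S K y) {\<omega>\<in>space paths. \<forall>i\<le>n. \<omega> i \<in> A (Suc i)} =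
          (\<integral>\<^sup>+\<omega>. indicator (A 0) z * (indicator {\<omega>. \<forall>i\<le>k. \<omega> i \<in> A (Suc i)} \<omega> * emeasure (K (\<omega> k)) (A (Suc (Suc k)))) \<partial>markov_path S K y)"
          using * measurable_indicator_box[of "\<lambda>i. A (Suc i)" k, OF A]
          by (subst nn_integral_cmult) (simp_all add: Suc Pn(3)[OF y])
        also have "\<dots> = (\<integral>\<^sup>+\<omega>. indicator {\<omega>. \<forall>i\<le>n. \<omega> i \<in> A i} (case_nat z \<omega>) *
          emeasure (K (case_nat z \<omega> n)) (A (Suc n)) \<partial>markov_path S K y)"
          by (rule nn_integral_cong)
            (auto simp: Suc indicator_def less_Suc_eq_le[symmetric] All_less_Suc2 simp del: less_Suc_eq_le)
        finally show "indicator (A 0) z * emeasure (markov_path S K y) {\<omega>\<in>space paths. \<forall>i\<le>n. \<omega> i \<in> A (Suc i)} =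
          (\<integral>\<^sup>+\<omega>. indicator {\<omega>. \<forall>i\<le>n. \<omega> i \<in> A i} (case_nat z \<omega>) *
          emeasure (K (case_nat z \<omega> n)) (A (Suc n)) \<partial>markov_path S K y)" .
      qed
    qed
    also have "\<dots> = (\<integral>\<^sup>+\<omega>. indicator {\<omega>. \<forall>i\<le>n. \<omega> i \<in> A i} \<omega> * emeasure (K (\<omega> n)) (A (Suc n)) \<partial>?Q)"
      by (subst Q_integral) simp_all
    finally show "emeasure ?Q {\<omega>\<in>space ?Q. \<forall>i\<le>Suc n. \<omega> i \<in> A i} =
      (\<integral>\<^sup>+\<omega>. indicator {\<omega>. \<forall>i\<le>n. \<omega> i \<in> A i} \<omega> * emeasure (K (\<omega> n)) (A (Suc n)) \<partial>?Q)" .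
  qed
qed

end

section \<open>Harris recurrence\<close>

lemma return_time_finite_iff: "return_time A \<omega> < \<infinity> \<longleftrightarrow> (\<exists>n\<ge>1. \<omega> n \<in> A)"
proof
  assume "return_time A \<omega> < \<infinity>"
  then have "\<not> {enat n | n. 1 \<le> n \<and> \<omega> n \<in> A} = {}"
    unfolding return_time_def Inf_enat_def by (cases "{enat n | n. 1 \<le> n \<and> \<omega> n \<in> A} = {}") (simp_all only: simp_thms if_True order.irrefl)
  then show "\<exists>n\<ge>1. \<omega> n \<in> A" by auto
next
  assume "\<exists>n\<ge>1. \<omega> n \<in> A"
  then obtain n where "1 \<le> n" "\<omega> n \<in> A" by auto
  then have "return_time A \<omega> \<le> enat n"
    unfolding return_time_def by (intro Inf_lower CollectI exI[of _ n]) simp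
  also have "enat n < \<infinity>" by simp
  finally show "return_time A \<omega> < \<infinity>" .
qed

context markov_kernel
begin

lemma prob_space_path: "z \<in> space S \<Longrightarrow> prob_space (markov_path S K z)"
  and sets_path: "z \<in> space S \<Longrightarrow> sets (markov_path S K z) = sets paths"
  and space_path: "z \<in> space S \<Longrightarrow> space (markov_path S K z) = space paths"
  using path_law_markov_path[of z] path_law_prob path_law_sets path_law_space by auto

lemma return_prob_eq_1_iff:
  assumes z: "z \<in> space S" and A[measurable]: "A \<in> sets S"
  shows "return_prob S K z A = 1 \<longleftrightarrow> (AE \<omega> in markov_path S K z. \<exists>n\<ge>1. \<omega> n \<in> A)"
proof -
  interpret prob_space "markov_path S K z" by (rule prob_space_path[OF z])
  note sets_path[OF z, measurable_cong] 
  have "{\<omega> \<in> space (markov_path S K z). \<exists>n\<ge>1. \<omega> n \<in> A} \<in> sets (markov_path S K z)"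
    by measurable
  then show ?thesis
    unfolding return_prob_def return_time_finite_iff by (rule prob_Collect_eq_1)
qed

lemma return_prob_pos_iff:
  assumes z: "z \<in> space S" and A[measurable]: "A \<in> sets S"
  shows "return_prob S K z A > 0 \<longleftrightarrow> \<not> (AE \<omega> in markov_path S K z. \<forall>n\<ge>1. \<omega> n \<notin> A)"
proof -
  interpret prob_space "markov_path S K z" by (rule prob_space_path[OF z])
  note sets_path[OF z, measurable_cong]
  have "{\<omega> \<in> space (markov_path S K z). \<exists>n\<ge>1. \<omega> n \<in> A} \<in> sets (markov_path S K z)"
    by measurable
  then have "return_prob S K z A = 0 \<longleftrightarrow> (AE \<omega> in markov_path S K z. \<not> (\<exists>n\<ge>1. \<omega> n \<in> A))"
    unfolding return_prob_def return_time_finite_iff by (rule prob_Collect_eq_0)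
  moreover have "return_prob S K z A \<ge> 0" by (simp add: return_prob_def)
  ultimately show ?thesis by (auto simp: less_le)
qed

lemma AE_path_start:
  assumes z: "z \<in> space S" and P: "Measurable.pred S P" "P z"
  shows "AE \<omega> in markov_path S K z. P (\<omega> 0)"
  by (rule path_law_AE_start[OF path_law_markov_path[OF z] z P])

lemma AE_path_shift:
  assumes z: "z \<in> space S" and P[measurable]: "Measurable.pred paths P"
  shows "(AE \<omega> in markov_path S K z. P \<omega>) \<longleftrightarrow>
    (AE y in K z. AE \<omega> in markov_path S K y. P (case_nat z \<omega>))"
proof -
  have cn[measurable]: "case_nat z \<in> measurable paths paths"
    by (rule measurable_case_nat') (use z in auto)
  have D: "(\<lambda>y. distr (markov_path S K y) paths (case_nat z)) \<in> measurable (K z) (subprob_algebra paths)"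
    by (subst measurable_cong_sets[OF sets_kernel[OF z] refl], rule measurable_prob_algebraD, measurable)
  have "(AE \<omega> in markov_path S K z. P \<omega>) \<longleftrightarrow>
    (AE y in K z. AE \<omega> in distr (markov_path S K y) paths (case_nat z). P \<omega>)"
    unfolding markov_path_shift[OF z] by (rule AE_bind[OF D P])
  also have "\<dots> \<longleftrightarrow> (AE y in K z. AE \<omega> in markov_path S K y. P (case_nat z \<omega>))"
  proof (rule AE_cong)
    fix y assume "y \<in> space (K z)"
    then have y: "y \<in> space S" by (simp add: space_kernel z)
    note sets_path[OF y, measurable_cong]
    show "(AE \<omega> in distr (markov_path S K y) paths (case_nat z). P \<omega>) \<longleftrightarrow>
      (AE \<omega> in markov_path S K y. P (case_nat z \<omega>))"
      by (rule AE_distr_iff) measurable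
  qed
  finally show ?thesis .
qed

lemma emeasure_path_shift:
  assumes z: "z \<in> space S" and X[measurable]: "X \<in> sets paths"
  shows "emeasure (markov_path S K z) X =
    (\<integral>\<^sup>+y. emeasure (markov_path S K y) {\<omega>\<in>space paths. case_nat z \<omega> \<in> X} \<partial>K z)"
proof -
  have cn[measurable]: "case_nat z \<in> measurable paths paths"
    by (rule measurable_case_nat') (use z in auto)
  have D: "(\<lambda>y. distr (markov_path S K y) paths (case_nat z)) \<in> measurable (K z) (subprob_algebra paths)"
    by (subst measurable_cong_sets[OF sets_kernel[OF z] refl], rule measurable_prob_algebraD, measurable)
  have "emeasure (markov_path S K z) X = (\<integral>\<^sup>+y. emeasure (distr (markov_path S K y) paths (case_nat z)) X \<partial>K z)"
    unfolding markov_path_shift[OF z]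
    using prob_space.not_empty[OF prob_space_kernel[OF z]] by (intro emeasure_bind[OF _ D X])
  also have "\<dots> = (\<integral>\<^sup>+y. emeasure (markov_path S K y) {\<omega>\<in>space paths. case_nat z \<omega> \<in> X} \<partial>K z)"
  proof (rule nn_integral_cong)
    fix y assume "y \<in> space (K z)"
    then have y: "y \<in> space S" by (simp add: space_kernel z)
    note sets_path[OF y, measurable_cong]
    show "emeasure (distr (markov_path S K y) paths (case_nat z)) X =
      emeasure (markov_path S K y) {\<omega>\<in>space paths. case_nat z \<omega> \<in> X}"
      by (subst emeasure_distr) (auto simp: space_path[OF y] intro!: arg_cong[where f="emeasure _"])
  qed
  finally show ?thesis .
qed

text \<open>Lumping: if the law of \<open>f\<close> after one step depends on \<open>s\<close> only
  through \<open>f s\<close>, the image process is again a Markov chain. It serves to forget the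
  labels.\<close>

lemma markov_path_distr:
  assumes K': "markov_kernel S' K'" and f[measurable]: "f \<in> measurable S' S"
    and proj: "\<And>s. s \<in> space S' \<Longrightarrow> K (f s) = distr (K' s) S f"
    and s: "s \<in> space S'"
  shows "distr (markov_path S' K' s) paths (\<lambda>\<omega> n. f (\<omega> n)) = markov_path S K (f s)"
proof (rule path_law_unique[OF _ path_law_markov_path])
  interpret K': markov_kernel S' K' by (rule K')
  note K'.sets_path[OF s, measurable_cong] K'.space_path[OF s, simp]
  show fs: "f s \<in> space S" "f s \<in> space S" using measurable_space[OF f s] by auto
  have F[measurable]: "(\<lambda>\<omega> n. f (\<omega> n)) \<in> measurable K'.paths paths"
    by (rule measurable_PiM_single') (auto simp: space_PiM PiE_iff measurable_space[OF f])
  have Fs: "(\<lambda>\<omega> n. f (\<omega> n)) \<in> measurable (markov_path S' K' s) paths" by measurable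
  let ?Q = "distr (markov_path S' K' s) paths (\<lambda>\<omega> n. f (\<omega> n))"
  have F_space: "(\<lambda>n. f (\<omega> n)) \<in> space paths" if "\<omega> \<in> space K'.paths" for \<omega>
    using measurable_space[OF F that] .
  show "path_law (f s) ?Q"
    unfolding path_law_def
  proof (intro conjI allI impI ballI)
    show "prob_space ?Q"
      by (rule prob_space.prob_space_distr[OF K'.prob_space_path[OF s] Fs])
  next
    fix B assume B[measurable]: "B \<in> sets S"
    have "emeasure ?Q {\<omega> \<in> space ?Q. \<omega> 0 \<in> B} = emeasure (markov_path S' K' s) {\<omega> \<in> space (markov_path S' K' s). \<omega> 0 \<in> f -` B \<inter> space S'}"
    proof (subst emeasure_distr[OF Fs])
      show "{\<omega> \<in> space ?Q. \<omega> 0 \<in> B} \<in> sets paths" by (simp only: space_distr) measurable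
    qed (auto intro!: arg_cong[where f="emeasure _"] simp: space_PiM PiE_iff F_space[unfolded space_PiM PiE_iff])
    also have "\<dots> = indicator (f -` B \<inter> space S') s"
      by (rule K'.path_law_emeasure_start[OF K'.path_law_markov_path[OF s]]) measurable
    finally show "emeasure ?Q {\<omega> \<in> space ?Q. \<omega> 0 \<in> B} = indicator B (f s)"
      using s by (simp add: indicator_def)
  next
    fix A :: "nat \<Rightarrow> 's set" and n assume "\<forall>i. A i \<in> sets S"
    then have A: "A i \<in> sets S" for i by auto
    let ?A = "\<lambda>i. f -` A i \<inter> space S'"
    have A': "?A i \<in> sets S'" for i using A[of i] by measurable
    have "emeasure ?Q {\<omega> \<in> space ?Q. \<forall>i\<le>Suc n. \<omega> i \<in> A i} =
      emeasure (markov_path S' K' s) {\<omega> \<in> space (markov_path S' K' s). \<forall>i\<le>Suc n. \<omega> i \<in> ?A i}"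
    proof (subst emeasure_distr[OF Fs])
      show "{\<omega> \<in> space ?Q. \<forall>i\<le>Suc n. \<omega> i \<in> A i} \<in> sets paths"
        using sets_box[of A "Suc n", OF A] by (simp only: space_distr)
    qed (auto intro!: arg_cong[where f="emeasure _"] simp: space_PiM PiE_iff F_space[unfolded space_PiM PiE_iff])
    also have "\<dots> = (\<integral>\<^sup>+\<omega>. indicator {\<omega>. \<forall>i\<le>n. \<omega> i \<in> ?A i} \<omega> * emeasure (K' (\<omega> n)) (?A (Suc n)) \<partial>markov_path S' K' s)"
      by (rule K'.path_law_emeasure_step[OF K'.path_law_markov_path[OF s] A'])
    also have "\<dots> = (\<integral>\<^sup>+\<omega>. indicator {\<omega>. \<forall>i\<le>n. \<omega> i \<in> A i} (\<lambda>n. f (\<omega> n)) * emeasure (K (f (\<omega> n))) (A (Suc n)) \<partial>markov_path S' K' s)"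
    proof (rule nn_integral_cong)
      fix \<omega> assume "\<omega> \<in> space (markov_path S' K' s)"
      then have \<omega>: "\<omega> i \<in> space S'" for i by (auto simp: space_PiM)
      have "f \<in> measurable (K' (\<omega> n)) S" using K'.sets_kernel[OF \<omega>[of n]] by (simp cong: measurable_cong_sets)
      then have "emeasure (K (f (\<omega> n))) (A (Suc n)) = emeasure (K' (\<omega> n)) (?A (Suc n))"
        unfolding proj[OF \<omega>[of n]] by (subst emeasure_distr) (auto simp: A K'.space_kernel[OF \<omega>])
      then show "indicator {\<omega>. \<forall>i\<le>n. \<omega> i \<in> ?A i} \<omega> * emeasure (K' (\<omega> n)) (?A (Suc n)) =
        indicator {\<omega>. \<forall>i\<le>n. \<omega> i \<in> A i} (\<lambda>n. f (\<omega> n)) * emeasure (K (f (\<omega> n))) (A (Suc n))"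
        using \<omega> by (auto simp: indicator_def)
    qed
    also have "\<dots> = (\<integral>\<^sup>+\<omega>. indicator {\<omega>. \<forall>i\<le>n. \<omega> i \<in> A i} \<omega> * emeasure (K (\<omega> n)) (A (Suc n)) \<partial>?Q)"
    proof -
      note [measurable] = A measurable_indicator_box[of A n, OF A]
      have "(\<lambda>\<omega>. indicator {\<omega>. \<forall>i\<le>n. \<omega> i \<in> A i} \<omega> * emeasure (K (\<omega> n)) (A (Suc n))) \<in> borel_measurable paths"
        by measurable
      with Fs show ?thesis by (subst nn_integral_distr) simp_all
    qed
    finally show "emeasure ?Q {\<omega> \<in> space ?Q. \<forall>i\<le>Suc n. \<omega> i \<in> A i} =
      (\<integral>\<^sup>+\<omega>. indicator {\<omega>. \<forall>i\<le>n. \<omega> i \<in> A i} \<omega> * emeasure (K (\<omega> n)) (A (Suc n)) \<partial>?Q)" .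
  qed simp
qed

text \<open>Time 0 counts as a hit here, in contrast to \<open>return_prob\<close>. Therefore
  \<open>u\<close> vanishes on \<open>A\<close>, and a first-step analysis gives
  \<open>u = v\<close> off \<open>A\<close>, so that \<open>u \<le> v\<close> everywhere.\<close>

lemma AE_hits_of_stationary:
  assumes stat: "stationary K \<pi>" and sets_pi: "sets \<pi> = sets S"
    and irr: "phi_irreducible S K"
    and A[measurable]: "A \<in> sets S" and pos: "emeasure \<pi> A > 0"
  shows "AE z in \<pi>. AE \<omega> in markov_path S K z. \<exists>n. \<omega> n \<in> A"
proof -
  interpret pi: prob_space \<pi> using stat by (simp add: stationary_def)
  have inv: "\<pi> \<bind> K = \<pi>" using stat by (simp add: stationary_def)
  note sets_pi[measurable_cong]
  have space_pi[simp]: "space \<pi> = space S" using sets_pi by (rule sets_eq_imp_space_eq)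
  have K_pi: "K \<in> measurable \<pi> (subprob_algebra S)" by measurable
  have P_sub[measurable]: "markov_path S K \<in> measurable S (subprob_algebra paths)"
    by (rule measurable_prob_algebraD) measurable
  define u where "u z = emeasure (markov_path S K z) {\<omega>\<in>space paths. \<forall>n. \<omega> n \<notin> A}" for z
  define v where "v z = (\<integral>\<^sup>+y. u y \<partial>K z)" for z
  have u[measurable]: "u \<in> borel_measurable S"
    unfolding u_def by measurable
  have v[measurable]: "v \<in> borel_measurable S"
    unfolding v_def by measurable
  have u_eq: "u z = indicator (space S - A) z * v z" if z: "z \<in> space S" for z
  proof -
    have "u z = (\<integral>\<^sup>+y. emeasure (markov_path S K y) {\<omega>\<in>space paths. case_nat z \<omega> \<in> {\<omega>\<in>space paths. \<forall>n. \<omega> n \<notin> A}} \<partial>K z)"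
      unfolding u_def by (rule emeasure_path_shift[OF z]) measurable
    also have "\<dots> = (\<integral>\<^sup>+y. indicator (space S - A) z * u y \<partial>K z)"
    proof (rule nn_integral_cong)
      fix y assume "y \<in> space (K z)"
      have "{\<omega>\<in>space paths. case_nat z \<omega> \<in> {\<omega>\<in>space paths. \<forall>n. \<omega> n \<notin> A}} =
        (if z \<in> A then {} else {\<omega>\<in>space paths. \<forall>n. \<omega> n \<notin> A})"
        using z by (auto simp: space_PiM PiE_iff split: nat.split nat.split_asm)
      then show "emeasure (markov_path S K y) {\<omega>\<in>space paths. case_nat z \<omega> \<in> {\<omega>\<in>space paths. \<forall>n. \<omega> n \<notin> A}} =
        indicator (space S - A) z * u y"
        using z by (simp add: u_def)
    qed
    also have "\<dots> = indicator (space S - A) z * v z"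
      unfolding v_def using z by (intro nn_integral_cmult) (simp cong: measurable_cong_sets[OF sets_kernel])
    finally show ?thesis .
  qed
  have "(\<integral>\<^sup>+z. v z \<partial>\<pi>) = (\<integral>\<^sup>+z. u z \<partial>(\<pi> \<bind> K))"
    unfolding v_def by (rule nn_integral_bind[symmetric, OF u K_pi])
  then have int_eq: "(\<integral>\<^sup>+z. v z \<partial>\<pi>) = (\<integral>\<^sup>+z. u z \<partial>\<pi>)" by (simp add: inv)
  have u_le_1: "u z \<le> 1" if "z \<in> space S" for z
    unfolding u_def by (rule prob_space.measure_le_1[OF prob_space_path[OF that]])
  have int_fin: "(\<integral>\<^sup>+z. u z \<partial>\<pi>) \<noteq> \<infinity>"
  proof -
    have "(\<integral>\<^sup>+z. u z \<partial>\<pi>) \<le> (\<integral>\<^sup>+z. 1 \<partial>\<pi>)" by (intro nn_integral_mono u_le_1) simp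
    then show ?thesis by (auto simp: pi.emeasure_space_1[simplified] top_unique)
  qed
  \<comment> \<open>The difference is nonnegative, and by stationarity its integral is a difference
    of equal finite numbers.\<close>
  have "AE z in \<pi>. v z - u z = 0"
  proof -
    have "(\<integral>\<^sup>+z. v z - u z \<partial>\<pi>) = (\<integral>\<^sup>+z. v z \<partial>\<pi>) - (\<integral>\<^sup>+z. u z \<partial>\<pi>)"
      using int_fin by (intro nn_integral_diff) (auto simp: u_eq indicator_def intro!: AE_I2)
    also have "\<dots> = 0" unfolding int_eq using int_fin by simp
    finally show ?thesis by (subst (asm) nn_integral_0_iff_AE) auto
  qed
  then have v_le_u: "AE z in \<pi>. v z \<le> u z"
    by eventually_elim (auto simp: diff_eq_0_iff_ennreal)
  define B where "B = {z\<in>space S. u z = 0}"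
  have B[measurable]: "B \<in> sets S" unfolding B_def by measurable
  have A_B: "A \<subseteq> B" using sets.sets_into_space[OF A] by (auto simp: B_def u_eq)
  have B_closed: "AE z in \<pi>. z \<in> B \<longrightarrow> (AE y in K z. y \<in> B)"
    using v_le_u
  proof (eventually_elim)
    case (elim z)
    show ?case
    proof
      assume "z \<in> B"
      with elim have "v z = 0" and z: "z \<in> space S" by (auto simp: B_def)
      then have "AE y in K z. u y = 0"
        unfolding v_def by (subst (asm) nn_integral_0_iff_AE) (auto cong: measurable_cong_sets[OF sets_kernel])
      moreover have "AE y in K z. y \<in> space S" using AE_space by eventually_elim (simp add: space_kernel z)
      ultimately show "AE y in K z. y \<in> B" by eventually_elim (simp add: B_def)
    qed
  qed
  have KB: "(\<lambda>z. emeasure (K z) B) \<in> borel_measurable S" by measurable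
  \<comment> \<open>Stationarity gives \<open>B\<close> the mass of the flow into it. The points of
    \<open>B\<close> alone already supply all of this mass, so the flow from the complement is
    zero.\<close>
  have Bc_closed: "AE z in \<pi>. z \<notin> B \<longrightarrow> (AE y in K z. y \<notin> B)"
  proof -
    have piB: "emeasure \<pi> B = (\<integral>\<^sup>+z. emeasure (K z) B \<partial>\<pi>)"
      using emeasure_bind[OF pi.not_empty K_pi B] by (simp add: inv)
    have "(\<integral>\<^sup>+z. emeasure (K z) B \<partial>\<pi>) =
      (\<integral>\<^sup>+z. indicator B z * emeasure (K z) B \<partial>\<pi>) + (\<integral>\<^sup>+z. indicator (space S - B) z * emeasure (K z) B \<partial>\<pi>)"
      by (subst nn_integral_add[symmetric]) (auto intro!: nn_integral_cong simp: indicator_def KB)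
    also have "(\<integral>\<^sup>+z. indicator B z * emeasure (K z) B \<partial>\<pi>) = (\<integral>\<^sup>+z. indicator B z \<partial>\<pi>)"
    proof (rule nn_integral_cong_AE)
      show "AE z in \<pi>. indicator B z * emeasure (K z) B = indicator B z"
        using B_closed
      proof eventually_elim
        fix z assume *: "z \<in> B \<longrightarrow> (AE y in K z. y \<in> B)"
        show "indicator B z * emeasure (K z) B = indicator B z"
        proof (cases "z \<in> B")
          case True
          then have z: "z \<in> space S" by (simp add: B_def)
          have "emeasure (K z) B = 1"
            using * True z by (subst prob_space.emeasure_eq_1_AE[OF prob_space_kernel[OF z]]) (auto simp: sets_kernel)
          then show ?thesis by simp
        qed simp
      qed
    qed
    also have "\<dots> = emeasure \<pi> B" by (simp add: sets_pi)
    finally have "emeasure \<pi> B = emeasure \<pi> B + (\<integral>\<^sup>+z. indicator (space S - B) z * emeasure (K z) B \<partial>\<pi>)"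
      using piB by simp
    then have "(\<integral>\<^sup>+z. indicator (space S - B) z * emeasure (K z) B \<partial>\<pi>) = 0"
      using pi.emeasure_finite[of B] by (metis add_0_right ennreal_add_left_cancel infinity_ennreal_def)
    then have "AE z in \<pi>. indicator (space S - B) z * emeasure (K z) B = 0"
      by (subst (asm) nn_integral_0_iff_AE) (auto simp: KB)
    moreover have "AE z in \<pi>. z \<in> space \<pi>" by (rule AE_space)
    ultimately show ?thesis
    proof eventually_elim
      case (elim z)
      show ?case
      proof
        assume "z \<notin> B"
        with elim have "B \<in> null_sets (K z)" by (auto simp: null_sets_def sets_kernel)
        then show "AE y in K z. y \<notin> B" by (rule AE_not_in)
      qed
    qed
  qed
  \<comment> \<open>The induction hypothesis concerns almost every starting point; rewriting \<pi>
    as \<pi> \<bind> K turns it into a statement about almost every point after one step.\<close>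
  have stays: "AE z in \<pi>. AE \<omega> in markov_path S K z. \<omega> n \<in> B \<longleftrightarrow> z \<in> B" for n
  proof (induction n)
    case 0
    have "AE z in \<pi>. z \<in> space \<pi>" by (rule AE_space)
    then show ?case by eventually_elim (rule AE_path_start, auto)
  next
    case (Suc n)
    have stay_pred: "Measurable.pred S (\<lambda>z. AE \<omega> in markov_path S K z. \<omega> n \<in> B \<longleftrightarrow> z \<in> B)"
    proof -
      have "(AE \<omega> in markov_path S K z. \<omega> n \<in> B \<longleftrightarrow> z \<in> B) \<longleftrightarrow>
        (if z \<in> B then emeasure (markov_path S K z) {\<omega>\<in>space paths. \<omega> n \<notin> B} = 0
          else emeasure (markov_path S K z) {\<omega>\<in>space paths. \<omega> n \<in> B} = 0)" if z: "z \<in> space S" for z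
      proof -
        have "{\<omega>\<in>space paths. \<omega> n \<notin> B} \<in> sets paths" "{\<omega>\<in>space paths. \<omega> n \<in> B} \<in> sets paths" by measurable
        then show ?thesis by (simp add: AE_iff_null space_path sets_path z null_sets_def)
      qed
      then show ?thesis
        by (rule measurable_cong[THEN iffD2]) measurable
    qed
    have "AE z in \<pi> \<bind> K. AE \<omega> in markov_path S K z. \<omega> n \<in> B \<longleftrightarrow> z \<in> B"
      unfolding inv by (rule Suc.IH)
    then have "AE z in \<pi>. AE y in K z. AE \<omega> in markov_path S K y. \<omega> n \<in> B \<longleftrightarrow> y \<in> B"
      by (subst (asm) AE_bind[OF K_pi stay_pred])
    moreover have "AE z in \<pi>. z \<in> space \<pi>" by (rule AE_space)
    ultimately show ?case
      using B_closed Bc_closed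
    proof eventually_elim
      fix z assume z: "z \<in> space \<pi>"
        and *: "AE y in K z. AE \<omega> in markov_path S K y. \<omega> n \<in> B \<longleftrightarrow> y \<in> B"
        and B: "z \<in> B \<longrightarrow> (AE y in K z. y \<in> B)" "z \<notin> B \<longrightarrow> (AE y in K z. y \<notin> B)"
      have "AE y in K z. y \<in> B \<longleftrightarrow> z \<in> B" using B by (cases "z \<in> B") auto
      with * have "AE y in K z. AE \<omega> in markov_path S K y. \<omega> n \<in> B \<longleftrightarrow> z \<in> B"
        by eventually_elim simp
      then show "AE \<omega> in markov_path S K z. \<omega> (Suc n) \<in> B \<longleftrightarrow> z \<in> B"
        using z by (subst AE_path_shift) (auto)
    qed
  qed
  have "AE z in \<pi>. z \<in> B"
  proof (rule ccontr)
    assume nB: "\<not> (AE z in \<pi>. z \<in> B)"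
    have all: "AE z in \<pi>. AE \<omega> in markov_path S K z. \<forall>n. \<omega> n \<in> B \<longleftrightarrow> z \<in> B"
      using stays by (simp add: AE_all_countable)
    \<comment> \<open>Almost every point stays on its own side forever, so such a point exists off
      \<open>B\<close> by the assumption to be refuted, and in \<open>B\<close> because
      \<open>B\<close> contains \<open>A\<close>. The irreducibility measure charges one of the
      sides, and that side is never reached from the point on the other one.\<close>
    obtain z2 where z2: "z2 \<in> space S" "z2 \<notin> B" "AE \<omega> in markov_path S K z2. \<forall>n. \<omega> n \<in> B \<longleftrightarrow> z2 \<in> B"
    proof (rule ccontr)
      assume "\<not> thesis"
      with that have *: "\<And>z. z \<in> space S \<Longrightarrow> AE \<omega> in markov_path S K z. \<forall>n. \<omega> n \<in> B \<longleftrightarrow> z \<in> B \<Longrightarrow> z \<in> B" by blast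
      have "AE z in \<pi>. z \<in> space \<pi>" by (rule AE_space)
      with all have "AE z in \<pi>. z \<in> B" by eventually_elim (rule *, auto)
      with nB show False by simp
    qed
    obtain z1 where z1: "z1 \<in> space S" "z1 \<in> B" "AE \<omega> in markov_path S K z1. \<forall>n. \<omega> n \<in> B \<longleftrightarrow> z1 \<in> B"
    proof (rule ccontr)
      assume "\<not> thesis"
      with that have *: "\<And>z. z \<in> space S \<Longrightarrow> AE \<omega> in markov_path S K z. \<forall>n. \<omega> n \<in> B \<longleftrightarrow> z \<in> B \<Longrightarrow> z \<notin> B" by blast
      have "AE z in \<pi>. z \<in> space \<pi>" by (rule AE_space)
      with all have "AE z in \<pi>. z \<notin> A" by eventually_elim (use * A_B in auto)
      then have "emeasure \<pi> A = 0"
        using sets.sets_into_space[OF A] by (subst (asm) AE_iff_measurable[of A]) (auto simp: sets_pi)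
      with pos show False by simp
    qed
    from irr obtain \<psi> where psi: "sets \<psi> = sets S" "emeasure \<psi> (space S) \<noteq> 0"
      and irr': "\<And>z C. z \<in> space S \<Longrightarrow> C \<in> sets S \<Longrightarrow> emeasure \<psi> C > 0 \<Longrightarrow> return_prob S K z C > 0"
      unfolding phi_irreducible_def by blast
    have "emeasure \<psi> (space S) = emeasure \<psi> B + emeasure \<psi> (space S - B)"
      using sets.sets_into_space[OF B] psi(1) by (subst plus_emeasure) (auto intro!: arg_cong[where f="emeasure _"])
    with psi(2) consider "emeasure \<psi> B > 0" | "emeasure \<psi> (space S - B) > 0"
      by (auto simp: zero_less_iff_neq_zero)
    then show False
    proof cases
      case 1
      have "\<not> (AE \<omega> in markov_path S K z2. \<forall>n\<ge>1. \<omega> n \<notin> B)"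
        using irr'[OF z2(1) B 1] return_prob_pos_iff[OF z2(1) B] by simp
      moreover have "AE \<omega> in markov_path S K z2. \<forall>n\<ge>1. \<omega> n \<notin> B"
        using z2(3) by eventually_elim (use z2(2) in auto)
      ultimately show False by simp
    next
      case 2
      have B': "space S - B \<in> sets S" by measurable
      have "\<not> (AE \<omega> in markov_path S K z1. \<forall>n\<ge>1. \<omega> n \<notin> space S - B)"
        using irr'[OF z1(1) B' 2] return_prob_pos_iff[OF z1(1) B'] by simp
      moreover have "AE \<omega> in markov_path S K z1. \<forall>n\<ge>1. \<omega> n \<notin> space S - B"
        using z1(3) by eventually_elim (use z1(2) in auto)
      ultimately show False by simp
    qed
  qed
  moreover have "AE z in \<pi>. z \<in> space \<pi>" by (rule AE_space)
  ultimately show ?thesis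
  proof eventually_elim
    fix z assume zB: "z \<in> B" and "z \<in> space \<pi>"
    then have z: "z \<in> space S" by simp
    have "{\<omega>\<in>space paths. \<forall>n. \<omega> n \<notin> A} \<in> sets paths" by measurable
    then have "{\<omega>\<in>space paths. \<forall>n. \<omega> n \<notin> A} \<in> null_sets (markov_path S K z)"
      using zB by (simp add: null_sets_def sets_path z B_def u_def)
    then have "AE \<omega> in markov_path S K z. \<omega> \<notin> {\<omega>\<in>space paths. \<forall>n. \<omega> n \<notin> A}" by (rule AE_not_in)
    with AE_space show "AE \<omega> in markov_path S K z. \<exists>n. \<omega> n \<in> A"
      by eventually_elim (simp add: space_path z)
  qed
qed

text \<open>The starting points that do not hit \<open>A\<close> almost surely form a null set. The
  chain leaves it at some time \<ge> 1, and from there it hits \<open>A\<close>. Asking for a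
  positive time matters: a hit at time 0 would not count as a return.\<close>

theorem harris_recurrent_if_leaves_null_sets:
  assumes stat: "stationary K \<pi>" and sets_pi: "sets \<pi> = sets S"
    and irr: "phi_irreducible S K"
    and leaves: "\<And>z N. z \<in> space S \<Longrightarrow> N \<in> null_sets \<pi> \<Longrightarrow> AE \<omega> in markov_path S K z. \<exists>n\<ge>1. \<omega> n \<notin> N"
  shows "harris_recurrent S K \<pi>"
  unfolding harris_recurrent_def
proof (intro conjI ballI impI irr sets_pi stat)
  fix A z assume A[measurable]: "A \<in> sets S" and pos: "emeasure \<pi> A > 0" and z: "z \<in> space S"
  define G where "G z \<longleftrightarrow> (AE \<omega> in markov_path S K z. \<exists>n. \<omega> n \<in> A)" for z
  have P_sub[measurable]: "markov_path S K \<in> measurable S (subprob_algebra paths)"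
    by (rule measurable_prob_algebraD) measurable
  have G[measurable]: "Measurable.pred S G"
    unfolding G_def by (rule pred_AE_kernel[OF P_sub]) measurable
  have "AE z in \<pi>. G z"
    unfolding G_def by (rule AE_hits_of_stationary[OF stat sets_pi irr A pos])
  then have null: "{z\<in>space S. \<not> G z} \<in> null_sets \<pi>"
    using sets_eq_imp_space_eq[OF sets_pi] sets_pi by (subst (asm) AE_iff_null) (auto simp: pred_def)
  \<comment> \<open>The Markov property at the fixed time \<open>n\<close>, obtained by shifting one
    step at a time; the existential time of escape is then handled by taking all \<open>n\<close>
    together.\<close>
  have hits: "AE \<omega> in markov_path S K z. G (\<omega> n) \<longrightarrow> (\<exists>k\<ge>n. \<omega> k \<in> A)" if "z \<in> space S" for n z
    using that
  proof (induction n arbitrary: z)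
    case 0
    show ?case
    proof (cases "G z")
      case True
      then show ?thesis unfolding G_def by eventually_elim auto
    next
      case False
      have "AE \<omega> in markov_path S K z. \<not> G (\<omega> 0)"
        by (rule AE_path_start[OF 0, of "\<lambda>z. \<not> G z"]) (use False in auto)
      then show ?thesis by eventually_elim simp
    qed
  next
    case (Suc n)
    have "AE y in K z. y \<in> space (K z)" by (rule AE_space)
    then have "AE y in K z. AE \<omega> in markov_path S K y. G (\<omega> n) \<longrightarrow> (\<exists>k\<ge>Suc n. case_nat z \<omega> k \<in> A)"
    proof eventually_elim
      fix y assume "y \<in> space (K z)"
      then have "y \<in> space S" by (simp add: space_kernel Suc.prems)
      from Suc.IH[OF this] show "AE \<omega> in markov_path S K y. G (\<omega> n) \<longrightarrow> (\<exists>k\<ge>Suc n. case_nat z \<omega> k \<in> A)"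
        by eventually_elim (force intro: exI[of _ "Suc _"])
    qed
    then show ?case
      by (subst AE_path_shift[OF Suc.prems]) (auto)
  qed
  have "AE \<omega> in markov_path S K z. \<forall>n. G (\<omega> n) \<longrightarrow> (\<exists>k\<ge>n. \<omega> k \<in> A)"
    using hits[OF z] by (simp add: AE_all_countable)
  moreover have "AE \<omega> in markov_path S K z. \<omega> \<in> space (markov_path S K z)" by (rule AE_space)
  ultimately have "AE \<omega> in markov_path S K z. \<exists>n\<ge>1. \<omega> n \<in> A"
    using leaves[OF z null]
  proof eventually_elim
    fix \<omega> assume *: "\<forall>n. G (\<omega> n) \<longrightarrow> (\<exists>k\<ge>n. \<omega> k \<in> A)" "\<omega> \<in> space (markov_path S K z)"
      "\<exists>n\<ge>1. \<omega> n \<notin> {z\<in>space S. \<not> G z}"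
    then obtain n where n: "n \<ge> 1" "\<omega> n \<notin> {z\<in>space S. \<not> G z}" by blast
    have "\<omega> n \<in> space S" using *(2) by (auto simp: space_path[OF z] space_PiM)
    with n have "G (\<omega> n)" by simp
    then obtain k where "k \<ge> n" "\<omega> k \<in> A" using * by blast
    with n show "\<exists>n\<ge>1. \<omega> n \<in> A" by (intro exI[of _ k]) auto
  qed
  then show "return_prob S K z A = 1" by (simp add: return_prob_eq_1_iff[OF z A])
qed

end

section \<open>The trans-dimensional model\<close>

context transdim_mcmc
begin

text \<open>The cylinder over the region among total functions. There the topology and the Borel
  sets of the type are available, whereas the region itself consists of extensional
  functions.\<close>

definition extended_region :: "nat \<Rightarrow> (nat \<Rightarrow> real) set" where
  "extended_region m = {x. restrict x {..<dimn T m} \<in> region T m}"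

lemma open_extended_region: "m \<in> models T \<Longrightarrow> open (extended_region m)"
proof -
  assume m: "m \<in> models T"
  let ?X = "product_topology (\<lambda>_. euclideanreal) (UNIV :: nat set)"
  have "continuous_map ?X (product_topology (\<lambda>_. euclideanreal) {..<dimn T m}) (\<lambda>x. restrict x {..<dimn T m})"
    by (auto simp: continuous_map_componentwise intro!: continuous_map_product_projection)
  from openin_continuous_map_preimage[OF this region_open[OF m]]
  show ?thesis by (simp add: euclidean_product_topology extended_region_def)
qed

lemma region_subset: "m \<in> models T \<Longrightarrow> region T m \<subseteq> extensional {..<dimn T m}"
  using openin_subset[OF region_open] by (auto simp: PiE_def)

lemma restrict_region: "m \<in> models T \<Longrightarrow> x \<in> region T m \<Longrightarrow> restrict x {..<dimn T m} = x"
  using region_subset by (intro extensional_restrict) auto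

text \<open>Extending a point by zeros is measurable, and the region is the preimage of its open
  cylinder under this map.\<close>

lemma sets_region [measurable]:
  assumes m: "m \<in> models T"
  shows "region T m \<in> sets (\<Pi>\<^sub>M i\<in>{..<dimn T m}. lborel)"
proof -
  let ?e = "\<lambda>x l. if l < dimn T m then x l else 0 :: real"
  have e: "?e \<in> measurable (\<Pi>\<^sub>M i\<in>{..<dimn T m}. lborel) (\<Pi>\<^sub>M i\<in>UNIV. borel)"
  proof (rule measurable_PiM_single')
    fix l show "(\<lambda>x. ?e x l) \<in> borel_measurable (\<Pi>\<^sub>M i\<in>{..<dimn T m}. lborel)"
      by (cases "l < dimn T m") simp_all
  qed auto
  have "extended_region m \<in> sets (\<Pi>\<^sub>M i\<in>UNIV. borel)"
    using open_extended_region[OF m] by (simp add: sets_PiM_equal_borel)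
  from measurable_sets[OF e this]
  have "?e -` extended_region m \<inter> space (\<Pi>\<^sub>M i\<in>{..<dimn T m}. lborel) \<in> sets (\<Pi>\<^sub>M i\<in>{..<dimn T m}. lborel)" .
  moreover have "?e -` extended_region m \<inter> space (\<Pi>\<^sub>M i\<in>{..<dimn T m}. lborel) = region T m"
  proof -
    have "restrict (?e x) {..<dimn T m} = restrict x {..<dimn T m}" for x by (auto simp: fun_eq_iff)
    then show ?thesis
      using region_subset[OF m] by (auto simp: extended_region_def space_PiM PiE_def extensional_restrict)
  qed
  ultimately show ?thesis by simp
qed

lemma space_region_lebesgue [simp]: "m \<in> models T \<Longrightarrow> space (region_lebesgue T m) = region T m"
  using region_subset by (auto simp: region_lebesgue_def space_restrict_space space_PiM PiE_def)

lemma measurable_region_lebesgueI: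
  assumes "m \<in> models T" "f \<in> measurable M (\<Pi>\<^sub>M i\<in>{..<dimn T m}. lborel)" "\<And>x. x \<in> space M \<Longrightarrow> f x \<in> region T m"
  shows "f \<in> measurable M (region_lebesgue T m)"
  unfolding region_lebesgue_def using assms by (intro measurable_restrict_space2) auto

lemma measurable_region_lebesgue1:
  "f \<in> measurable (\<Pi>\<^sub>M i\<in>{..<dimn T m}. lborel) N \<Longrightarrow> f \<in> measurable (region_lebesgue T m) N"
  unfolding region_lebesgue_def by (rule measurable_restrict_space1)

text \<open>The family used to generate \<open>state_space\<close> is already closed, so a set of
  states is measurable exactly when each of its slices is; measurable maps can be checked one model
  at a time.\<close>

lemma sigma_algebra_state_space:
  "sigma_algebra (SIGMA m:models T. region T m)
     {A. A \<subseteq> (SIGMA m:models T. region T m) \<and> (\<forall>m\<in>models T. Pair m -` A \<in> sets (region_lebesgue T m))}"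
    (is "sigma_algebra ?O ?C")
proof (rule sigma_algebra_iff2[THEN iffD2], intro conjI ballI allI impI)
  show "?C \<subseteq> Pow ?O" "{} \<in> ?C" by auto
next
  fix A assume A: "A \<in> ?C"
  have "Pair m -` (?O - A) \<in> sets (region_lebesgue T m)" if m: "m \<in> models T" for m
  proof -
    have "Pair m -` (?O - A) = space (region_lebesgue T m) - Pair m -` A"
      using m by auto
    moreover have "Pair m -` A \<in> sets (region_lebesgue T m)" using A m by simp
    ultimately show ?thesis by (simp only: sets.compl_sets)
  qed
  then show "?O - A \<in> ?C" by auto
next
  fix A :: "nat \<Rightarrow> _" assume A: "range A \<subseteq> ?C"
  have "Pair m -` (\<Union> (range A)) \<in> sets (region_lebesgue T m)" if m: "m \<in> models T" for m
    using A m by (auto simp: vimage_UN)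
  then show "\<Union> (range A) \<in> ?C" using A by fastforce
qed

lemma space_state_space [simp]: "space (state_space T) = (SIGMA m:models T. region T m)"
  unfolding state_space_def by (rule space_measure_of) auto

lemma sets_state_space_iff:
  "A \<in> sets (state_space T) \<longleftrightarrow> A \<subseteq> (SIGMA m:models T. region T m) \<and>
     (\<forall>m\<in>models T. Pair m -` A \<in> sets (region_lebesgue T m))"
proof -
  have "sets (state_space T) = {A. A \<subseteq> (SIGMA m:models T. region T m) \<and> (\<forall>m\<in>models T. Pair m -` A \<in> sets (region_lebesgue T m))}"
    unfolding state_space_def
    by (subst sets_measure_of) (auto simp: sigma_algebra.sigma_sets_eq[OF sigma_algebra_state_space])
  then show ?thesis by simp
qed

lemma measurable_Pair_state [measurable]:
  assumes m: "m \<in> models T"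
  shows "Pair m \<in> measurable (region_lebesgue T m) (state_space T)"
proof (rule measurableI)
  fix A assume A: "A \<in> sets (state_space T)"
  then have "Pair m -` A \<in> sets (region_lebesgue T m)" using m by (simp add: sets_state_space_iff)
  then show "Pair m -` A \<inter> space (region_lebesgue T m) \<in> sets (region_lebesgue T m)" by auto
qed (use m in auto)

lemma measurable_state_spaceI:
  assumes f: "\<And>m. m \<in> models T \<Longrightarrow> (\<lambda>x. f (m, x)) \<in> measurable (region_lebesgue T m) N"
  shows "f \<in> measurable (state_space T) N"
proof (rule measurableI)
  fix s assume "s \<in> space (state_space T)"
  then show "f s \<in> space N" using f[THEN measurable_space] by auto
next
  fix A assume A: "A \<in> sets N"
  show "f -` A \<inter> space (state_space T) \<in> sets (state_space T)"
    unfolding sets_state_space_iff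
  proof (intro conjI ballI)
    fix m assume m: "m \<in> models T"
    have "Pair m -` (f -` A \<inter> space (state_space T)) = (\<lambda>x. f (m, x)) -` A \<inter> space (region_lebesgue T m)"
      using m by auto
    then show "Pair m -` (f -` A \<inter> space (state_space T)) \<in> sets (region_lebesgue T m)"
      using measurable_sets[OF f[OF m] A] by simp
  qed auto
qed

section \<open>Augmented spaces and their coordinate projections\<close>

definition augmented :: "nat \<Rightarrow> (nat \<Rightarrow> real) measure" where
  "augmented m = restrict_space (\<Pi>\<^sub>M l\<in>UNIV. borel) (aug_region T m)"

lemma space_augmented [simp]: "space (augmented m) = aug_region T m"
  by (simp add: augmented_def space_restrict_space space_PiM)

lemma measurable_augmented_component [measurable]: "(\<lambda>x. x l) \<in> borel_measurable (augmented m)"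
  unfolding augmented_def by (intro measurable_restrict_space1) measurable

lemma measurable_augmented_restrict:
  "m \<in> models T \<Longrightarrow> (\<lambda>x. restrict x {..<dimn T m}) \<in> measurable (augmented m) (region_lebesgue T m)"
  by (rule measurable_region_lebesgueI) (auto simp: aug_region_def intro!: measurable_restrict)

text \<open>The natural domain of the coordinate map number \<open>l\<close> out of model
  \<open>m\<close>: the values that this coordinate takes on the augmented space.\<close>

definition slot :: "nat \<Rightarrow> nat \<Rightarrow> real set" where
  "slot m l = (\<lambda>x. x l) ` aug_region T m"

lemma slot_high:
  assumes m: "m \<in> models T" and l: "l \<ge> dimn T m"
  shows "slot m l = aux T"
proof -
  from region_nonempty[OF m] obtain x where x: "x \<in> region T m" by auto
  have "t \<in> slot m l" if "t \<in> aux T" for t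
  proof -
    let ?y = "\<lambda>k. if k < dimn T m then x k else t"
    have "restrict ?y {..<dimn T m} = restrict x {..<dimn T m}" by (auto simp: fun_eq_iff)
    then have "?y \<in> aug_region T m"
      using x that by (simp add: aug_region_def restrict_region[OF m x])
    moreover have "?y l = t" using l by simp
    ultimately show ?thesis unfolding slot_def by (intro image_eqI[of _ _ ?y]) simp_all
  qed
  then show ?thesis using l by (auto simp: slot_def aug_region_def)
qed

lemma section_low:
  assumes m: "m \<in> models T" and l: "l < dimn T m" and x: "x \<in> aug_region T m"
  shows "{t. x(l := t) \<in> aug_region T m} = {t. x(l := t) \<in> extended_region m}"
  using x l by (auto simp: aug_region_def extended_region_def)

lemma section_low_open:
  assumes m: "m \<in> models T" and l: "l < dimn T m" and x: "x \<in> aug_region T m"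
  shows "open {t. x(l := t) \<in> aug_region T m}"
proof -
  have "continuous_on UNIV (\<lambda>t. x(l := t))"
  proof (rule continuous_on_coordinatewise_then_product)
    fix k show "continuous_on UNIV (\<lambda>t. (x(l := t)) k)"
      by (cases "k = l") simp_all
  qed
  from open_vimage[OF open_extended_region[OF m] this]
  show ?thesis by (simp add: section_low[OF m l x] vimage_def)
qed

text \<open>A region need not be a box, so the inclusion may be strict for state coordinates.
  Derivatives within the two sets nevertheless agree there, because both sets are open.\<close>

lemma section_subset_slot: "{t. x(l := t) \<in> aug_region T m} \<subseteq> slot m l"
proof
  fix t assume "t \<in> {t. x(l := t) \<in> aug_region T m}"
  then show "t \<in> slot m l" unfolding slot_def by (intro image_eqI[of _ _ "x(l := t)"]) auto
qed

lemma slot_low_open: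
  assumes m: "m \<in> models T" and l: "l < dimn T m"
  shows "open (slot m l)"
proof (rule openI)
  fix t assume "t \<in> slot m l"
  then obtain x where x: "x \<in> aug_region T m" "t = x l" by (auto simp: slot_def)
  have "open {t. x(l := t) \<in> aug_region T m}" by (rule section_low_open[OF m l x(1)])
  moreover have "t \<in> {t. x(l := t) \<in> aug_region T m}" using x by simp
  ultimately obtain e where "e > 0" "ball t e \<subseteq> {t. x(l := t) \<in> aug_region T m}"
    using open_contains_ball by blast
  then show "\<exists>e>0. ball t e \<subseteq> slot m l" using section_subset_slot by blast
qed

lemma section_high:
  assumes m: "m \<in> models T" and l: "l \<ge> dimn T m" and x: "x \<in> aug_region T m"
  shows "{t. x(l := t) \<in> aug_region T m} = slot m l"
proof -
  have "restrict (x(l := t)) {..<dimn T m} = restrict x {..<dimn T m}" for t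
    using l by (auto simp: fun_eq_iff)
  then show ?thesis unfolding slot_high[OF m l] using x l by (auto simp: aug_region_def)
qed

lemma slot_borel [measurable]: "m \<in> models T \<Longrightarrow> slot m l \<in> sets borel"
  using slot_low_open[of m l] slot_high[of m l] aux_interval by (cases "l < dimn T m") auto

text \<open>The slot is open or is the auxiliary interval, whose boundary lies in {0, 1}. This is
  the countable exceptional set in the measurability of derivatives.\<close>

lemma slot_boundary: "m \<in> models T \<Longrightarrow> countable (slot m l - interior (slot m l))"
proof (cases "l < dimn T m")
  case True
  then show "m \<in> models T \<Longrightarrow> ?thesis" using slot_low_open[of m l] by (simp add: interior_open)
next
  case False
  have "countable (aux T - interior (aux T))"
    using aux_interval
  proof
    assume "aux T = {0..1}"
    then have "aux T - interior (aux T) \<subseteq> {0, 1}" by auto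
    then show ?thesis by (rule countable_subset) simp
  qed (simp add: interior_open)
  then show "m \<in> models T \<Longrightarrow> ?thesis" using slot_high[of m l] False by simp
qed

end

section \<open>Coordinate maps, the Jacobian and the acceptance probability of a jump\<close>

locale coordinate_preserving_mcmc = transdim_mcmc +
  assumes coordinate_preserving: "coordinate_preserving T"
begin

text \<open>The choice is made separately for every ordered pair of models. On slots the result is
  forced by the jump map, so the two directions are still mutually inverse there.\<close>

definition coord_map :: "nat \<Rightarrow> nat \<Rightarrow> nat \<Rightarrow> real \<Rightarrow> real" where
  "coord_map i j = (SOME h. (\<forall>x\<in>aug_region T i. \<forall>l. jump_map T i j x l = h l (x l)) \<and>
     (\<forall>l. h l differentiable_on slot i l))"

context
  fixes i j assumes ij: "i \<in> models T" "j \<in> models T" "jump T i j > 0"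
begin

lemma coord_map: "(\<forall>x\<in>aug_region T i. \<forall>l. jump_map T i j x l = coord_map i j l (x l)) \<and>
     (\<forall>l. coord_map i j l differentiable_on slot i l)"
proof -
  have "\<exists>h. (\<forall>x\<in>aug_region T i. \<forall>l. jump_map T i j x l = h l (x l)) \<and> (\<forall>l. h l differentiable_on slot i l)"
    using coordinate_preserving ij unfolding coordinate_preserving_def slot_def by blast
  then show ?thesis unfolding coord_map_def by (rule someI_ex)
qed

lemma jump_map_coord: "x \<in> aug_region T i \<Longrightarrow> jump_map T i j x l = coord_map i j l (x l)"
  and coord_map_differentiable: "coord_map i j l differentiable_on slot i l"
  using coord_map by auto

text \<open>Continuation by the identity yields a Borel function on the whole line whose preimages
  of null sets stay null.\<close>

definition ext_coord_map :: "nat \<Rightarrow> real \<Rightarrow> real" where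
  "ext_coord_map l t = (if t \<in> slot i l then coord_map i j l t else t)"

lemma ext_coord_map_measurable [measurable]: "ext_coord_map l \<in> borel_measurable borel"
  unfolding ext_coord_map_def
  using differentiable_imp_continuous_on[OF coord_map_differentiable] slot_borel ij
  by (intro borel_measurable_continuous_on_if continuous_intros) auto

lemma jump_map_ext_coord: "x \<in> aug_region T i \<Longrightarrow> jump_map T i j x l = ext_coord_map l (x l)"
  by (simp add: ext_coord_map_def jump_map_coord slot_def)

lemma jump_map_component_measurable [measurable]: "(\<lambda>x. jump_map T i j x l) \<in> borel_measurable (augmented i)"
proof -
  have "(\<lambda>x. ext_coord_map l (x l)) \<in> borel_measurable (augmented i)" by measurable
  then show ?thesis by (rule measurable_cong[THEN iffD1, rotated]) (simp add: jump_map_ext_coord)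
qed

lemma jump_map_restrict_measurable:
  "(\<lambda>x. restrict (jump_map T i j x) {..<dimn T j}) \<in> measurable (augmented i) (region_lebesgue T j)"
  using jump_map_mem[OF ij]
  by (intro measurable_region_lebesgueI ij measurable_restrict) (auto simp: aug_region_def)

text \<open>The definition differentiates along sections, which vary with \<open>x\<close>;
  replacing them by slots makes factor \<open>l\<close> a function of \<open>x l\<close> alone, from
  which measurability follows.\<close>

lemma jacobian_eq:
  assumes x: "x \<in> aug_region T i"
  shows "jacobian T i j x =
    limsup (\<lambda>n. \<Prod>l<n. ennreal \<bar>if x l \<in> slot i l then vector_derivative (coord_map i j l) (at (x l) within slot i l) else 0\<bar>)"
proof -
  have "vector_derivative (\<lambda>t. jump_map T i j (x(l := t)) l) (at (x l) within {t. x(l := t) \<in> aug_region T i})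
    = vector_derivative (coord_map i j l) (at (x l) within slot i l)" for l
  proof -
    let ?S = "{t. x(l := t) \<in> aug_region T i}"
    have xl: "x l \<in> ?S" using x by simp
    have eq: "jump_map T i j (x(l := t)) l = coord_map i j l t" if "t \<in> ?S" for t
      using jump_map_coord[of "x(l := t)" l] that by simp
    have at_eq: "at (x l) within ?S = at (x l) within slot i l"
    proof (cases "l < dimn T i")
      case True
      show ?thesis
        using at_within_open[OF xl section_low_open[OF ij(1) True x]]
          at_within_open[OF _ slot_low_open[OF ij(1) True], of "x l"] subsetD[OF section_subset_slot xl]
        by simp
    next
      case False
      then show ?thesis using section_high[OF ij(1) _ x, of l] by simp
    qed
    have "((\<lambda>t. jump_map T i j (x(l := t)) l) has_vector_derivative D) (at (x l) within ?S) \<longleftrightarrow>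
      (coord_map i j l has_vector_derivative D) (at (x l) within ?S)" for D
      using has_vector_derivative_transform[OF xl, of "\<lambda>t. jump_map T i j (x(l := t)) l" "coord_map i j l" D]
        has_vector_derivative_transform[OF xl, of "coord_map i j l" "\<lambda>t. jump_map T i j (x(l := t)) l" D] eq
      by auto
    then show ?thesis unfolding vector_derivative_def at_eq by simp
  qed
  moreover have "x l \<in> slot i l" for l using x by (simp add: slot_def)
  ultimately show ?thesis by (simp add: jacobian_def)
qed

lemma jacobian_measurable [measurable]: "jacobian T i j \<in> borel_measurable (augmented i)"
proof -
  define D where "D l t = (if t \<in> slot i l then vector_derivative (coord_map i j l) (at t within slot i l) else 0)" for l t
  have [measurable]: "D l \<in> borel_measurable borel" for l
    unfolding D_def using ij
    by (intro borel_measurable_vector_derivative_within coord_map_differentiable slot_borel slot_boundary)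
  have "(\<lambda>x. limsup (\<lambda>n. \<Prod>l<n. ennreal \<bar>D l (x l)\<bar>)) \<in> borel_measurable (augmented i)"
    by measurable
  then show ?thesis
    by (rule measurable_cong[THEN iffD1, rotated]) (simp add: jacobian_eq D_def)
qed

lemma jump_accept_measurable: "jump_accept T i j \<in> borel_measurable (augmented i)"
proof -
  have d1: "(\<lambda>x. dens T j (restrict (jump_map T i j x) {..<dimn T j})) \<in> borel_measurable (augmented i)"
    by (rule measurable_compose[OF jump_map_restrict_measurable dens_measurable[OF ij(2)]])
  have d2: "(\<lambda>x. dens T i (restrict x {..<dimn T i})) \<in> borel_measurable (augmented i)"
    by (rule measurable_compose[OF measurable_augmented_restrict[OF ij(1)] dens_measurable[OF ij(1)]])
  note [measurable] = d1 d2
  show ?thesis unfolding jump_accept_def[abs_def] Let_def by measurable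
qed

end
end

section \<open>Measurability of one iteration\<close>

context transdim_mcmc
begin

lemma prob_space_aux: "prob_space (restrict_space lborel (aux T))"
proof
  have [measurable]: "aux T \<in> sets borel" using aux_interval by auto
  show "emeasure (restrict_space lborel (aux T)) (space (restrict_space lborel (aux T))) = 1"
    using aux_interval by (subst emeasure_restrict_space) (auto simp: space_restrict_space)
qed

abbreviation aux_seq :: "(nat \<Rightarrow> real) measure" where
  "aux_seq \<equiv> \<Pi>\<^sub>M l\<in>UNIV. restrict_space lborel (aux T)"

lemma prob_space_aux_seq: "prob_space aux_seq"
  by (rule prob_space_PiM) (rule prob_space_aux)

lemma region_component_measurable:
  "l < dimn T m \<Longrightarrow> (\<lambda>x. x l) \<in> borel_measurable (region_lebesgue T m)"
proof (rule measurable_region_lebesgue1)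
  assume "l < dimn T m"
  then have "(\<lambda>x. x l) \<in> measurable (\<Pi>\<^sub>M i\<in>{..<dimn T m}. lborel :: real measure) lborel"
    by (intro measurable_component_singleton) simp
  then show "(\<lambda>x. x l) \<in> borel_measurable (\<Pi>\<^sub>M i\<in>{..<dimn T m}. lborel :: real measure)"
    by (simp only: measurable_cong_sets[OF refl sets_lborel])
qed

lemma splice_measurable:
  assumes m: "m \<in> models T"
  shows "(\<lambda>(x, u) l. if l < dimn T m then x l else u l) \<in>
    measurable (region_lebesgue T m \<Otimes>\<^sub>M aux_seq) (augmented m)"
  unfolding augmented_def
proof (rule measurable_restrict_space2)
  show "(\<lambda>(x, u) l. if l < dimn T m then x l else u l) \<in>
      space (region_lebesgue T m \<Otimes>\<^sub>M aux_seq) \<rightarrow> aug_region T m"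
  proof safe
    fix x u assume "(x, u) \<in> space (region_lebesgue T m \<Otimes>\<^sub>M aux_seq)"
    then have x: "x \<in> region T m" and u: "\<And>l. u l \<in> aux T"
      using m by (auto simp: space_pair_measure space_PiM space_restrict_space PiE_iff)
    have "restrict (\<lambda>l. if l < dimn T m then x l else u l) {..<dimn T m} = restrict x {..<dimn T m}"
      by (auto simp: fun_eq_iff)
    then show "(\<lambda>l. if l < dimn T m then x l else u l) \<in> aug_region T m"
      using x u by (simp add: aug_region_def restrict_region[OF m])
  qed
  show "(\<lambda>(x, u) l. if l < dimn T m then x l else u l) \<in>
      measurable (region_lebesgue T m \<Otimes>\<^sub>M aux_seq) (\<Pi>\<^sub>M l\<in>UNIV. borel)"
    unfolding split_beta'
  proof (rule measurable_PiM_single')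
    fix l
    have x: "(\<lambda>x. x l) \<in> borel_measurable (region_lebesgue T m)" if "l < dimn T m"
      by (rule region_component_measurable[OF that])
    have "(\<lambda>u. u l) \<in> measurable aux_seq (restrict_space lborel (aux T))" by simp
    then have u: "(\<lambda>u. u l) \<in> borel_measurable aux_seq"
      by (rule measurable_compose) (intro measurable_restrict_space1, simp)
    show "(\<lambda>p. if l < dimn T m then fst p l else snd p l) \<in> borel_measurable (region_lebesgue T m \<Otimes>\<^sub>M aux_seq)"
      by (cases "l < dimn T m")
        (auto intro: measurable_compose[OF measurable_fst x] measurable_compose[OF measurable_snd u])
  qed auto
qed

lemma refresh_measurable [measurable]:
  assumes m: "m \<in> models T"
  shows "refresh T m \<in> measurable (region_lebesgue T m) (prob_algebra (augmented m))"
  unfolding refresh_def augmented_def[symmetric]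
proof (rule measurable_distr_prob_space2[OF measurable_const splice_measurable[OF m]])
  show "aux_seq \<in> space (prob_algebra aux_seq)"
    by (simp add: space_prob_algebra prob_space_aux_seq)
qed

lemma labelled_measurable:
  assumes "s \<in> measurable M (state_space T)"
  shows "(\<lambda>x. return (labelled_space T) (s x, lab)) \<in> measurable M (prob_algebra (labelled_space T))"
proof -
  have "(\<lambda>x. (s x, lab)) \<in> measurable M (labelled_space T)"
    unfolding labelled_space_def using assms by (intro measurable_Pair measurable_const) auto
  from measurable_compose[OF this measurable_return_prob_space] show ?thesis .
qed

lemma coin_labelled_measurable:
  assumes p: "p \<in> borel_measurable M"
    and s: "s \<in> measurable M (state_space T)" "s' \<in> measurable M (state_space T)"
  shows "(\<lambda>x. measure_pmf (bernoulli_pmf (p x)) \<bind>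
      (\<lambda>acc. return (labelled_space T) (if acc then (s x, lab) else (s' x, lab'))))
    \<in> measurable M (prob_algebra (labelled_space T))"
proof (rule measurable_bind_prob_space2)
  show "(\<lambda>x. measure_pmf (bernoulli_pmf (p x))) \<in> measurable M (prob_algebra (count_space UNIV))"
    using p by measurable
  show "(\<lambda>(x, acc). return (labelled_space T) (if acc then (s x, lab) else (s' x, lab')))
    \<in> measurable (M \<Otimes>\<^sub>M count_space UNIV) (prob_algebra (labelled_space T))"
  proof -
    have "(\<lambda>q. (if snd q then (s (fst q), lab) else (s' (fst q), lab'))) \<in> measurable (M \<Otimes>\<^sub>M count_space UNIV) (labelled_space T)"
      using s unfolding labelled_space_def by measurable
    from measurable_compose[OF this measurable_return_prob_space] show ?thesis by (simp add: split_beta')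
  qed
qed

lemma update_measurable:
  assumes m: "m \<in> models T" and i: "i < dimn T m"
  shows "(\<lambda>(x, z). x(i := z)) \<in> measurable (region_lebesgue T m \<Otimes>\<^sub>M lborel) (\<Pi>\<^sub>M i\<in>{..<dimn T m}. lborel)"
proof -
  have f: "fst \<in> measurable (region_lebesgue T m \<Otimes>\<^sub>M lborel) (\<Pi>\<^sub>M i\<in>{..<dimn T m}. lborel)"
    by (rule measurable_compose[OF measurable_fst measurable_region_lebesgue1[OF measurable_ident_sets[OF refl]]])
  show ?thesis
    unfolding split_beta'
    by (rule measurable_fun_upd[OF _ f measurable_snd]) (use i in auto)
qed

lemma proposal_kernel:
  assumes m: "m \<in> models T" and i: "i < dimn T m"
  shows "(\<lambda>x. density lborel (\<lambda>z. ennreal (proposal T m i x z))) \<in> measurable (region_lebesgue T m) (prob_algebra lborel)"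
proof (rule measurable_density_kernel)
  have "sets (region_lebesgue T m \<Otimes>\<^sub>M borel) = sets (region_lebesgue T m \<Otimes>\<^sub>M lborel)"
    by (intro sets_pair_measure_cong) auto
  then have "(\<lambda>(x, z). proposal T m i x z) \<in> borel_measurable (region_lebesgue T m \<Otimes>\<^sub>M lborel)"
    using proposal_measurable[OF m i] by (simp cong: measurable_cong_sets)
  then show "(\<lambda>(x, z). ennreal (proposal T m i x z)) \<in> borel_measurable (region_lebesgue T m \<Otimes>\<^sub>M lborel)"
    by (simp add: split_beta')
qed (use m i proposal_density in auto)

definition coord_move ::
  "nat \<Rightarrow> nat \<Rightarrow> (nat \<Rightarrow> real) \<Rightarrow> real \<Rightarrow> ((nat \<times> (nat \<Rightarrow> real)) \<times> nat option) measure" where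
  "coord_move m i x z =
     (if x(i := z) \<in> region T m
      then measure_pmf (bernoulli_pmf (coord_accept T m i x z)) \<bind>
        (\<lambda>acc. return (labelled_space T) (if acc then ((m, x(i := z)), Some i) else ((m, x), None)))
      else return (labelled_space T) ((m, x), None))"

lemma within_move_eq:
  "within_move T m x = uniform_count_measure {..<dimn T m} \<bind>
     (\<lambda>i. density lborel (\<lambda>z. ennreal (proposal T m i x z)) \<bind> coord_move m i x)"
  by (simp add: within_move_def coord_move_def[abs_def])

lemma coord_move_measurable:
  assumes m: "m \<in> models T" and i: "i < dimn T m"
  shows "(\<lambda>(x, z). coord_move m i x z) \<in>
    measurable (region_lebesgue T m \<Otimes>\<^sub>M lborel) (prob_algebra (labelled_space T))"
proof -
  let ?R = "region_lebesgue T m \<Otimes>\<^sub>M lborel"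
  let ?B = "{p \<in> space ?R. (fst p)(i := snd p) \<in> region T m}"
  have upd: "(\<lambda>p. (fst p)(i := snd p)) \<in> measurable ?R (\<Pi>\<^sub>M i\<in>{..<dimn T m}. lborel)"
    using update_measurable[OF m i] by (simp add: split_beta')
  have B: "?B \<in> sets ?R"
    using measurable_sets[OF upd sets_region[OF m]] by (simp add: vimage_def Int_def conj_commute)
  have st: "(\<lambda>p. (m, fst p)) \<in> measurable ?R (state_space T)"
    by (rule measurable_compose[OF measurable_fst measurable_Pair_state[OF m]])
  show ?thesis
    unfolding split_beta' coord_move_def
  \<comment> \<open>Density and reverse proposal are known to be measurable on the region only, so
    the acceptance probability is treated on the set where the proposed point stays inside.\<close>
  proof (rule measurable_If_restrict_space_iff[THEN iffD2])
    show "?B \<in> sets ?R" by (rule B)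
    show "(\<lambda>p. measure_pmf (bernoulli_pmf (coord_accept T m i (fst p) (snd p))) \<bind>
        (\<lambda>acc. return (labelled_space T) (if acc then ((m, (fst p)(i := snd p)), Some i) else ((m, fst p), None))))
      \<in> measurable (restrict_space ?R {p. (fst p)(i := snd p) \<in> region T m}) (prob_algebra (labelled_space T)) \<and>
      (\<lambda>p. return (labelled_space T) ((m, fst p), None)) \<in>
        measurable (restrict_space ?R {p. (fst p)(i := snd p) \<notin> region T m}) (prob_algebra (labelled_space T))"
    proof (intro conjI coin_labelled_measurable)
      let ?R1 = "restrict_space ?R {p. (fst p)(i := snd p) \<in> region T m}"
      have upd1: "(\<lambda>p. (fst p)(i := snd p)) \<in> measurable ?R1 (region_lebesgue T m)"
        by (rule measurable_region_lebesgueI[OF m measurable_restrict_space1[OF upd]])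
          (auto simp: space_restrict_space)
      show "(\<lambda>p. (m, (fst p)(i := snd p))) \<in> measurable ?R1 (state_space T)"
        by (rule measurable_compose[OF upd1 measurable_Pair_state[OF m]])
      show "(\<lambda>p. (m, fst p)) \<in> measurable ?R1 (state_space T)"
        by (rule measurable_restrict_space1[OF st])
      show "(\<lambda>p. return (labelled_space T) ((m, fst p), None)) \<in>
          measurable (restrict_space ?R {p. (fst p)(i := snd p) \<notin> region T m}) (prob_algebra (labelled_space T))"
        by (rule labelled_measurable[OF measurable_restrict_space1[OF st]])
      have q: "(\<lambda>p. proposal T m i (f p) (g p)) \<in> borel_measurable N"
        if "f \<in> measurable N (region_lebesgue T m)" "g \<in> borel_measurable N" for f g N
        using measurable_compose[OF measurable_Pair[OF that] proposal_measurable[OF m i]] by simp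
      have fst1: "fst \<in> measurable ?R1 (region_lebesgue T m)" and snd1: "snd \<in> borel_measurable ?R1"
        by (auto intro!: measurable_restrict_space1)
      have "(\<lambda>p. fst p i) \<in> borel_measurable ?R1"
        by (rule measurable_compose[OF fst1 region_component_measurable[OF i]])
      note [measurable] = this q[OF fst1 snd1] q[OF upd1 this]
        measurable_compose[OF fst1 dens_measurable[OF m]] measurable_compose[OF upd1 dens_measurable[OF m]]
      show "(\<lambda>p. coord_accept T m i (fst p) (snd p)) \<in> borel_measurable ?R1"
        unfolding coord_accept_def Let_def by measurable
    qed
  qed
qed

lemma proposal_move_measurable:
  assumes m: "m \<in> models T" and i: "i < dimn T m"
  shows "(\<lambda>x. density lborel (\<lambda>z. ennreal (proposal T m i x z)) \<bind> coord_move m i x)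
    \<in> measurable (region_lebesgue T m) (prob_algebra (labelled_space T))"
  by (rule measurable_bind_prob_space2[OF proposal_kernel[OF m i] coord_move_measurable[OF m i]])

lemma prob_space_direction:
  "m \<in> models T \<Longrightarrow> prob_space (uniform_count_measure {..<dimn T m})"
  using dimn_pos[of m] by (intro prob_space_uniform_count_measure) auto

lemma within_measurable:
  assumes m: "m \<in> models T"
  shows "within_move T m \<in> measurable (region_lebesgue T m) (prob_algebra (labelled_space T))"
  unfolding within_move_eq[abs_def]
  by (rule measurable_bind_countable[OF _ prob_space_direction[OF m]])
    (auto simp: sets_uniform_count_measure intro: proposal_move_measurable[OF m])

lemma prob_space_jump:
  assumes m: "m \<in> models T"
  shows "prob_space (point_measure {m' \<in> models T. jump T m m' > 0} (\<lambda>m'. ennreal (jump T m m')))"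
proof
  let ?J = "{m' \<in> models T. jump T m m' > 0}"
  \<comment> \<open>The models left out carry jump probability zero.\<close>
  have "(jump T m has_sum 1) ?J"
    using jump_sum[OF m] jump_nonneg[OF m]
    by (subst has_sum_cong_neutral[of "models T" ?J "jump T m" "jump T m"]) (auto simp: not_less antisym)
  then have "(\<integral>\<^sup>+m'. ennreal (jump T m m') \<partial>count_space ?J) = 1"
    by (subst nn_integral_count_space_has_sum) auto
  then show "emeasure (point_measure ?J (\<lambda>m'. ennreal (jump T m m')))
      (space (point_measure ?J (\<lambda>m'. ennreal (jump T m m')))) = 1"
    by (simp add: point_measure_def emeasure_density nn_integral_count_space_indicator mult.assoc indicator_inter_arith[symmetric])
qed

end

context coordinate_preserving_mcmc
begin

lemma between_measurable:
  assumes m: "m \<in> models T"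
  shows "(\<lambda>(x, x'). between_move T m x x') \<in>
    measurable (region_lebesgue T m \<Otimes>\<^sub>M augmented m) (prob_algebra (labelled_space T))"
  unfolding between_move_def split_beta'
proof (rule measurable_bind_countable)
  let ?J = "{m' \<in> models T. jump T m m' > 0}"
  let ?R = "region_lebesgue T m \<Otimes>\<^sub>M augmented m"
  show "countable ?J" by simp
  show "prob_space (point_measure ?J (\<lambda>m'. ennreal (jump T m m')))" by (rule prob_space_jump[OF m])
  show "sets (point_measure ?J (\<lambda>m'. ennreal (jump T m m'))) = sets (count_space ?J)"
    by (rule sets_point_measure_count_space)
  fix m' assume "m' \<in> ?J"
  then have m': "m' \<in> models T" "jump T m m' > 0" by auto
  show "(\<lambda>p. measure_pmf (bernoulli_pmf (jump_accept T m m' (snd p))) \<bind>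
      (\<lambda>acc. return (labelled_space T)
         (if acc then ((m', restrict (jump_map T m m' (snd p)) {..<dimn T m'}), None) else ((m, fst p), None))))
    \<in> measurable ?R (prob_algebra (labelled_space T))"
    by (intro coin_labelled_measurable measurable_compose[OF measurable_snd jump_accept_measurable[OF m m']]
        measurable_compose[OF measurable_fst measurable_Pair_state[OF m]]
        measurable_compose[OF measurable_compose[OF measurable_snd jump_map_restrict_measurable[OF m m']]
          measurable_Pair_state[OF m'(1)]])
qed

lemma labelled_step_measurable:
  "labelled_step T \<in> measurable (state_space T) (prob_algebra (labelled_space T))"
proof (rule measurable_state_spaceI)
  fix m assume m: "m \<in> models T"
  let ?R = "region_lebesgue T m \<Otimes>\<^sub>M augmented m"
  have "(\<lambda>x. refresh T m x \<bind> (\<lambda>x'. measure_pmf (bernoulli_pmf (jump_prob T)) \<bind>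
      (\<lambda>jumping. if jumping then between_move T m x x' else within_move T m x)))
    \<in> measurable (region_lebesgue T m) (prob_algebra (labelled_space T))"
  proof (rule measurable_bind_prob_space2[OF refresh_measurable[OF m]], unfold split_beta', rule measurable_bind_countable)
    show "countable (UNIV :: bool set)" by simp
    fix jumping
    show "(\<lambda>p. if jumping then between_move T m (fst p) (snd p) else within_move T m (fst p))
      \<in> measurable ?R (prob_algebra (labelled_space T))"
      using between_measurable[OF m] measurable_compose[OF measurable_fst within_measurable[OF m]]
      by (cases jumping) (simp_all add: split_beta')
  qed (simp_all add: measure_pmf.prob_space_axioms)
  then show "(\<lambda>x. labelled_step T (m, x)) \<in> measurable (region_lebesgue T m) (prob_algebra (labelled_space T))"
    by (simp add: labelled_step_def)
qed

end

section \<open>Almost-sure statements about one iteration\<close>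

context transdim_mcmc
begin

text \<open>Both outcomes are required to satisfy \<open>Q\<close>, which makes the statement
  uniform in the acceptance probability.\<close>

lemma coin_move_AE:
  assumes u: "u \<in> space (labelled_space T)" "v \<in> space (labelled_space T)"
    and Q: "Measurable.pred (labelled_space T) Q" "Q u" "Q v"
  shows "AE y in measure_pmf (bernoulli_pmf p) \<bind>
      (\<lambda>acc. return (labelled_space T) (if acc then u else v)). Q y"
proof (rule AE_bind_countable[of _ UNIV _ "labelled_space T"])
  fix acc :: bool
  have *: "(if acc then u else v) \<in> space (labelled_space T)" using u by simp
  then show "return (labelled_space T) (if acc then u else v) \<in> space (prob_algebra (labelled_space T))"
    by (simp add: space_prob_algebra prob_space_return)
  show "AE y in return (labelled_space T) (if acc then u else v). Q y"
    using Q * by (subst AE_return) auto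
qed (use Q in auto)

lemma space_labelled [simp]: "space (labelled_space T) = (SIGMA m:models T. region T m) \<times> UNIV"
  by (simp add: labelled_space_def space_pair_measure)

lemma coord_move_AE:
  assumes m: "m \<in> models T" and x: "x \<in> region T m"
    and Q: "Measurable.pred (labelled_space T) Q" "Q ((m, x), None)"
      "x(i := z) \<in> region T m \<longrightarrow> Q ((m, x(i := z)), Some i)"
  shows "AE y in coord_move m i x z. Q y"
proof (cases "x(i := z) \<in> region T m")
  case True
  then show ?thesis
    unfolding coord_move_def using m x Q by (auto intro!: coin_move_AE)
next
  case False
  then show ?thesis
    unfolding coord_move_def using m x Q by (simp add: AE_return)
qed

text \<open>The proposal has a density, so a Lebesgue null set of proposed values is harmless
  whatever that density is.\<close>

lemma within_move_AE:
  assumes m: "m \<in> models T" and x: "x \<in> region T m"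
    and Q: "Measurable.pred (labelled_space T) Q" "Q ((m, x), None)"
      "\<And>i. i < dimn T m \<Longrightarrow> AE z in lborel. x(i := z) \<in> region T m \<longrightarrow> Q ((m, x(i := z)), Some i)"
  shows "AE y in within_move T m x. Q y"
  unfolding within_move_eq
proof (rule AE_bind_countable[of _ "{..<dimn T m}" _ "labelled_space T"])
  show "sets (uniform_count_measure {..<dimn T m}) = sets (count_space {..<dimn T m})"
    by (simp add: sets_uniform_count_measure)
  fix i assume "i \<in> {..<dimn T m}"
  then have i: "i < dimn T m" by simp
  have x': "x \<in> space (region_lebesgue T m)" using m x by simp
  show "density lborel (\<lambda>z. ennreal (proposal T m i x z)) \<bind> coord_move m i x \<in> space (prob_algebra (labelled_space T))"
    by (rule measurable_space[OF proposal_move_measurable[OF m i] x'])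
  have "coord_move m i x \<in> measurable lborel (prob_algebra (labelled_space T))"
    using measurable_compose[OF measurable_Pair1'[OF x'] coord_move_measurable[OF m i]] by simp
  then have k: "coord_move m i x \<in> measurable (density lborel (\<lambda>z. ennreal (proposal T m i x z))) (subprob_algebra (labelled_space T))"
    by (simp add: measurable_prob_algebraD)
  have q: "(\<lambda>z. ennreal (proposal T m i x z)) \<in> borel_measurable lborel"
    using measurable_compose[OF measurable_Pair1'[OF x'] proposal_measurable[OF m i]] by simp
  show "AE y in density lborel (\<lambda>z. ennreal (proposal T m i x z)) \<bind> coord_move m i x. Q y"
    unfolding AE_bind[OF k Q(1)] AE_density[OF q]
    using Q(3)[OF i] by eventually_elim (auto intro: coord_move_AE[OF m x Q(1,2)])
qed (use Q in auto)

end

context coordinate_preserving_mcmc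
begin

lemma between_move_AE:
  assumes m: "m \<in> models T" and x: "x \<in> region T m" "x' \<in> aug_region T m"
    and Q: "Measurable.pred (labelled_space T) Q" "Q ((m, x), None)"
      "\<And>m'. m' \<in> models T \<Longrightarrow> jump T m m' > 0 \<Longrightarrow> Q ((m', restrict (jump_map T m m' x') {..<dimn T m'}), None)"
  shows "AE y in between_move T m x x'. Q y"
  unfolding between_move_def
proof (rule AE_bind_countable[of _ "{m' \<in> models T. jump T m m' > 0}" _ "labelled_space T"])
  fix m' assume "m' \<in> {m' \<in> models T. jump T m m' > 0}"
  then have m': "m' \<in> models T" "jump T m m' > 0" by auto
  have s: "((m', restrict (jump_map T m m' x') {..<dimn T m'}), None) \<in> space (labelled_space T)"
    using jump_map_mem[OF m m' x(2)] m' by (simp add: aug_region_def)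
  have t: "((m, x), None) \<in> space (labelled_space T)" using m x by simp
  show "AE y in measure_pmf (bernoulli_pmf (jump_accept T m m' x')) \<bind>
      (\<lambda>acc. return (labelled_space T) (if acc then ((m', restrict (jump_map T m m' x') {..<dimn T m'}), None) else ((m, x), None))). Q y"
    by (rule coin_move_AE[OF s t Q(1) Q(3)[OF m'] Q(2)])
  show "measure_pmf (bernoulli_pmf (jump_accept T m m' x')) \<bind>
      (\<lambda>acc. return (labelled_space T) (if acc then ((m', restrict (jump_map T m m' x') {..<dimn T m'}), None) else ((m, x), None)))
      \<in> space (prob_algebra (labelled_space T))"
    using s t by (intro bind_countable_in_prob_algebra[of _ UNIV])
      (auto simp: space_prob_algebra prob_space_return measure_pmf.prob_space_axioms)
qed (use Q in \<open>auto simp: sets_point_measure_count_space\<close>)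

text \<open>Up to null sets a step has three kinds of outcome: the old point after any rejection, an
  accepted update of one coordinate, and the landing point of a jump. The models are countable, so
  one exceptional set of refreshed points serves all jumps.\<close>

lemma labelled_step_AE:
  assumes m: "m \<in> models T" and x: "x \<in> region T m"
    and Q: "Measurable.pred (labelled_space T) Q" "Q ((m, x), None)"
      "\<And>i. i < dimn T m \<Longrightarrow> AE z in lborel. x(i := z) \<in> region T m \<longrightarrow> Q ((m, x(i := z)), Some i)"
      "\<And>m'. m' \<in> models T \<Longrightarrow> jump T m m' > 0 \<Longrightarrow>
        AE x' in refresh T m x. Q ((m', restrict (jump_map T m m' x') {..<dimn T m'}), None)"
  shows "AE y in labelled_step T (m, x). Q y"
proof -
  let ?c = "measure_pmf (bernoulli_pmf (jump_prob T))"
  let ?g = "\<lambda>x' jumping. if jumping then between_move T m x x' else within_move T m x"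
  have x': "x \<in> space (region_lebesgue T m)" using m x by simp
  have R: "refresh T m x \<in> space (prob_algebra (augmented m))"
    by (rule measurable_space[OF refresh_measurable[OF m] x'])
  then have sets_R: "sets (refresh T m x) = sets (augmented m)" and space_R: "space (refresh T m x) = aug_region T m"
    by (auto simp: space_prob_algebra dest: sets_eq_imp_space_eq)
  have b: "between_move T m x \<in> measurable (augmented m) (prob_algebra (labelled_space T))"
    using measurable_compose[OF measurable_Pair1'[OF x'] between_measurable[OF m]] by simp
  have w: "within_move T m x \<in> space (prob_algebra (labelled_space T))"
    by (rule measurable_space[OF within_measurable[OF m] x'])
  have "(\<lambda>x'. ?c \<bind> ?g x') \<in> measurable (augmented m) (prob_algebra (labelled_space T))"
  proof (rule measurable_bind_countable[of UNIV])
    fix j show "(\<lambda>x'. ?g x' j) \<in> measurable (augmented m) (prob_algebra (labelled_space T))"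
      using b w by (cases j) auto
  qed (auto simp: measure_pmf.prob_space_axioms)
  then have k: "(\<lambda>x'. ?c \<bind> ?g x') \<in> measurable (refresh T m x) (subprob_algebra (labelled_space T))"
    by (intro measurable_prob_algebraD) (simp add: measurable_cong_sets[OF sets_R refl])
  have jumps: "AE x' in refresh T m x. \<forall>m'\<in>{m'\<in>models T. jump T m m' > 0}.
      Q ((m', restrict (jump_map T m m' x') {..<dimn T m'}), None)"
    using Q(4) by (intro AE_ball_countable') auto
  have "AE x' in refresh T m x. AE y in ?c \<bind> ?g x'. Q y"
    using jumps AE_space
  proof eventually_elim
    case (elim x')
    then have x'_aug: "x' \<in> aug_region T m" by (simp add: space_R)
    show ?case
    proof (rule AE_bind_countable[of _ UNIV _ "labelled_space T"])
      fix j
      show "?g x' j \<in> space (prob_algebra (labelled_space T))"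
        using w measurable_space[OF b] x'_aug by (cases j) auto
      show "AE y in ?g x' j. Q y"
        using within_move_AE[OF m x Q(1-3)] between_move_AE[OF m x x'_aug Q(1,2)] elim by (cases j) auto
    qed (use Q in auto)
  qed
  then show ?thesis
    unfolding labelled_step_def prod.case AE_bind[OF k Q(1)] .
qed

end

section \<open>Escape from null sets\<close>

abbreviation gaussian :: "real measure" where
  "gaussian \<equiv> density lborel (\<lambda>t. ennreal (std_normal_density t))"

lemma null_sets_gaussian: "null_sets gaussian = null_sets lborel"
proof -
  have "std_normal_density t \<noteq> 0" for t using normal_density_pos[of 1 0 t] by simp
  then have "A \<in> null_sets gaussian \<longleftrightarrow> A \<in> sets lborel \<and> (AE t in lborel. t \<notin> A)" for A
    by (subst null_sets_density_iff) auto
  then show ?thesis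
    using AE_iff_null_sets[of _ lborel] by (auto simp: null_sets_def)
qed

lemma AE_gaussian: "(AE t in gaussian. P t) \<longleftrightarrow> (AE t in lborel. P t)"
  by (simp add: AE_density normal_density_pos)

text \<open>
  The Gaussian only serves as a probability measure equivalent to Lebesgue measure: with probability
  factors, a product can be projected onto fewer coordinates.
\<close>

definition frozen_law :: "nat set \<Rightarrow> (nat \<Rightarrow> real) \<Rightarrow> nat \<Rightarrow> real measure" where
  "frozen_law F c l = (if l \<in> F then gaussian else return borel (c l))"

lemma sets_frozen_law [simp, measurable_cong]: "sets (frozen_law F c l) = sets borel"
  and space_frozen_law [simp]: "space (frozen_law F c l) = UNIV"
  by (auto simp: frozen_law_def)

lemma prob_space_frozen_law: "prob_space (frozen_law F c l)"
  by (auto simp: frozen_law_def prob_space_return prob_space_normal_density)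

interpretation frozen: product_prob_space "frozen_law F c" I for F c I
  by (intro product_prob_space.intro product_prob_space_axioms.intro product_sigma_finite.intro
      prob_space_frozen_law prob_space_imp_sigma_finite)

text \<open>With \<open>i\<close> randomized, Fubini makes its value the inner variable, and
  Gaussian and Lebesgue null sets coincide. What results no longer refers to the previous value of
  coordinate \<open>i\<close>.\<close>

lemma frozen_law_update_AE:
  assumes I: "finite I" "i \<in> I" and Q: "Measurable.pred (\<Pi>\<^sub>M l\<in>I. borel) Q"
    and AE: "AE x in (\<Pi>\<^sub>M l\<in>I. frozen_law (insert i F) c l). Q x"
  shows "AE x in (\<Pi>\<^sub>M l\<in>I. frozen_law F c l). AE z in lborel. Q (x(i := z))"
proof -
  let ?J = "I - {i}"
  have I_eq: "insert i ?J = I" and J: "finite ?J" "i \<notin> ?J" using I by auto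
  have sets_eq: "sets (\<Pi>\<^sub>M l\<in>I. frozen_law G c l) = sets (\<Pi>\<^sub>M l\<in>I. borel)" for G
    by (intro sets_PiM_cong) auto
  have Q1: "Measurable.pred (\<Pi>\<^sub>M l\<in>insert i ?J. frozen_law G c l) Q" for G
    using Q unfolding I_eq by (simp cong: measurable_cong_sets add: measurable_cong_sets[OF sets_eq refl])
  have Q2: "Measurable.pred (\<Pi>\<^sub>M l\<in>insert i ?J. frozen_law F c l) (\<lambda>x. AE z in lborel. Q (x(i := z)))"
  proof (rule lborel.pred_AE)
    have "(\<lambda>p. (fst p)(i := snd p)) \<in> measurable ((\<Pi>\<^sub>M l\<in>insert i ?J. frozen_law F c l) \<Otimes>\<^sub>M lborel) (\<Pi>\<^sub>M l\<in>I. borel)"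
    proof (rule measurable_fun_upd[of _ I])
      show "fst \<in> measurable ((\<Pi>\<^sub>M l\<in>insert i ?J. frozen_law F c l) \<Otimes>\<^sub>M lborel) (\<Pi>\<^sub>M l\<in>I. borel)"
        unfolding I_eq by (rule measurable_compose[OF measurable_fst measurable_ident_sets[OF sets_eq]])
    qed (use I in auto)
    from measurable_compose[OF this Q]
    show "Measurable.pred ((\<Pi>\<^sub>M l\<in>insert i ?J. frozen_law F c l) \<Otimes>\<^sub>M lborel) (\<lambda>p. Q ((fst p)(i := snd p)))" .
  qed
  have "AE x in (\<Pi>\<^sub>M l\<in>?J. frozen_law (insert i F) c l). AE z in frozen_law (insert i F) c i. Q (x(i := z))"
    using AE frozen.AE_PiM_insert(1)[OF J Q1, of "insert i F"] unfolding I_eq by blast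
  then have "AE x in (\<Pi>\<^sub>M l\<in>?J. frozen_law (insert i F) c l). AE z in lborel. Q (x(i := z))"
  proof -
    assume *: "AE x in (\<Pi>\<^sub>M l\<in>?J. frozen_law (insert i F) c l). AE z in frozen_law (insert i F) c i. Q (x(i := z))"
    have eq: "frozen_law (insert i F) c i = gaussian" by (simp add: frozen_law_def)
    from * show "AE x in (\<Pi>\<^sub>M l\<in>?J. frozen_law (insert i F) c l). AE z in lborel. Q (x(i := z))" unfolding eq AE_gaussian .
  qed
  also have "(\<Pi>\<^sub>M l\<in>?J. frozen_law (insert i F) c l) = (\<Pi>\<^sub>M l\<in>?J. frozen_law F c l)"
    by (intro PiM_cong) (auto simp: frozen_law_def)
  \<comment> \<open>The old value \<open>t\<close> is overwritten by \<open>z\<close>, so coordinate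
    \<open>i\<close> may be put back under whatever law \<open>frozen_law F c\<close>
    prescribes.\<close>
  finally have "AE x in (\<Pi>\<^sub>M l\<in>?J. frozen_law F c l). AE t in frozen_law F c i. AE z in lborel. Q ((x(i := t))(i := z))"
  proof eventually_elim
    case (elim x)
    then show ?case unfolding fun_upd_upd by (rule AE_I2)
  qed
  then show ?thesis
    using frozen.AE_PiM_insert(1)[OF J Q2] unfolding I_eq by blast
qed

context transdim_mcmc
begin

text \<open>
  The set \<open>F\<close> collects the coordinates that have already been randomized, so
  \<open>evades N n F s\<close> says that almost surely the chain is not in \<open>N\<close> after \<open>n\<close> steps from \<open>s\<close> with
  every coordinate randomized.
\<close>

primrec evades :: "(nat \<times> (nat \<Rightarrow> real)) set \<Rightarrow> nat \<Rightarrow> nat set \<Rightarrow> nat \<times> (nat \<Rightarrow> real) \<Rightarrow> bool" where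
  "evades N 0 F s \<longleftrightarrow> \<not> (F = UNIV \<and> s \<in> N)"
| "evades N (Suc n) F s \<longleftrightarrow> (AE p in labelled_step T s. evades N n (F \<union> set_option (snd p)) (fst p))"

text \<open>With fewer coordinates randomized at the start, the forbidden event that all are
  randomized becomes rarer. This permits forgetting coordinates that were randomized by a
  jump.\<close>

lemma evades_antimono: "F \<subseteq> F' \<Longrightarrow> evades N n F' s \<Longrightarrow> evades N n F s"
proof (induction n arbitrary: F F' s)
  case 0
  then show ?case by auto
next
  case (Suc n)
  from Suc.prems(2) show ?case
    unfolding evades.simps
    by eventually_elim (rule Suc.IH[rotated], use Suc.prems(1) in auto)
qed

lemma region_pred_measurable:
  assumes m: "m \<in> models T" and P: "Measurable.pred (state_space T) P"
  shows "Measurable.pred (\<Pi>\<^sub>M l\<in>{..<dimn T m}. borel) (\<lambda>x. x \<in> region T m \<longrightarrow> P (m, x))"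
proof -
  let ?B = "\<Pi>\<^sub>M l\<in>{..<dimn T m}. borel :: real measure"
  have sets_eq: "sets ?B = sets (\<Pi>\<^sub>M l\<in>{..<dimn T m}. lborel)"
    by (intro sets_PiM_cong) auto
  have reg: "region T m \<in> sets ?B" using sets_region[OF m] by (simp add: sets_eq)
  have "{x \<in> space (region_lebesgue T m). \<not> P (m, x)} \<in> sets (region_lebesgue T m)"
    using measurable_compose[OF measurable_Pair_state[OF m] P] by (intro predE pred_intros_logic)
  then have "{x \<in> region T m. \<not> P (m, x)} \<in> sets ?B"
    using reg unfolding space_region_lebesgue[OF m]
    by (auto simp: region_lebesgue_def sets_restrict_space sets_eq)
  moreover have "{x \<in> space ?B. x \<in> region T m \<longrightarrow> P (m, x)} = space ?B - {x \<in> region T m. \<not> P (m, x)}"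
    by auto
  ultimately show ?thesis
    by (simp only: pred_def sets.compl_sets)
qed

end

context coordinate_preserving_mcmc
begin

text \<open>The recursion passes to an almost-sure statement about a kernel, and the label varies in
  a countable type, so each level inherits measurability from the one below.\<close>

lemma evades_measurable:
  assumes N: "N \<in> sets (state_space T)"
  shows "Measurable.pred (state_space T) (evades N n F)"
    and "Measurable.pred (labelled_space T) (\<lambda>p. evades N n (F \<union> set_option (snd p)) (fst p))"
proof -
  have lab: "Measurable.pred (labelled_space T) (\<lambda>p. P (snd p) (fst p))"
    if "\<And>a. Measurable.pred (state_space T) (P a)" for P :: "nat option \<Rightarrow> _ \<Rightarrow> bool"
    unfolding labelled_space_def
    by (rule measurable_compose_countable[of "\<lambda>a p. P a (fst p)" _ _ snd])
      (auto intro: measurable_compose[OF measurable_fst that])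
  show *: "Measurable.pred (state_space T) (evades N n F)" for n F
  proof (induction n arbitrary: F)
    case 0
    show ?case unfolding evades.simps using N by measurable
  next
    case (Suc n)
    show ?case
      unfolding evades.simps
      by (rule pred_AE_kernel[OF measurable_prob_algebraD[OF labelled_step_measurable]])
        (rule lab[of "\<lambda>a. evades N n (F \<union> set_option a)"], rule Suc.IH)
  qed
  show "Measurable.pred (labelled_space T) (\<lambda>p. evades N n (F \<union> set_option (snd p)) (fst p))"
    by (rule lab[of "\<lambda>a. evades N n (F \<union> set_option a)"]) (rule *)
qed

text \<open>A value in the slot is completed to a point of the augmented space; jumping there and
  back returns that point, and in particular its coordinate \<open>l\<close>.\<close>

lemma coord_map_inverse:
  assumes ij: "i \<in> models T" "j \<in> models T" "jump T i j > 0" and t: "t \<in> slot i l"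
  shows "coord_map i j l t \<in> slot j l" "coord_map j i l (coord_map i j l t) = t"
proof -
  have ji: "j \<in> models T" "i \<in> models T" "jump T j i > 0" using ij jump_symmetric by auto
  from t obtain x where x: "x \<in> aug_region T i" "t = x l" by (auto simp: slot_def)
  let ?y = "jump_map T i j x"
  have y: "?y \<in> aug_region T j" by (rule jump_map_mem[OF ij x(1)])
  have yl: "?y l = coord_map i j l t" using jump_map_coord[OF ij x(1)] x by simp
  show "coord_map i j l t \<in> slot j l" using y yl[symmetric] by (simp add: slot_def)
  show "coord_map j i l (coord_map i j l t) = t"
    using jump_map_coord[OF ji y, of l] jump_map_inverse[OF ij x(1)] yl x by simp
qed

lemma ext_coord_map_null:
  assumes ij: "i \<in> models T" "j \<in> models T" "jump T i j > 0" and Z: "Z \<in> null_sets lborel"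
  shows "ext_coord_map i j l -` Z \<in> null_sets lborel"
proof (rule null_sets_vimage_differentiable_inverse[OF _ _ _ _ Z])
  have ji: "j \<in> models T" "i \<in> models T" "jump T j i > 0" using ij jump_symmetric by auto
  show "ext_coord_map i j l \<in> borel_measurable borel" by (rule ext_coord_map_measurable[OF ij])
  show "coord_map j i l differentiable_on slot j l" by (rule coord_map_differentiable[OF ji])
  fix t
  show "ext_coord_map i j l t \<in> slot j l \<and> coord_map j i l (ext_coord_map i j l t) = t" if "t \<in> slot i l"
    using coord_map_inverse[OF ij that] that by (simp add: ext_coord_map_def[OF ij])
  show "ext_coord_map i j l t = t" if "t \<notin> slot i l"
    using that by (simp add: ext_coord_map_def[OF ij])
qed

text \<open>Coordinate by coordinate, the jump takes a random value to a law without mass on null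
  sets and a frozen value to a frozen value. From index \<open>dimn T i\<close> on the source values
  are fresh uniform draws, so these coordinates land as randomized ones. The hypothesis covers all
  \<open>c\<close> because the landing values depend on the pair of models.\<close>

lemma jump_lands_AE:
  assumes ij: "i \<in> models T" "j \<in> models T" "jump T i j > 0"
    and Q: "Measurable.pred (\<Pi>\<^sub>M l\<in>{..<dimn T j}. borel) Q"
    and AE: "\<And>c. AE y in (\<Pi>\<^sub>M l\<in>{..<dimn T j}. frozen_law (F \<union> {dimn T i..}) c l). Q y"
  shows "AE x in (\<Pi>\<^sub>M l\<in>{..<dimn T i}. frozen_law F c l). x \<in> region T i \<longrightarrow>
    (AE x' in refresh T i x. Q (restrict (jump_map T i j x') {..<dimn T j}))"
proof -
  let ?d = "dimn T i" and ?d' = "dimn T j"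
  let ?I = "{..<?d}" and ?J = "{..<?d'}" and ?K = "{?d..<?d'}"
  let ?U = "restrict_space lborel (aux T)"
  define f where "f = ext_coord_map i j"
  have f_meas[measurable]: "f l \<in> borel_measurable borel" for l
    unfolding f_def by (rule ext_coord_map_measurable[OF ij])
  \<comment> \<open>The coordinate laws of the augmented source point: the given law for the state,
    uniform for the refreshed part.\<close>
  define L where "L l = (if l < ?d then frozen_law F c l else ?U)" for l
  define c' where "c' l = f l (c l)" for l
  let ?N = "frozen_law (F \<union> {?d..}) c'"
  have [measurable]: "aux T \<in> sets borel" using aux_interval by auto
  have f_L: "f l \<in> measurable (L l) borel" for l
    by (auto simp: L_def frozen_law_def intro!: measurable_restrict_space1)
  have prob_L: "prob_space (L l)" for l
    by (simp add: L_def prob_space_frozen_law prob_space_aux)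
  interpret L: product_prob_space L A for A
    by (intro product_prob_space.intro product_prob_space_axioms.intro product_sigma_finite.intro
        prob_L prob_space_imp_sigma_finite)
  interpret U: product_prob_space "\<lambda>_. ?U" A for A :: "nat set"
    by (intro product_prob_space.intro product_prob_space_axioms.intro product_sigma_finite.intro
        prob_space_aux prob_space_imp_sigma_finite)
  let ?g = "\<lambda>w. \<lambda>l\<in>?J. f l (w l)"
  have sets_N: "sets (\<Pi>\<^sub>M l\<in>?J. ?N l) = sets (\<Pi>\<^sub>M l\<in>?J. borel)"
    by (intro sets_PiM_cong) auto
  have "AE w in PiM ?J L. Q (?g w)"
  proof (rule AE_PiM_map[of L ?N])
    show "product_sigma_finite L" by unfold_locales
    show "product_sigma_finite ?N" by unfold_locales
    show "Measurable.pred (PiM ?J ?N) Q" using Q by (simp add: measurable_cong_sets[OF sets_N refl])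
    show "AE y in PiM ?J ?N. Q y" by (rule AE)
    show "f l \<in> measurable (L l) (?N l)" for l
      using f_L by (simp add: measurable_cong_sets[OF refl sets_frozen_law])
    fix l Z assume Z: "Z \<in> null_sets (?N l)"
    consider "l < ?d" "l \<in> F" | "l < ?d" "l \<notin> F" | "?d \<le> l" by linarith
    then show "f l -` Z \<inter> space (L l) \<in> null_sets (L l)"
    proof cases
      case 1
      with Z have "Z \<in> null_sets lborel" by (simp add: frozen_law_def null_sets_gaussian)
      with 1 show ?thesis
        using ext_coord_map_null[OF ij] by (simp add: L_def frozen_law_def null_sets_gaussian f_def)
    next
      case 2
      with Z have Z': "Z \<in> sets borel" "c' l \<notin> Z"
        by (auto simp: frozen_law_def null_sets_def indicator_def split: if_splits)
      have "f l -` Z \<in> sets borel" using measurable_sets[OF f_meas Z'(1)] by simp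
      with 2 Z' show ?thesis by (simp add: L_def frozen_law_def null_sets_def c'_def)
    next
      case 3
      with Z have "Z \<in> null_sets lborel" by (simp add: frozen_law_def null_sets_gaussian)
      from ext_coord_map_null[OF ij this] have "f l -` Z \<in> null_sets lborel" by (simp add: f_def)
      then have "f l -` Z \<inter> aux T \<in> null_sets lborel"
        by (rule null_set_Int2) simp
      with 3 show ?thesis
        by (simp add: L_def null_sets_restrict_space space_restrict_space)
    qed
  qed simp
  moreover have Q_g: "Measurable.pred (PiM A L) (\<lambda>w. Q (?g w))" if "?J \<subseteq> A" for A
  proof -
    have "?g \<in> measurable (PiM A L) (\<Pi>\<^sub>M l\<in>?J. borel)"
    proof (rule measurable_restrict)
      fix l assume "l \<in> ?J"
      then have "(\<lambda>w. w l) \<in> measurable (PiM A L) (L l)" using that by (intro measurable_component_singleton) auto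
      then show "(\<lambda>w. f l (w l)) \<in> borel_measurable (PiM A L)" by (rule measurable_compose[OF _ f_L])
    qed
    from measurable_compose[OF this Q] show ?thesis .
  qed
  \<comment> \<open>The target may have fewer or more coordinates than the source. The index set is
    enlarged to contain all source coordinates, which can then be split off from the refreshed ones
    in \<open>?K\<close>; \<open>?K\<close> is empty if the dimension does not increase.\<close>
  ultimately have "AE w in PiM (?I \<union> ?K) L. Q (?g (restrict w ?J))"
    by (subst L.AE_PiM_restrict) auto
  then have "AE w in PiM (?I \<union> ?K) L. Q (?g w)"
    by (simp cong: restrict_cong)
  moreover have "?J \<subseteq> ?I \<union> ?K" by auto
  ultimately have "AE x in PiM ?I L. AE v in PiM ?K L. Q (?g (merge ?I ?K (x, v)))"
    by (subst (asm) L.AE_PiM_merge[OF _ _ _ Q_g]) auto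
  moreover have PiM_I: "PiM ?I L = (\<Pi>\<^sub>M l\<in>?I. frozen_law F c l)"
    by (intro PiM_cong) (auto simp: L_def)
  moreover have PiM_K: "PiM ?K L = (\<Pi>\<^sub>M l\<in>?K. ?U)"
    by (intro PiM_cong) (auto simp: L_def)
  ultimately have "AE x in (\<Pi>\<^sub>M l\<in>?I. frozen_law F c l). AE v in (\<Pi>\<^sub>M l\<in>?K. ?U). Q (?g (merge ?I ?K (x, v)))"
    unfolding PiM_I PiM_K by blast
  then show ?thesis
    using AE_space
  proof (eventually_elim, intro impI)
    fix x assume AE_v: "AE v in (\<Pi>\<^sub>M l\<in>?K. ?U). Q (?g (merge ?I ?K (x, v)))"
      and x_space: "x \<in> space (\<Pi>\<^sub>M l\<in>?I. frozen_law F c l)" and x: "x \<in> region T i"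
    have "(\<lambda>v. merge ?I ?K (x, v)) \<in> measurable (PiM ?K L) (PiM (?I \<union> ?K) L)"
    proof -
      have "x \<in> space (PiM ?I L)" using x_space by (simp add: space_PiM L_def PiE_iff)
      from measurable_compose[OF measurable_Pair1'[OF this] measurable_merge] show ?thesis .
    qed
    then have "Measurable.pred (PiM ?K L) (\<lambda>v. Q (?g (merge ?I ?K (x, v))))"
      by (rule measurable_compose[OF _ Q_g]) auto
    then have v_pred: "Measurable.pred (\<Pi>\<^sub>M l\<in>?K. ?U) (\<lambda>v. Q (?g (merge ?I ?K (x, v))))"
      by (simp only: PiM_K)
    \<comment> \<open>The landing state reads only the finitely many refreshed coordinates in
      \<open>?K\<close>, so the statement lifts to the full auxiliary sequence.\<close>
    have "AE u in aux_seq. Q (?g (merge ?I ?K (x, restrict u ?K)))"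
      using AE_v by (subst U.AE_PiM_restrict[OF _ _ v_pred]) auto
    moreover have "?g (merge ?I ?K (x, restrict u ?K)) = ?g (\<lambda>l. if l < ?d then x l else u l)" for u
      by (auto simp: fun_eq_iff merge_def)
    ultimately have AE_u: "AE u in aux_seq. Q (?g (\<lambda>l. if l < ?d then x l else u l))" by simp
    have x': "x \<in> space (region_lebesgue T i)" using ij x by simp
    have splice: "(\<lambda>u l. if l < ?d then x l else u l) \<in> measurable aux_seq (augmented i)"
      using measurable_compose[OF measurable_Pair1'[OF x'] splice_measurable[OF ij(1)]] by simp
    have jump_eq: "restrict (jump_map T i j w) ?J = ?g w" if "w \<in> aug_region T i" for w
      using that by (auto simp: fun_eq_iff f_def jump_map_ext_coord[OF ij])
    have "AE u in aux_seq. Q (restrict (jump_map T i j (\<lambda>l. if l < ?d then x l else u l)) ?J)"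
      using AE_u AE_space
    proof eventually_elim
      case (elim u)
      have "(\<lambda>l. if l < ?d then x l else u l) \<in> aug_region T i"
        using measurable_space[OF splice elim(2)] by simp
      from jump_eq[OF this] elim(1) show ?case by simp
    qed
    moreover have "Measurable.pred (augmented i) (\<lambda>w. Q (restrict (jump_map T i j w) ?J))"
      by (rule measurable_compose[OF _ Q], rule measurable_restrict)
        (rule jump_map_component_measurable[OF ij])
    ultimately show "AE x' in refresh T i x. Q (restrict (jump_map T i j x') ?J)"
      unfolding refresh_def augmented_def[symmetric]
      by (subst AE_distr_iff[OF splice]) (auto simp: pred_def)
  qed
qed

lemma evades_AE:
  assumes N: "N \<in> sets (state_space T)"
    and null: "\<And>m. m \<in> models T \<Longrightarrow> AE x in (\<Pi>\<^sub>M l\<in>{..<dimn T m}. lborel). x \<in> region T m \<longrightarrow> (m, x) \<notin> N"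
    and m: "m \<in> models T"
  shows "AE x in (\<Pi>\<^sub>M l\<in>{..<dimn T m}. frozen_law F c l). x \<in> region T m \<longrightarrow> evades N n F (m, x)"
  using m
proof (induction n arbitrary: F c m)
  case (0 F c m)
  show ?case
  proof (cases "F = UNIV")
    \<comment> \<open>Now every factor is Gaussian, and the identity maps pull Lebesgue null sets
      back to Gaussian ones.\<close>
    case True
    have P: "Measurable.pred (\<Pi>\<^sub>M l\<in>{..<dimn T m}. lborel) (\<lambda>x. x \<in> region T m \<longrightarrow> (m, x) \<notin> N)"
    proof -
      have "Measurable.pred (state_space T) (\<lambda>s. s \<notin> N)" using N by measurable
      from region_pred_measurable[OF 0 this] show ?thesis
        by (subst measurable_cong_sets[OF sets_PiM_cong[OF refl] refl, of _ _ "\<lambda>_. borel"]) auto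
    qed
    have "AE x in (\<Pi>\<^sub>M l\<in>{..<dimn T m}. frozen_law F c l). (\<lambda>l\<in>{..<dimn T m}. x l) \<in> region T m \<longrightarrow> (m, (\<lambda>l\<in>{..<dimn T m}. x l)) \<notin> N"
    proof (rule AE_PiM_map[of "frozen_law F c" "\<lambda>_. lborel" "{..<dimn T m}" "\<lambda>_ t. t" "\<lambda>x. x \<in> region T m \<longrightarrow> (m, x) \<notin> N"])
      show "product_sigma_finite (frozen_law F c)" by unfold_locales
      show "product_sigma_finite (\<lambda>_::nat. lborel :: real measure)"
        by (intro product_sigma_finite.intro lborel.sigma_finite_measure_axioms)
      show "(\<lambda>t. t) \<in> measurable (frozen_law F c l) lborel" for l
        by (rule measurable_ident_sets) simp
      show "Z \<in> null_sets lborel \<Longrightarrow> (\<lambda>t. t) -` Z \<inter> space (frozen_law F c l) \<in> null_sets (frozen_law F c l)" for l Z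
        using True by (simp add: frozen_law_def null_sets_gaussian)
    qed (use P null[OF 0] in auto)
    then show ?thesis
      by eventually_elim (auto simp: restrict_region[OF 0] restrict_def[symmetric])
  next
    case False
    then show ?thesis by simp
  qed
next
  case (Suc n F c m)
  let ?I = "{..<dimn T m}"
  have pred: "Measurable.pred (\<Pi>\<^sub>M l\<in>{..<dimn T m'}. borel) (\<lambda>x. x \<in> region T m' \<longrightarrow> evades N n G (m', x))"
    if "m' \<in> models T" for m' G
    by (rule region_pred_measurable[OF that evades_measurable(1)[OF N]])
  \<comment> \<open>A rejection changes neither the point nor the randomized coordinates, so the
    induction hypothesis applies with the same \<open>F\<close> and \<open>c\<close>.\<close>
  have stay: "AE x in (\<Pi>\<^sub>M l\<in>?I. frozen_law F c l). x \<in> region T m \<longrightarrow> evades N n F (m, x)"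
    by (rule Suc.IH[OF Suc.prems])
  have update: "AE x in (\<Pi>\<^sub>M l\<in>?I. frozen_law F c l). \<forall>i\<in>?I. AE z in lborel.
      x(i := z) \<in> region T m \<longrightarrow> evades N n (insert i F) (m, x(i := z))"
  proof (rule AE_ball_countable')
    fix i assume i: "i \<in> ?I"
    show "AE x in (\<Pi>\<^sub>M l\<in>?I. frozen_law F c l). AE z in lborel.
        x(i := z) \<in> region T m \<longrightarrow> evades N n (insert i F) (m, x(i := z))"
      by (rule frozen_law_update_AE[OF _ i pred[OF Suc.prems] Suc.IH[OF Suc.prems]]) simp
  qed simp
  have jumps: "AE x in (\<Pi>\<^sub>M l\<in>?I. frozen_law F c l). \<forall>m'\<in>{m'\<in>models T. jump T m m' > 0}. x \<in> region T m \<longrightarrow>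
      (AE x' in refresh T m x. evades N n F (m', restrict (jump_map T m m' x') {..<dimn T m'}))"
  proof (rule AE_ball_countable')
    fix m' assume "m' \<in> {m'\<in>models T. jump T m m' > 0}"
    then have m': "m' \<in> models T" "jump T m m' > 0" by auto
    \<comment> \<open>The landing point is randomized also in the refreshed coordinates; the larger
      set is cut back to \<open>F\<close> below by monotonicity.\<close>
    let ?Q = "\<lambda>y. y \<in> region T m' \<longrightarrow> evades N n (F \<union> {dimn T m..}) (m', y)"
    have "AE x in (\<Pi>\<^sub>M l\<in>?I. frozen_law F c l). x \<in> region T m \<longrightarrow>
        (AE x' in refresh T m x. ?Q (restrict (jump_map T m m' x') {..<dimn T m'}))"
      by (rule jump_lands_AE[OF Suc.prems m' pred[OF m'(1)] Suc.IH[OF m'(1)]])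
    then show "AE x in (\<Pi>\<^sub>M l\<in>?I. frozen_law F c l). x \<in> region T m \<longrightarrow>
        (AE x' in refresh T m x. evades N n F (m', restrict (jump_map T m m' x') {..<dimn T m'}))"
    proof (eventually_elim, intro impI)
      fix x assume *: "x \<in> region T m \<longrightarrow> (AE x' in refresh T m x. ?Q (restrict (jump_map T m m' x') {..<dimn T m'}))"
        and x: "x \<in> region T m"
      have sp: "space (refresh T m x) = aug_region T m"
        by (simp add: refresh_def space_restrict_space space_PiM)
      have "AE x' in refresh T m x. ?Q (restrict (jump_map T m m' x') {..<dimn T m'})"
        using * x by blast
      then show "AE x' in refresh T m x. evades N n F (m', restrict (jump_map T m m' x') {..<dimn T m'})"
        using AE_space
      proof eventually_elim
        case (elim x')
        then have "restrict (jump_map T m m' x') {..<dimn T m'} \<in> region T m'" unfolding sp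
          using jump_map_mem[OF Suc.prems m', of x'] by (simp add: aug_region_def)
        with elim show ?case using evades_antimono[of F "F \<union> {dimn T m..}"] by auto
      qed
    qed
  qed simp
  show ?case
    using stay update jumps
  proof (eventually_elim, intro impI)
    fix x
    assume *: "x \<in> region T m \<longrightarrow> evades N n F (m, x)"
      "\<forall>i\<in>?I. AE z in lborel. x(i := z) \<in> region T m \<longrightarrow> evades N n (insert i F) (m, x(i := z))"
      "\<forall>m'\<in>{m'\<in>models T. jump T m m' > 0}. x \<in> region T m \<longrightarrow>
        (AE x' in refresh T m x. evades N n F (m', restrict (jump_map T m m' x') {..<dimn T m'}))"
      and x: "x \<in> region T m"
    have "AE p in labelled_step T (m, x). evades N n (F \<union> set_option (snd p)) (fst p)"
      by (rule labelled_step_AE[OF Suc.prems x evades_measurable(2)[OF N]]) (use * x in auto)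
    then show "evades N (Suc n) F (m, x)" by simp
  qed
qed

text \<open>For this \<open>F\<close> no state coordinate of model \<open>m\<close> is random. With
  frozen values \<open>x\<close> the product law is the Dirac measure at \<open>x\<close>, and an
  almost-everywhere statement becomes one about this very starting point.\<close>

lemma evades_from_start:
  assumes N: "N \<in> sets (state_space T)"
    and null: "\<And>m. m \<in> models T \<Longrightarrow> AE x in (\<Pi>\<^sub>M l\<in>{..<dimn T m}. lborel). x \<in> region T m \<longrightarrow> (m, x) \<notin> N"
    and m: "m \<in> models T" and x: "x \<in> region T m"
  shows "evades N n {dimn T m..} (m, x)"
proof -
  let ?I = "{..<dimn T m}" and ?F = "{dimn T m..}"
  let ?Q = "\<lambda>y. y \<in> region T m \<longrightarrow> evades N n ?F (m, y)"
  have "AE y in (\<Pi>\<^sub>M l\<in>?I. frozen_law ?F x l). ?Q y"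
    by (rule evades_AE[OF N null m])
  also have "(\<Pi>\<^sub>M l\<in>?I. frozen_law ?F x l) = (\<Pi>\<^sub>M l\<in>?I. return borel (x l))"
    by (intro PiM_cong) (auto simp: frozen_law_def)
  also have "\<dots> = return (\<Pi>\<^sub>M l\<in>?I. borel) x"
    by (subst PiM_return) (auto simp: restrict_region[OF m x] restrict_def[symmetric])
  finally have "AE y in return (\<Pi>\<^sub>M l\<in>?I. borel) x. ?Q y" .
  moreover have "x \<in> space (\<Pi>\<^sub>M l\<in>?I. borel)"
    using region_subset[OF m] x by (auto simp: space_PiM PiE_def)
  ultimately have "?Q x"
    using region_pred_measurable[OF m evades_measurable(1)[OF N, of n ?F]] by (subst (asm) AE_return) auto
  with x show ?thesis by simp
qed

section \<open>Passage from one-step statements to trajectories\<close>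

lemma labelled_chain: "markov_kernel (labelled_space T) (\<lambda>(s, _). labelled_step T s)"
proof
  show "(\<lambda>(s, _). labelled_step T s) \<in> measurable (labelled_space T) (prob_algebra (labelled_space T))"
    using measurable_compose[OF measurable_fst labelled_step_measurable]
    unfolding split_beta' labelled_space_def .
qed

lemma fst_labelled_measurable: "fst \<in> measurable (labelled_space T) (state_space T)"
  unfolding labelled_space_def by (rule measurable_fst)

lemma mcmc_chain: "markov_kernel (state_space T) (mcmc_kernel T)"
proof
  show "mcmc_kernel T \<in> measurable (state_space T) (prob_algebra (state_space T))"
    using measurable_compose[OF labelled_step_measurable measurable_distr_prob_space[OF fst_labelled_measurable]]
    by (simp add: mcmc_kernel_def[abs_def])
qed

lemma AE_path_labelled:
  assumes z: "z \<in> space (state_space T)" and N: "N \<in> sets (state_space T)"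
  shows "(AE \<omega> in markov_path (state_space T) (mcmc_kernel T) z. \<exists>n\<ge>1. \<omega> n \<notin> N) \<longleftrightarrow>
    (AE \<omega> in labelled_path T z. \<exists>n\<ge>1. fst (\<omega> n) \<notin> N)"
proof -
  interpret S: markov_kernel "state_space T" "mcmc_kernel T" by (rule mcmc_chain)
  interpret L: markov_kernel "labelled_space T" "\<lambda>(s, _). labelled_step T s" by (rule labelled_chain)
  have zl: "(z, None) \<in> space (labelled_space T)" using z by simp
  have eq: "distr (labelled_path T z) S.paths (\<lambda>\<omega> n. fst (\<omega> n)) = markov_path (state_space T) (mcmc_kernel T) z"
    unfolding labelled_path_def
    using S.markov_path_distr[OF labelled_chain fst_labelled_measurable _ zl]
    by (simp add: mcmc_kernel_def split_beta')
  have F: "(\<lambda>\<omega> n. fst (\<omega> n)) \<in> measurable (labelled_path T z) S.paths"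
  proof -
    have "(\<lambda>\<omega> n. fst (\<omega> n)) \<in> measurable L.paths S.paths"
    proof (rule measurable_PiM_single')
      fix n :: nat
      show "(\<lambda>\<omega>. fst (\<omega> n)) \<in> measurable L.paths (state_space T)"
        by (rule measurable_compose[OF _ fst_labelled_measurable, of "\<lambda>\<omega>. \<omega> n"]) simp
    qed (auto simp: space_PiM PiE_iff mem_Times_iff)
    then show ?thesis
      by (simp add: measurable_cong_sets[OF L.sets_path[OF zl] refl] labelled_path_def)
  qed
  note [measurable] = N
  have "{\<omega> \<in> space S.paths. \<exists>n\<ge>1. \<omega> n \<notin> N} \<in> sets S.paths" by measurable
  from AE_distr_iff[OF F this] show ?thesis unfolding eq .
qed

text \<open>Unrolls the recursion along a trajectory. Labels are counted from time 1 on, so the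
  label \<open>lab\<close> of the starting point may be arbitrary.\<close>

lemma evades_path_AE:
  assumes N: "N \<in> sets (state_space T)" and z: "z \<in> space (state_space T)" and ev: "evades N n F z"
  shows "AE \<omega> in markov_path (labelled_space T) (\<lambda>(s, _). labelled_step T s) (z, lab).
    \<not> (F \<union> {i. \<exists>k\<in>{1..n}. snd (\<omega> k) = Some i} = UNIV \<and> fst (\<omega> n) \<in> N)"
  using z ev
proof (induction n arbitrary: F z lab)
  interpret L: markov_kernel "labelled_space T" "\<lambda>(s, _). labelled_step T s" by (rule labelled_chain)
  note [measurable] = N fst_labelled_measurable
  case 0
  have zl: "(z, lab) \<in> space (labelled_space T)" using 0 by simp
  have "AE \<omega> in markov_path (labelled_space T) (\<lambda>(s, _). labelled_step T s) (z, lab). \<not> (F = UNIV \<and> fst (\<omega> 0) \<in> N)"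
    by (rule L.AE_path_start[OF zl, of "\<lambda>p. \<not> (F = UNIV \<and> fst p \<in> N)"]) (use 0 in auto)
  then show ?case by simp
next
  interpret L: markov_kernel "labelled_space T" "\<lambda>(s, _). labelled_step T s" by (rule labelled_chain)
  case (Suc n)
  let ?P = "markov_path (labelled_space T) (\<lambda>(s, _). labelled_step T s)"
  have zl: "(z, lab) \<in> space (labelled_space T)" using Suc by simp
  have snd_meas: "snd \<in> measurable (labelled_space T) (count_space UNIV)"
    unfolding labelled_space_def by (rule measurable_snd)
  note [measurable] = N fst_labelled_measurable snd_meas
  have event: "Measurable.pred L.paths (\<lambda>\<omega>. \<not> (F \<union> {i. \<exists>k\<in>{1..m}. snd (\<omega> k) = Some i} = UNIV \<and> fst (\<omega> m) \<in> N))" for m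
  proof -
    have "Measurable.pred L.paths (\<lambda>\<omega>. \<not> ((\<forall>i. i \<in> F \<or> (\<exists>k\<in>{1..m}. snd (\<omega> k) = Some i)) \<and> fst (\<omega> m) \<in> N))"
      by measurable
    then show ?thesis by (simp add: set_eq_iff)
  qed
  have "AE p in labelled_step T z. evades N n (F \<union> set_option (snd p)) (fst p)"
    using Suc.prems(2) by simp
  then have "AE p in (case (z, lab) of (s, _) \<Rightarrow> labelled_step T s). AE \<omega> in ?P p.
      \<not> (F \<union> {i. \<exists>k\<in>{1..Suc n}. snd (case_nat (z, lab) \<omega> k) = Some i} = UNIV \<and> fst (case_nat (z, lab) \<omega> (Suc n)) \<in> N)"
    unfolding prod.case using AE_space
  proof eventually_elim
    case (elim p)
    obtain s' lab' where p: "p = (s', lab')" by (cases p)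
    have p_space: "p \<in> space (labelled_space T)"
      using elim(2) L.space_kernel[OF zl] by simp
    have s': "s' \<in> space (state_space T)" using p_space p by simp
    \<comment> \<open>The label of the first step sits at time 0 of the shifted path. The induction
      hypothesis does not count it there, which is why it enters through the enlarged
      \<open>F\<close>.\<close>
    have "AE \<omega> in ?P p. snd (\<omega> 0) = lab'"
      by (rule L.AE_path_start[OF p_space, of "\<lambda>p. snd p = lab'"]) (use p in auto)
    moreover have "AE \<omega> in ?P p. \<not> ((F \<union> set_option lab') \<union> {i. \<exists>k\<in>{1..n}. snd (\<omega> k) = Some i} = UNIV \<and> fst (\<omega> n) \<in> N)"
      unfolding p by (rule Suc.IH[OF s']) (use elim p in simp)
    ultimately show ?case
    proof eventually_elim
      case (elim \<omega>)
      have "{i. \<exists>k\<in>{1..Suc n}. snd (case_nat (z, lab) \<omega> k) = Some i} \<subseteq> set_option lab' \<union> {i. \<exists>k\<in>{1..n}. snd (\<omega> k) = Some i}"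
      proof
        fix i assume "i \<in> {i. \<exists>k\<in>{1..Suc n}. snd (case_nat (z, lab) \<omega> k) = Some i}"
        then obtain k where k: "1 \<le> k" "k \<le> Suc n" "snd (case_nat (z, lab) \<omega> k) = Some i" by auto
        then obtain k' where "k = Suc k'" by (cases k) auto
        with k elim(1) show "i \<in> set_option lab' \<union> {i. \<exists>k\<in>{1..n}. snd (\<omega> k) = Some i}"
          by (cases k') auto
      qed
      with elim(2) show ?case by (simp only: nat.case) blast
    qed
  qed
  then show ?case
    by (subst L.AE_path_shift[OF zl event])
qed

lemma leaves_null_set:
  assumes N: "N \<in> sets (state_space T)"
    and null: "\<And>m. m \<in> models T \<Longrightarrow> AE x in (\<Pi>\<^sub>M l\<in>{..<dimn T m}. lborel). x \<in> region T m \<longrightarrow> (m, x) \<notin> N"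
    and z: "z \<in> space (state_space T)" and acc: "accepts_all_directions T z"
  shows "AE \<omega> in markov_path (state_space T) (mcmc_kernel T) z. \<exists>n\<ge>1. \<omega> n \<notin> N"
  unfolding AE_path_labelled[OF z N]
proof -
  obtain m x where z_eq: "z = (m, x)" by (cases z)
  have m: "m \<in> models T" and x: "x \<in> region T m" using z z_eq by auto
  let ?F = "{dimn T m..}"
  have "AE \<omega> in labelled_path T z. \<forall>n. \<not> (?F \<union> {i. \<exists>k\<in>{1..n}. snd (\<omega> k) = Some i} = UNIV \<and> fst (\<omega> n) \<in> N)"
    unfolding AE_all_countable labelled_path_def
    using evades_path_AE[OF N z evades_from_start[OF N null m x, folded z_eq]] by blast
  moreover have "AE \<omega> in labelled_path T z. \<forall>i<dimn T m. \<exists>n\<ge>1. snd (\<omega> n) = Some i"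
    using acc unfolding accepts_all_directions_def z_eq prod.case .
  ultimately show "AE \<omega> in labelled_path T z. \<exists>n\<ge>1. fst (\<omega> n) \<notin> N"
  proof eventually_elim
    case (elim \<omega>)
    from elim(2) obtain t where t: "\<And>i. i < dimn T m \<Longrightarrow> t i \<ge> 1 \<and> snd (\<omega> (t i)) = Some i" by metis
    \<comment> \<open>By this time every chosen acceptance has occurred. It is at least 1 because
      the dimension is positive.\<close>
    define n where "n = Max (t ` {..<dimn T m})"
    have t_le: "t i \<le> n" if "i < dimn T m" for i
      unfolding n_def using that by (intro Max_ge) auto
    have "?F \<union> {i. \<exists>k\<in>{1..n}. snd (\<omega> k) = Some i} = UNIV"
      using t t_le by (force simp: not_le)
    with elim(1) have "fst (\<omega> n) \<notin> N" by blast
    moreover have "n \<ge> 1" using t[of 0] t_le[of 0] dimn_pos[OF m] by auto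
    ultimately show ?case by blast
  qed
qed

section \<open>Null sets of the target distribution\<close>

lemma model_dist_subprob:
  assumes m: "m \<in> models T"
  shows "subprob_space (model_dist T m)"
proof (rule subprob_spaceI)
  note [measurable] = dens_measurable[OF m]
  have "emeasure (model_dist T m) (space (model_dist T m)) =
      (\<integral>\<^sup>+x. ennreal (dens T m x) / mass T m \<partial>region_lebesgue T m)"
    unfolding model_dist_def by (subst emeasure_density) (auto intro!: nn_integral_cong simp: indicator_def)
  also have "\<dots> = mass T m / mass T m"
    unfolding mass_def by (rule nn_integral_divide) measurable
  \<comment> \<open>The quotient is 1 for positive finite mass and 0 for mass 0; a bound by 1 is all
    that \<open>bind\<close> asks for.\<close>
  also have "\<dots> \<le> 1"
    using mass_finite[OF m] by (cases "mass T m = 0") (auto simp: ennreal_divide_self)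
  finally show "emeasure (model_dist T m) (space (model_dist T m)) \<le> 1" .
  show "space (model_dist T m) \<noteq> {}"
    using region_nonempty[OF m] m by (simp add: model_dist_def)
qed

lemma sets_model_dist [simp, measurable_cong]: "sets (model_dist T m) = sets (region_lebesgue T m)"
  by (simp add: model_dist_def)

lemma return_pair_measurable:
  "m \<in> models T \<Longrightarrow>
    (\<lambda>x. return (state_space T) (m, x)) \<in> measurable (model_dist T m) (subprob_algebra (state_space T))"
  using measurable_compose[OF measurable_Pair_state return_measurable, of m]
  by (simp add: measurable_cong_sets[OF sets_model_dist refl])

lemma model_component_measurable:
  "(\<lambda>m. model_dist T m \<bind> (\<lambda>x. return (state_space T) (m, x))) \<in>
    measurable (point_measure (models T) (\<lambda>m. ennreal (weight T m))) (subprob_algebra (state_space T))"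
  using subprob_space.bind_in_space[OF model_dist_subprob return_pair_measurable] by auto

lemma sets_target: "sets (target T) = sets (state_space T)"
  unfolding target_def
  using measurable_space[OF model_component_measurable] two_models
  by (subst sets_bind[where N="state_space T"]) (auto simp: space_subprob_algebra space_point_measure)

lemma null_sets_target_AE:
  assumes N: "N \<in> null_sets (target T)" and m: "m \<in> models T"
  shows "AE x in (\<Pi>\<^sub>M l\<in>{..<dimn T m}. lborel). x \<in> region T m \<longrightarrow> (m, x) \<notin> N"
proof -
  have N_sets[measurable]: "N \<in> sets (state_space T)" using N sets_target by auto
  note [measurable] = dens_measurable[OF m]
  have pred: "Measurable.pred (state_space T) (\<lambda>s. s \<notin> N)" by measurable
  have "AE s in target T. s \<notin> N" by (rule AE_not_in[OF N])
  then have "AE m in point_measure (models T) (\<lambda>m. ennreal (weight T m)).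
      AE s in model_dist T m \<bind> (\<lambda>x. return (state_space T) (m, x)). s \<notin> N"
    unfolding target_def AE_bind[OF model_component_measurable pred] .
  \<comment> \<open>All weights are positive, so an almost-sure statement about the model index
    holds for each model.\<close>
  then have "AE s in model_dist T m \<bind> (\<lambda>x. return (state_space T) (m, x)). s \<notin> N"
    using m weight_bounds[OF m] unfolding point_measure_def
    by (subst (asm) AE_density) (auto simp: AE_count_space)
  then have "AE x in model_dist T m. AE s in return (state_space T) (m, x). s \<notin> N"
    unfolding AE_bind[OF return_pair_measurable[OF m] pred] .
  then have "AE x in region_lebesgue T m. 0 < ennreal (dens T m x) / mass T m \<longrightarrow>
      (AE s in return (state_space T) (m, x). s \<notin> N)"
    unfolding model_dist_def by (subst (asm) AE_density) auto
  then have "AE x in region_lebesgue T m. (m, x) \<notin> N"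
    using AE_space
  proof eventually_elim
    case (elim x)
    then have x: "x \<in> region T m" using m by simp
    \<comment> \<open>Division by an infinite mass would give 0, so finiteness of the mass enters
      here together with positivity of the density.\<close>
    have "0 < ennreal (dens T m x) / mass T m"
      using dens_pos[OF m x] mass_finite[OF m] by (simp add: ennreal_zero_less_divide)
    with elim have "AE s in return (state_space T) (m, x). s \<notin> N" by simp
    then show ?case using m x pred by (subst (asm) AE_return) auto
  qed
  then show ?thesis
    unfolding region_lebesgue_def
    using sets_region[OF m] by (subst (asm) AE_restrict_space_iff) auto
qed

end

theorem theorem21:
  fixes T :: transdim
  assumes "transdim_mcmc T"
    and "coordinate_preserving T"
    and "stationary (mcmc_kernel T) (target T)"
    and "phi_irreducible (state_space T) (mcmc_kernel T)"
    and "\<And>z. z \<in> space (state_space T) \<Longrightarrow> accepts_all_directions T z"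
  shows "harris_recurrent (state_space T) (mcmc_kernel T) (target T)"
proof -
  interpret coordinate_preserving_mcmc T
    by (intro coordinate_preserving_mcmc.intro coordinate_preserving_mcmc_axioms.intro assms)
  interpret markov_kernel "state_space T" "mcmc_kernel T" by (rule mcmc_chain)
  show ?thesis
  proof (rule harris_recurrent_if_leaves_null_sets[OF assms(3) sets_target assms(4)])
    fix z N assume z: "z \<in> space (state_space T)" and N: "N \<in> null_sets (target T)"
    then have "N \<in> sets (state_space T)" using sets_target by auto
    then show "AE \<omega> in markov_path (state_space T) (mcmc_kernel T) z. \<exists>n\<ge>1. \<omega> n \<notin> N"
      using null_sets_target_AE[OF N] z assms(5)[OF z] by (rule leaves_null_set)
  qed
qed

end
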